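(* For every positive integer $m \geq 1$, there exist chiral $4$-polytopes $\mathcal{P}_m$ and $\mathcal{Q}_m$ (that is, chiral abstract polytopes of rank $4$), each of Schläfli type $\{4,4,4\}$, such that the automorphism group of $\mathcal{P}_m$ is a solvable group of order $1024m^2$ and the automorphism group of $\mathcal{Q}_m$ is a solvable group of order $2048m^2$.
   Context: An abstract polytope of rank $n$ (an $n$-polytope) is a partially ordered set $\mathcal{P}$ endowed with a strictly monotone rank function with range $\{-1,0,\dots,n\}$, satisfying (P1)-(P4) below. Elements of $\mathcal{P}$ are called faces, and elements of rank $j$ are called $j$-faces. Two faces $F,G$ are incident if $F\le G$ or $F\ge G$. A chain is a totally ordered subset of $\mathcal{P}$, and it has length $i$ if it contains exactly $i+1$ faces. Maximal chains are called flags. Two flags are $j$-adjacent if they differ in exactly one face, of rank $j$, and adjacent if they are $j$-adjacent for some $j$. For faces $F\le G$, the section $G/F$ is the set $\{H\in\mathcal{P} : F\le H\le G\}$, which has rank $\operatorname{rank}(G)-\operatorname{rank}(F)-1$; a section of rank $d$ is called a $d$-section. (P1) $\mathcal{P}$ has a least face $F_{-1}$ and a greatest face $F_n$. (P2) Each flag has length $n+1$ (so it has exactly $n+2$ faces, including $F_{-1}$ and $F_n$). (P3) Strong flag-connectedness: any two flags $\Phi,\Psi$ can be joined by a sequence of flags $\Phi=\Phi_0,\Phi_1,\dots,\Phi_k=\Psi$ with successive flags adjacent and each $\Phi_i$ containing $\Phi\cap\Psi$. (P4) Diamond condition: if $F<G$ are faces of ranks $i-1$ and $i+1$ respectively, where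 $0\le i\le n-1$, then there are precisely two $i$-faces $H$ with $F<H<G$. Every $2$-section of $\mathcal{P}$ is isomorphic to the face lattice of a polygon. $\mathcal{P}$ is equivelar of Schläfli type (or just type) $\{k_1,\dots,k_{n-1}\}$ if, for each $1\le i\le n-1$, every $2$-section $G/F$ with $F$ an $(i-2)$-face and $G$ an $(i+1)$-face incident with $F$ is the face lattice of a $k_i$-gon (i.e. has exactly $k_i$ edges). An automorphism of $\mathcal{P}$ is an order-preserving permutation of its elements (an automorphism of the poset, which preserves ranks), and the automorphism group of $\mathcal{P}$ is the group of all automorphisms under composition. $\mathcal{P}$ is chiral if its automorphism group has exactly two orbits on the set of flags, with every two adjacent flags lying in different orbits. *)

theory Defs
  imports "HOL-Algebra.Algebra"
begin

text \<open>
  A poset is given by a reflexive partial order relation \<open>r\<close> in the sense of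
  HOL.Order_Relation; since \<open>r\<close> is reflexive on \<open>Field r\<close>, its elements
  are exactly the members of \<open>Field r\<close>.
\<close>

definition flags :: "'a rel \<Rightarrow> 'a set set" where
  "flags r = {\<Phi> \<in> Chains r. \<forall>\<Psi> \<in> Chains r. \<Phi> \<subseteq> \<Psi> \<longrightarrow> \<Psi> = \<Phi>}"

definition j_adjacent :: "('a \<Rightarrow> int) \<Rightarrow> int \<Rightarrow> 'a set \<Rightarrow> 'a set \<Rightarrow> bool" where
  "j_adjacent rk j \<Phi> \<Psi> \<longleftrightarrow>
     (\<exists>F G. \<Phi> - \<Psi> = {F} \<and> \<Psi> - \<Phi> = {G} \<and> rk F = j \<and> rk G = j)"

definition adjacent :: "('a \<Rightarrow> int) \<Rightarrow> 'a set \<Rightarrow> 'a set \<Rightarrow> bool" where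
  "adjacent rk \<Phi> \<Psi> \<longleftrightarrow> (\<exists>j. j_adjacent rk j \<Phi> \<Psi>)"

definition poset_section :: "'a rel \<Rightarrow> 'a \<Rightarrow> 'a \<Rightarrow> 'a set" where
  "poset_section r G F = {H. (F, H) \<in> r \<and> (H, G) \<in> r}"

locale abstract_polytope =
  fixes n :: nat and r :: "'a rel" and rk :: "'a \<Rightarrow> int"
  assumes partial_order: "partial_order_on (Field r) r"
    and rank_strict_mono: "\<And>F G. (F, G) \<in> r \<Longrightarrow> F \<noteq> G \<Longrightarrow> rk F < rk G"
    and rank_range: "rk ` Field r = {-1..int n}"
    and P1_least: "\<exists>F \<in> Field r. \<forall>G \<in> Field r. (F, G) \<in> r"
    and P1_greatest: "\<exists>G \<in> Field r. \<forall>F \<in> Field r. (F, G) \<in> r"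
    and P2: "\<And>\<Phi>. \<Phi> \<in> flags r \<Longrightarrow> card \<Phi> = n + 2"
    and P3: "\<And>\<Phi> \<Psi>. \<Phi> \<in> flags r \<Longrightarrow> \<Psi> \<in> flags r \<Longrightarrow>
      (\<Phi>, \<Psi>) \<in> {(\<Phi>', \<Psi>'). \<Phi>' \<in> flags r \<and> \<Psi>' \<in> flags r \<and> adjacent rk \<Phi>' \<Psi>' \<and>
                         \<Phi> \<inter> \<Psi> \<subseteq> \<Phi>' \<and> \<Phi> \<inter> \<Psi> \<subseteq> \<Psi>'}\<^sup>*"
    and P4: "\<And>i F G. 0 \<le> i \<Longrightarrow> i \<le> int n - 1 \<Longrightarrow> (F, G) \<in> r \<Longrightarrow> F \<noteq> G \<Longrightarrow>
      rk F = i - 1 \<Longrightarrow> rk G = i + 1 \<Longrightarrow>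
      card {H. rk H = i \<and> (F, H) \<in> r \<and> F \<noteq> H \<and> (H, G) \<in> r \<and> H \<noteq> G} = 2"

text \<open>
  The list \<open>ks\<close> is \<open>[k\<^sub>1, \<dots>, k\<^sub>n\<^sub>-\<^sub>1]\<close>, so that \<open>k\<^sub>i\<close> is \<open>ks ! (i - 1)\<close>.
  The edges (1-faces) of a 2-section \<open>G/F\<close> with \<open>F\<close> an \<open>(i - 2)\<close>-face are its
  members that have rank \<open>i\<close> in the whole polytope.
\<close>

definition has_schlafli_type :: "nat \<Rightarrow> 'a rel \<Rightarrow> ('a \<Rightarrow> int) \<Rightarrow> nat list \<Rightarrow> bool" where
  "has_schlafli_type n r rk ks \<longleftrightarrow>
     length ks = n - 1 \<and>
     (\<forall>i \<in> {1..n - 1}. \<forall>F G. (F, G) \<in> r \<and> rk F = int i - 2 \<and> rk G = int i + 1 \<longrightarrow>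
        finite {H \<in> poset_section r G F. rk H = int i} \<and>
        card {H \<in> poset_section r G F. rk H = int i} = ks ! (i - 1))"

definition poset_auts :: "'a rel \<Rightarrow> ('a \<Rightarrow> 'a) set" where
  "poset_auts r =
     {\<phi> \<in> Bij (Field r). \<forall>x \<in> Field r. \<forall>y \<in> Field r. (x, y) \<in> r \<longleftrightarrow> (\<phi> x, \<phi> y) \<in> r}"

definition aut_group :: "'a rel \<Rightarrow> ('a \<Rightarrow> 'a) monoid" where
  "aut_group r = BijGroup (Field r) \<lparr>carrier := poset_auts r\<rparr>"

lemma subgroup_poset_auts: "subgroup (poset_auts r) (BijGroup (Field r))"
proof (rule group.subgroupI[OF group_BijGroup])
  show "poset_auts r \<subseteq> carrier (BijGroup (Field r))"
    by (auto simp: poset_auts_def BijGroup_def)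
  have "(\<lambda>x\<in>Field r. x) \<in> poset_auts r"
    by (simp add: poset_auts_def id_Bij)
  then show "poset_auts r \<noteq> {}" by blast
next
  fix f assume f: "f \<in> poset_auts r"
  then have fB: "f \<in> Bij (Field r)"
    and iso: "\<And>x y. x \<in> Field r \<Longrightarrow> y \<in> Field r \<Longrightarrow> (x, y) \<in> r \<longleftrightarrow> (f x, f y) \<in> r"
    by (auto simp: poset_auts_def)
  let ?g = "inv_into (Field r) f"
  have img: "f ` Field r = Field r" using fB by (simp add: Bij_def bij_betw_def)
  have "(x, y) \<in> r \<longleftrightarrow> (?g x, ?g y) \<in> r" if "x \<in> Field r" "y \<in> Field r" for x y
    using iso[OF Bij_inv_into_mem[OF fB that(1)] Bij_inv_into_mem[OF fB that(2)]] that img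
    by (simp add: f_inv_into_f)
  then show "inv\<^bsub>BijGroup (Field r)\<^esub> f \<in> poset_auts r"
    by (simp add: poset_auts_def inv_BijGroup[OF fB] restrict_inv_into_Bij[OF fB])
next
  fix f g assume f: "f \<in> poset_auts r" and g: "g \<in> poset_auts r"
  then have B: "f \<in> Bij (Field r)" "g \<in> Bij (Field r)" by (auto simp: poset_auts_def)
  have "g x \<in> Field r" if "x \<in> Field r" for x
    using Bij_imp_funcset[OF B(2)] that by auto
  then have "compose (Field r) f g \<in> poset_auts r"
    using f g B compose_Bij[OF B] by (simp add: poset_auts_def compose_eq)
  then show "f \<otimes>\<^bsub>BijGroup (Field r)\<^esub> g \<in> poset_auts r"
    using B by (simp add: BijGroup_def)
qed

lemma group_aut_group: "group (aut_group r)"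
  unfolding aut_group_def
  by (rule subgroup.subgroup_is_group[OF subgroup_poset_auts group_BijGroup])

locale chiral_polytope = abstract_polytope +
  assumes two_orbits: "card (orbits (aut_group r) (flags r) (`)) = 2"
    and adjacent_orbits: "\<And>\<Phi> \<Psi>. \<Phi> \<in> flags r \<Longrightarrow> \<Psi> \<in> flags r \<Longrightarrow> adjacent rk \<Phi> \<Psi> \<Longrightarrow>
      orbit (aut_group r) (`) \<Phi> \<noteq> orbit (aut_group r) (`) \<Psi>"

end

theory Submission
  imports Defs "HOL-Library.Product_Plus" "HOL-Library.Countable"
begin

text \<open>
  A polytope of rank \<open>n\<close> is encoded by its set of flags together with the involutions
  \<open>r\<^sub>0, \<dots>, r\<^sub>n\<^sub>-\<^sub>1\<close>, where \<open>r\<^sub>j\<close> sends a flag to its \<open>j\<close>-adjacent flag. The \<open>i\<close>-faces are the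
  orbits of the group generated by the \<open>r\<^sub>j\<close> with \<open>j \<noteq> i\<close>, the polytope axioms reduce to one
  intersection property of such orbits, and the automorphisms are the permutations of the flags
  that commute with all \<open>r\<^sub>j\<close>.

  The Coxeter group \<open>[4,4,4]\<close> is a semidirect product of \<open>[4,4]\<close> with the right-angled Coxeter group
  \<open>M\<close> that has one generator for each square of the square tessellation, adjacent squares
  commuting. So a polytope of type \<open>{4,4,4}\<close> with toroidal facets can be given by an action of \<open>M\<close> on
  the set of facets: a generator moves a facet to its neighbour across the corresponding square.
  We use an action of \<open>M\<close> on 32 facets, through a group of order 64, whose point stabiliser (of
  order 2) is normalised by the rotations in \<open>[4,4,4]\<close> but not by the reflections; this is
  the source of chirality. The action depends only on the class of a square modulo the lattice
  spanned by \<open>(2,2)\<close> and \<open>(2,-2)\<close>, so the squares may be identified modulo any sublattice \<open>\<Lambda>\<close> with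
  the symmetry of the square. The automorphism group then has order \<open>128\<close> times the index of
  \<open>\<Lambda>\<close>; the lattices spanned by \<open>(2m,2m), (2m,-2m)\<close> and by \<open>(4m,0), (0,4m)\<close> have index \<open>8m\<^sup>2\<close> and
  \<open>16m\<^sup>2\<close>.
\<close>

section \<open>Polytopes from flags\<close>

text \<open>Crossing four squares whose colours \<open>(a, b, d)\<close> sum to zero restores
  \<open>(p, i, j, q)\<close> and adds to \<open>c\<close> a constant plus \<open>p\<close> times
  the sum of the four products \<open>a * b\<close>. If that sum is odd, the facets with one value
  of \<open>p\<close> are fixed and all others are moved: this is the nontrivial element of a point
  stabiliser, and the obstruction to reflections. Accordingly, translations and quarter turns of the
  squares extend to symmetries that keep \<open>p\<close>, whereas a mirror extends only together
  with a negation of \<open>p\<close>. So \<open>p\<close> is tied to the orientation of a frame: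
  whether the two agree (\<open>par\<close>) changes under every adjacency, is kept by every
  automorphism, and is the only invariant of a flag. There are \<open>32 * 8\<close> flags for each
  class of squares modulo \<Lambda>, and the automorphisms act freely on them with two orbits of
  equal size, whence the factor 128.\<close>

inductive_set orb :: "(int \<Rightarrow> 'f \<Rightarrow> 'f) \<Rightarrow> int set \<Rightarrow> 'f \<Rightarrow> 'f set"
  for r :: "int \<Rightarrow> 'f \<Rightarrow> 'f" and J :: "int set" and w :: 'f where
  orb_base: "w \<in> orb r J w"
| orb_step: "v \<in> orb r J w \<Longrightarrow> j \<in> J \<Longrightarrow> r j v \<in> orb r J w"

lemma orb_trans: "u \<in> orb r J v \<Longrightarrow> v \<in> orb r J w \<Longrightarrow> u \<in> orb r J w"
  by (induction rule: orb.induct) (auto intro: orb.intros)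

lemma orb_mono: "v \<in> orb r J w \<Longrightarrow> J \<subseteq> K \<Longrightarrow> v \<in> orb r K w"
  by (induction rule: orb.induct) (auto intro: orb.intros)

lemma orb_invariant:
  assumes "v \<in> orb r J w" and "P w" and "\<And>u j. P u \<Longrightarrow> j \<in> J \<Longrightarrow> P (r j u)"
  shows "P v"
  using assms by (induction rule: orb.induct) auto

lemma orb_singleton:
  assumes "v \<in> orb r {j} w" "r j (r j w) = w"
  shows "v = w \<or> v = r j w"
  using assms(1) by (rule orb_invariant) (use assms(2) in auto)

locale flag_system =
  fixes n :: nat and \<Omega> :: "'f set" and r :: "int \<Rightarrow> 'f \<Rightarrow> 'f"
  assumes finite_flags: "finite \<Omega>"
    and flags_nonempty: "\<Omega> \<noteq> {}"
    and closed: "\<And>j w. j \<in> {0..<int n} \<Longrightarrow> w \<in> \<Omega> \<Longrightarrow> r j w \<in> \<Omega>"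
    and invol: "\<And>j w. j \<in> {0..<int n} \<Longrightarrow> w \<in> \<Omega> \<Longrightarrow> r j (r j w) = w"
    and far_commute: "\<And>i j w. i \<in> {0..<int n} \<Longrightarrow> j \<in> {0..<int n} \<Longrightarrow> i + 2 \<le> j \<Longrightarrow> w \<in> \<Omega> \<Longrightarrow>
      r i (r j w) = r j (r i w)"
    and connected: "\<And>v w. v \<in> \<Omega> \<Longrightarrow> w \<in> \<Omega> \<Longrightarrow> v \<in> orb r {0..<int n} w"
    and intersection: "\<And>i k v w. -1 \<le> i \<Longrightarrow> i < k \<Longrightarrow> k \<le> int n \<Longrightarrow> w \<in> \<Omega> \<Longrightarrow>
      v \<in> orb r {i<..<int n} w \<Longrightarrow> v \<in> orb r {0..<k} w \<Longrightarrow> v \<in> orb r {i<..<k} w"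
begin

abbreviation "idx \<equiv> {0..<int n}"

lemma orb_in: "v \<in> orb r J w \<Longrightarrow> w \<in> \<Omega> \<Longrightarrow> J \<subseteq> idx \<Longrightarrow> v \<in> \<Omega>"
  by (induction rule: orb.induct) (use closed in auto)

lemma orb_sym:
  assumes "v \<in> orb r J w" "w \<in> \<Omega>" "J \<subseteq> idx"
  shows "w \<in> orb r J v"
  using assms
proof (induction rule: orb.induct)
  case orb_base
  show ?case by (rule orb.orb_base)
next
  case (orb_step v j)
  have v: "v \<in> \<Omega>" using orb_in[OF orb_step.hyps(1)] orb_step.prems by auto
  have "r j (r j v) \<in> orb r J (r j v)"
    by (intro orb.orb_step orb.orb_base orb_step.hyps)
  then have "v \<in> orb r J (r j v)" using invol v orb_step by auto
  then show ?case using orb_step orb_trans by metis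
qed

lemma commute:
  assumes "i \<in> idx" "j \<in> idx" "2 \<le> \<bar>i - j\<bar>" "w \<in> \<Omega>"
  shows "r i (r j w) = r j (r i w)"
  using far_commute[of i j w] far_commute[of j i w] assms by fastforce

lemma orb_commute:
  assumes "v \<in> orb r A w" "w \<in> \<Omega>" "A \<subseteq> idx" "b \<in> idx" "\<And>a. a \<in> A \<Longrightarrow> 2 \<le> \<bar>b - a\<bar>"
  shows "r b v \<in> orb r A (r b w)"
  using assms
proof (induction rule: orb.induct)
  case orb_base
  then show ?case by (simp add: orb.orb_base)
next
  case (orb_step v j)
  have "v \<in> \<Omega>" using orb_in[OF orb_step.hyps(1)] orb_step.prems by auto
  then have "r b (r j v) = r j (r b v)"
    by (intro commute) (use orb_step in auto)
  then show ?case using orb_step by (auto intro: orb.orb_step)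
qed

text \<open>Letters from \<open>A\<close> commute with letters from \<open>B\<close>, so those from
  \<open>B\<close> can be moved to the beginning of the path from \<open>w\<close>.\<close>

lemma orb_decompose:
  assumes "v \<in> orb r (A \<union> B) w" "w \<in> \<Omega>" "A \<subseteq> idx" "B \<subseteq> idx"
    and far: "\<And>a b. a \<in> A \<Longrightarrow> b \<in> B \<Longrightarrow> 2 \<le> \<bar>b - a\<bar>"
  shows "\<exists>u \<in> orb r B w. v \<in> orb r A u"
  using assms(1)
proof (induction rule: orb.induct)
  case orb_base
  show ?case by (blast intro: orb.orb_base)
next
  case (orb_step v j)
  then obtain u where u: "u \<in> orb r B w" "v \<in> orb r A u" by blast
  have "u \<in> \<Omega>" using orb_in[OF u(1) assms(2,4)] .
  show ?case
  proof (cases "j \<in> A")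
    case True
    then show ?thesis using u(1) orb.orb_step[OF u(2)] by blast
  next
    case False
    then have j: "j \<in> B" using orb_step.hyps by blast
    have "r j v \<in> orb r A (r j u)"
      by (rule orb_commute[OF u(2) \<open>u \<in> \<Omega>\<close> assms(3)]) (use j far assms(4) in auto)
    then show ?thesis using orb.orb_step[OF u(1) j] by blast
  qed
qed

lemma orb_splitE:
  assumes "v \<in> orb r J w" "w \<in> \<Omega>" "J \<subseteq> A \<union> B" "A \<subseteq> idx" "B \<subseteq> idx"
    and "\<And>a b. a \<in> A \<Longrightarrow> b \<in> B \<Longrightarrow> 2 \<le> \<bar>b - a\<bar>"
  obtains u where "u \<in> orb r B w" "v \<in> orb r A u" "u \<in> \<Omega>"
  using orb_decompose[OF orb_mono[OF assms(1,3)] assms(2,4-6)] orb_in assms(2,5) by blast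

text \<open>Bootstraps \<open>intersection\<close>, which speaks of intervals of indices only, to
  arbitrary sets of omitted indices. Strong flag-connectedness and the injectivity of
  \<open>fl\<close> rest on it.\<close>

lemma orb_path_intersection:
  assumes "finite I" "w \<in> \<Omega>" "v \<in> \<Omega>" "I \<subseteq> {-1..int n}"
    and "\<And>i. i \<in> I \<Longrightarrow> v \<in> orb r (idx - {i}) w"
  shows "v \<in> orb r (idx - I) w"
  using assms(1,4,5)
proof (induction rule: finite_linorder_max_induct)
  case empty
  then show ?case using connected assms by simp
next
  case (insert k I)
  show ?case
  proof (cases "I = {}")
    case True
    then show ?thesis using insert by auto
  next
    case False
    define l where "l = Max I"
    have l: "l \<in> I" "\<And>i. i \<in> I \<Longrightarrow> i \<le> l" using insert False by (auto simp: l_def)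
    have lk: "l < k" "-1 \<le> l" "k \<le> int n" using l insert by auto
    \<comment> \<open>The path from the induction hypothesis is split at \<open>l\<close> and the
      path that omits \<open>k\<close> is split at \<open>k\<close>; \<open>w1\<close> and
      \<open>w2\<close> are the flags where they turn from high to low indices.\<close>
    let ?A = "{a \<in> idx - I. a < l}" and ?B = "{l<..<int n}"
    let ?A' = "{0..<k}" and ?B' = "{k<..<int n}"
    have IH: "v \<in> orb r (idx - I) w" using insert by auto
    have "idx - I \<subseteq> ?A \<union> ?B" using l(1) by (auto simp: not_less order_le_less)
    then obtain w1 where w1: "w1 \<in> orb r ?B w" "v \<in> orb r ?A w1" "w1 \<in> \<Omega>"
      by (rule orb_splitE[OF IH \<open>w \<in> \<Omega>\<close>]) (use lk in auto)
    have vk: "v \<in> orb r (idx - {k}) w" using insert by auto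
    have "idx - {k} \<subseteq> ?A' \<union> ?B'" by auto
    then obtain w2 where w2: "w2 \<in> orb r ?B' w" "v \<in> orb r ?A' w2" "w2 \<in> \<Omega>"
      by (rule orb_splitE[OF vk \<open>w \<in> \<Omega>\<close>]) (use lk in auto)
    note \<Omega> = w1(3) w2(3)
    have "w1 \<in> orb r ?A v" by (rule orb_sym) (use w1 \<Omega> in auto)
    then have "w1 \<in> orb r ?A' v" by (rule orb_mono) (use lk in auto)
    then have 1: "w1 \<in> orb r {0..<k} w2" using w2 orb_trans by metis
    have "w \<in> orb r ?B' w2" by (rule orb_sym) (use w2 \<open>w \<in> \<Omega>\<close> lk in auto)
    then have "w \<in> orb r ?B w2" by (rule orb_mono) (use lk in auto)
    then have 2: "w1 \<in> orb r {l<..<int n} w2" using w1 orb_trans by metis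
    \<comment> \<open>The turning points are joined both below \<open>k\<close> and above
      \<open>l\<close>, hence strictly between. The new path goes from \<open>w\<close> to
      \<open>w2\<close> above \<open>k\<close>, on to \<open>w1\<close> between \<open>l\<close> and
      \<open>k\<close>, and to \<open>v\<close> below \<open>l\<close>.\<close>
    have 3: "w1 \<in> orb r {l<..<k} w2"
      using intersection[OF _ _ _ \<Omega>(2) 2 1] lk by auto
    have "w1 \<in> orb r (idx - insert k I) w2"
      by (rule orb_mono[OF 3]) (use l lk in force)
    moreover have "w2 \<in> orb r (idx - insert k I) w"
      by (rule orb_mono[OF w2(1)]) (use l lk in force)
    moreover have "v \<in> orb r (idx - insert k I) w1"
      by (rule orb_mono[OF w1(2)]) (use lk in force)
    ultimately show ?thesis using orb_trans by metis
  qed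
qed

end

section \<open>The poset of faces of a flag system\<close>

locale face_labelling = flag_system n \<Omega> r for n :: nat and \<Omega> :: "'f set" and r +
  fixes fc :: "int \<Rightarrow> 'f \<Rightarrow> 'a"
  assumes fc_eq_iff: "\<And>i j v w. i \<in> {-1..int n} \<Longrightarrow> j \<in> {-1..int n} \<Longrightarrow> v \<in> \<Omega> \<Longrightarrow> w \<in> \<Omega> \<Longrightarrow>
      fc i v = fc j w \<longleftrightarrow> i = j \<and> v \<in> orb r ({0..<int n} - {i}) w"
    and fixed_point_free: "\<And>j w. j \<in> {0..<int n} \<Longrightarrow> w \<in> \<Omega> \<Longrightarrow> r j w \<noteq> w"
begin

abbreviation "ranks \<equiv> {-1..int n}"

text \<open>Faces are related when they lie in a common flag, which is not visibly transitive. For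
  the ranks \<open>-1\<close> and \<open>n\<close> the set \<open>idx - {i}\<close> is all of
  \<open>idx\<close>, so connectedness leaves a single face of each of these ranks.\<close>

definition le :: "'a rel" where
  "le = {(fc i w, fc j w) |i j w. w \<in> \<Omega> \<and> -1 \<le> i \<and> i \<le> j \<and> j \<le> int n}"

definition rk :: "'a \<Rightarrow> int" where
  "rk x = (THE i. i \<in> ranks \<and> (\<exists>w \<in> \<Omega>. x = fc i w))"

definition fl :: "'f \<Rightarrow> 'a set" where
  "fl w = (\<lambda>i. fc i w) ` ranks"

lemma rk_fc [simp]: "i \<in> ranks \<Longrightarrow> w \<in> \<Omega> \<Longrightarrow> rk (fc i w) = i"
  unfolding rk_def by (rule the_equality) (use fc_eq_iff in blast)+

lemma Field_le: "Field le = {fc i w |i w. i \<in> ranks \<and> w \<in> \<Omega>}"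
proof (intro equalityI subsetI)
  fix x assume "x \<in> Field le"
  then show "x \<in> {fc i w |i w. i \<in> ranks \<and> w \<in> \<Omega>}"
    unfolding Field_def le_def by fastforce
next
  fix x assume "x \<in> {fc i w |i w. i \<in> ranks \<and> w \<in> \<Omega>}"
  then obtain i w where "i \<in> ranks" "w \<in> \<Omega>" "x = fc i w" by blast
  then have "(x, x) \<in> le" unfolding le_def by auto
  then show "x \<in> Field le" by (rule FieldI1)
qed

lemma FieldE:
  assumes "x \<in> Field le"
  obtains i w where "i \<in> ranks" "w \<in> \<Omega>" "x = fc i w" "rk x = i"
  using assms by (auto simp: Field_le)

lemma fc_Field: "i \<in> ranks \<Longrightarrow> w \<in> \<Omega> \<Longrightarrow> fc i w \<in> Field le"
  by (auto simp: Field_le)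

lemma le_I: "i \<in> ranks \<Longrightarrow> j \<in> ranks \<Longrightarrow> i \<le> j \<Longrightarrow> w \<in> \<Omega> \<Longrightarrow> (fc i w, fc j w) \<in> le"
  unfolding le_def by auto

lemma leE:
  assumes "(x, y) \<in> le"
  obtains i j w where "i \<in> ranks" "j \<in> ranks" "i \<le> j" "w \<in> \<Omega>" "x = fc i w" "y = fc j w"
    "rk x = i" "rk y = j"
proof -
  obtain i j w where "x = fc i w" "y = fc j w" "w \<in> \<Omega>" "-1 \<le> i" "i \<le> j" "j \<le> int n"
    using assms unfolding le_def by blast
  then show thesis using that[of i j w] by simp
qed

lemma le_common:
  assumes "(x, y) \<in> le"
  obtains w where "w \<in> \<Omega>" "x = fc (rk x) w" "y = fc (rk y) w"
    "rk x \<in> ranks" "rk y \<in> ranks" "rk x \<le> rk y"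
  using assms by (rule leE) metis

lemma le_Field: "(x, y) \<in> le \<Longrightarrow> x \<in> Field le \<and> y \<in> Field le"
  by (simp add: FieldI1 FieldI2)

lemma fc_orb:
  assumes "v \<in> orb r J w" "w \<in> \<Omega>" "J \<subseteq> idx" "i \<in> ranks" "i \<notin> J"
  shows "fc i v = fc i w"
proof -
  have "v \<in> \<Omega>" using orb_in assms by blast
  moreover have "v \<in> orb r (idx - {i}) w" by (rule orb_mono[OF assms(1)]) (use assms in auto)
  ultimately show ?thesis using fc_eq_iff assms by blast
qed

text \<open>A path that fixes the \<open>j\<close>-face can be sorted to use the indices above
  \<open>j\<close> first and those below \<open>j\<close> afterwards. Its turning point keeps the
  lower faces of \<open>w\<close> and already has the upper faces of \<open>v\<close>.\<close>

lemma fc_amalgamate: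
  assumes "v \<in> \<Omega>" "w \<in> \<Omega>" "j \<in> ranks" "fc j v = fc j w"
  shows "\<exists>u \<in> \<Omega>. (\<forall>i \<in> ranks. i \<le> j \<longrightarrow> fc i u = fc i w) \<and> (\<forall>i \<in> ranks. j \<le> i \<longrightarrow> fc i u = fc i v)"
proof -
  have v: "v \<in> orb r (idx - {j}) w" using fc_eq_iff assms by blast
  let ?A = "{0..<j}" and ?B = "{j<..<int n}"
  have "idx - {j} \<subseteq> ?A \<union> ?B" by auto
  then obtain u where u: "u \<in> orb r ?B w" "v \<in> orb r ?A u" "u \<in> \<Omega>"
    by (rule orb_splitE[OF v \<open>w \<in> \<Omega>\<close>]) (use assms in auto)
  have sub: "?A \<subseteq> idx" "?B \<subseteq> idx" using assms by auto
  have "fc i u = fc i w" if "i \<in> ranks" "i \<le> j" for i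
    using fc_orb[OF u(1) \<open>w \<in> \<Omega>\<close> sub(2)] that by auto
  moreover have "fc i u = fc i v" if "i \<in> ranks" "j \<le> i" for i
    using fc_orb[OF u(2) \<open>u \<in> \<Omega>\<close> sub(1)] that by auto
  ultimately show ?thesis using \<open>u \<in> \<Omega>\<close> by blast
qed

lemma le_trans: "(x, y) \<in> le \<Longrightarrow> (y, z) \<in> le \<Longrightarrow> (x, z) \<in> le"
proof -
  assume "(x, y) \<in> le" "(y, z) \<in> le"
  then obtain i j k w v where *: "i \<in> ranks" "j \<in> ranks" "k \<in> ranks" "i \<le> j" "j \<le> k" "w \<in> \<Omega>" "v \<in> \<Omega>"
    "x = fc i w" "y = fc j w" "y = fc j v" "z = fc k v"
    by (elim leE) metis
  then obtain u where "u \<in> \<Omega>" "fc i u = fc i w" "fc k u = fc k v"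
    using fc_amalgamate[of v w j] by metis
  then show ?thesis using le_I[of i k u] * by auto
qed

lemma partial_order_le: "partial_order_on (Field le) le"
  unfolding partial_order_on_def preorder_on_def
proof (intro conjI)
  show "refl_on (Field le) le"
    by (rule refl_onI) (auto simp: Field_le intro: le_I)
  show "trans le" by (rule transI) (rule le_trans)
  show "antisym le" 
  proof (rule antisymI)
    fix x y assume "(x, y) \<in> le" "(y, x) \<in> le"
    then show "x = y" by (elim leE) (metis order_antisym)
  qed
  show "le \<subseteq> Field le \<times> Field le" using le_Field by auto
qed

lemma rk_mono: "(x, y) \<in> le \<Longrightarrow> x \<noteq> y \<Longrightarrow> rk x < rk y"
  by (erule leE) (metis order_le_less)

text \<open>Built up by rank: a flag through the faces found so far and a flag through the two
  topmost faces are amalgamated along the face of rank \<open>l\<close>.\<close>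

lemma common_flag:
  assumes "finite I" "I \<subseteq> ranks" "\<And>i. i \<in> I \<Longrightarrow> \<exists>w \<in> \<Omega>. x i = fc i w"
    and "\<And>i j. i \<in> I \<Longrightarrow> j \<in> I \<Longrightarrow> i < j \<Longrightarrow> (x i, x j) \<in> le"
  shows "\<exists>w \<in> \<Omega>. \<forall>i \<in> I. x i = fc i w"
  using assms
proof (induction rule: finite_linorder_max_induct)
  case empty
  then show ?case using flags_nonempty by auto
next
  case (insert k I)
  then obtain w where w: "w \<in> \<Omega>" "\<And>i. i \<in> I \<Longrightarrow> x i = fc i w" by auto
  show ?case
  proof (cases "I = {}")
    case True
    then show ?thesis using insert by auto
  next
    case False
    define l where "l = Max I"
    have l: "l \<in> I" "\<And>i. i \<in> I \<Longrightarrow> i \<le> l" using insert False by (auto simp: l_def)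
    have "(x l, x k) \<in> le" using l insert by auto
    moreover have "rk (x l) = l" "rk (x k) = k" 
      using insert.prems(1) insert.prems(2)[of k] insert.prems(2)[of l] l by auto
    ultimately obtain v where v: "v \<in> \<Omega>" "x l = fc l v" "x k = fc k v"
      by (metis leE)
    have "l \<in> ranks" "k \<in> ranks" "l \<le> k" using l insert by auto
    then obtain u where "u \<in> \<Omega>" "\<forall>i \<in> ranks. i \<le> l \<longrightarrow> fc i u = fc i w"
      "\<forall>i \<in> ranks. l \<le> i \<longrightarrow> fc i u = fc i v"
      using fc_amalgamate[of v w l] v w l by metis
    then show ?thesis using v w l insert.prems(1) \<open>l \<le> k\<close> by (intro bexI[of _ u]) auto
  qed
qed

lemma fl_chain:
  assumes "w \<in> \<Omega>"
  shows "fl w \<in> Chains le"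
proof -
  have "(fc i w, fc j w) \<in> le \<or> (fc j w, fc i w) \<in> le" if "i \<in> ranks" "j \<in> ranks" for i j
    using le_I that assms by (cases "i \<le> j") simp_all
  then show ?thesis unfolding fl_def Chains_def by blast
qed

lemma chain_subset_fl:
  assumes "C \<in> Chains le"
  shows "\<exists>w \<in> \<Omega>. C \<subseteq> fl w"
proof -
  have CF: "C \<subseteq> Field le" using assms le_Field unfolding Chains_def by blast
  have cmp: "(x, y) \<in> le \<or> (y, x) \<in> le" if "x \<in> C" "y \<in> C" for x y
    using assms that unfolding Chains_def by blast
  have inj: "inj_on rk C"
    by (rule inj_onI) (metis cmp rk_mono order_less_irrefl)
  let ?I = "rk ` C" and ?x = "inv_into C rk"
  have sub: "?I \<subseteq> ranks" using CF by (auto elim!: FieldE)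
  have "\<exists>w \<in> \<Omega>. \<forall>i \<in> ?I. ?x i = fc i w"
  proof (rule common_flag[OF _ sub])
    show "finite ?I" by (rule finite_subset[OF sub]) simp
    show "\<exists>w \<in> \<Omega>. ?x i = fc i w" if i: "i \<in> ?I" for i
    proof -
      obtain y where y: "y \<in> C" "i = rk y" using i by blast
      then have "y \<in> Field le" using CF by blast
      then show ?thesis using y inj by (auto elim!: FieldE)
    qed
    show "(?x i, ?x j) \<in> le" if ij: "i \<in> ?I" "j \<in> ?I" "i < j" for i j
    proof -
      obtain y z where yz: "y \<in> C" "i = rk y" "z \<in> C" "j = rk z" using ij by blast
      then have "(y, z) \<in> le" using cmp[of y z] rk_mono[of z y] \<open>i < j\<close> by fastforce
      then show ?thesis using yz inj by simp
    qed
  qed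
  then obtain w where w: "w \<in> \<Omega>" "\<And>x. x \<in> C \<Longrightarrow> x = fc (rk x) w" using inj by auto
  have "C \<subseteq> fl w"
  proof
    fix x assume "x \<in> C"
    then show "x \<in> fl w" unfolding fl_def using w(2) sub by blast
  qed
  then show ?thesis using w(1) by blast
qed

lemma fl_subset_eq:
  assumes "v \<in> \<Omega>" "w \<in> \<Omega>" "fl v \<subseteq> fl w"
  shows "fl v = fl w"
proof -
  have "fc i v = fc i w" if i: "i \<in> ranks" for i
  proof -
    have "fc i v \<in> fl w" using assms i by (auto simp: fl_def)
    then obtain j where "j \<in> ranks" "fc i v = fc j w" by (auto simp: fl_def)
    then show ?thesis using fc_eq_iff assms i by metis
  qed
  then show ?thesis by (auto simp: fl_def)
qed

lemma flags_le: "flags le = fl ` \<Omega>"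
proof
  show "flags le \<subseteq> fl ` \<Omega>"
  proof
    fix C assume "C \<in> flags le"
    then have C: "C \<in> Chains le" "\<And>D. D \<in> Chains le \<Longrightarrow> C \<subseteq> D \<Longrightarrow> D = C"
      unfolding flags_def by auto
    obtain w where "w \<in> \<Omega>" "C \<subseteq> fl w" using chain_subset_fl[OF C(1)] by blast
    then show "C \<in> fl ` \<Omega>" using C(2) fl_chain by blast
  qed
  show "fl ` \<Omega> \<subseteq> flags le"
  proof
    fix C assume "C \<in> fl ` \<Omega>"
    then obtain w where w: "w \<in> \<Omega>" "C = fl w" by auto
    have "D = fl w" if D: "D \<in> Chains le" "fl w \<subseteq> D" for D
    proof -
      obtain v where "v \<in> \<Omega>" "D \<subseteq> fl v" using chain_subset_fl D by blast
      then show ?thesis using fl_subset_eq[of w v] w D by auto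
    qed
    then show "C \<in> flags le" using w fl_chain unfolding flags_def by auto
  qed
qed

lemma inj_on_fc: "w \<in> \<Omega> \<Longrightarrow> inj_on (\<lambda>i. fc i w) ranks"
  by (rule inj_on_inverseI[of _ rk]) simp

lemma card_fl: "w \<in> \<Omega> \<Longrightarrow> card (fl w) = n + 2"
  unfolding fl_def by (simp add: card_image inj_on_fc)

lemma fc_mem_fl_iff: "i \<in> ranks \<Longrightarrow> v \<in> \<Omega> \<Longrightarrow> w \<in> \<Omega> \<Longrightarrow> fc i v \<in> fl w \<longleftrightarrow> fc i v = fc i w"
  using fc_eq_iff[of i _ v w] unfolding fl_def by blast

lemma orb_of_faces:
  assumes "v \<in> \<Omega>" "w \<in> \<Omega>" "I \<subseteq> ranks" "\<And>i. i \<in> I \<Longrightarrow> fc i v = fc i w"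
  shows "v \<in> orb r (idx - I) w"
proof (rule orb_path_intersection)
  show "finite I" by (rule finite_subset[OF assms(3)]) simp
  show "v \<in> orb r (idx - {i}) w" if "i \<in> I" for i
    using assms fc_eq_iff[of i i v w] that by blast
qed (use assms(1-3) in auto)

lemma orb_empty: "orb r {} w = {w}"
proof (intro equalityI subsetI)
  fix v assume "v \<in> orb r {} w"
  then show "v \<in> {w}" by (rule orb_invariant) auto
qed (simp add: orb.orb_base)

lemma orb_single:
  assumes "j \<in> idx" "w \<in> \<Omega>" "v \<in> orb r {j} w"
  shows "v = w \<or> v = r j w"
  by (rule orb_singleton[OF assms(3) invol[OF assms(1,2)]])

text \<open>Agreement in all ranks leaves no index that a path between the two flags could
  use.\<close>

lemma inj_on_fl: "inj_on fl \<Omega>"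
proof (rule inj_onI)
  fix v w assume *: "v \<in> \<Omega>" "w \<in> \<Omega>" "fl v = fl w"
  have "fc i v = fc i w" if "i \<in> ranks" for i
    using fc_mem_fl_iff[of i v w] * that by (auto simp: fl_def)
  then have "v \<in> orb r (idx - ranks) w" using orb_of_faces[of v w ranks] * by auto
  moreover have "idx - ranks = {}" by auto
  ultimately show "v = w" using orb_empty by auto
qed

lemma fc_r_other: "j \<in> idx \<Longrightarrow> w \<in> \<Omega> \<Longrightarrow> i \<in> ranks \<Longrightarrow> i \<noteq> j \<Longrightarrow> fc i (r j w) = fc i w"
  by (rule fc_orb[of _ "{j}"]) (auto intro: orb.intros)

lemma fc_r_same: "j \<in> idx \<Longrightarrow> w \<in> \<Omega> \<Longrightarrow> fc j (r j w) \<noteq> fc j w"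
proof
  assume *: "j \<in> idx" "w \<in> \<Omega>" "fc j (r j w) = fc j w"
  have "fc i (r j w) = fc i w" if "i \<in> ranks" for i
    using fc_r_other[of j w i] * that by (cases "i = j") auto
  then have "fl (r j w) = fl w" unfolding fl_def by auto
  then have "r j w = w" using inj_on_fl * closed by (auto dest: inj_onD)
  then show False using fixed_point_free * by auto
qed

lemma fl_r_diff:
  assumes "j \<in> idx" "w \<in> \<Omega>"
  shows "fl w - fl (r j w) = {fc j w}"
proof -
  have "fc i w \<in> fl (r j w) \<longleftrightarrow> i \<noteq> j" if "i \<in> ranks" for i
    using fc_mem_fl_iff[of i w "r j w"] that assms closed fc_r_other[of j w i] fc_r_same[of j w] by auto
  moreover have "j \<in> ranks" using assms by auto
  ultimately show ?thesis unfolding fl_def[of w] by blast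
qed

lemma adjacent_r:
  assumes "j \<in> idx" "w \<in> \<Omega>"
  shows "j_adjacent rk j (fl w) (fl (r j w))"
proof -
  have "fl (r j w) - fl w = {fc j (r j w)}"
    using fl_r_diff[of j "r j w"] assms closed invol by auto
  then show ?thesis unfolding j_adjacent_def using fl_r_diff[OF assms] assms closed by auto
qed

lemma adjacentD:
  assumes "v \<in> \<Omega>" "w \<in> \<Omega>" "adjacent rk (fl v) (fl w)"
  shows "\<exists>j \<in> idx. v = r j w"
proof -
  obtain j F G where F: "fl v - fl w = {F}" "fl w - fl v = {G}" "rk F = j" "rk G = j"
    using assms unfolding adjacent_def j_adjacent_def by blast
  then obtain i where i: "F = fc i v" "i \<in> ranks" unfolding fl_def by blast
  have ij: "i = j" using F i assms by auto
  have eq: "fc k v = fc k w" if "k \<in> ranks" "k \<noteq> j" for k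
  proof -
    have "fc k v \<noteq> F" using i ij that assms fc_eq_iff by metis
    then have "fc k v \<in> fl w" using F that by (auto simp: fl_def)
    then show ?thesis using fc_mem_fl_iff assms that by blast
  qed
  have v: "v \<in> orb r (idx - (ranks - {j})) w"
    by (rule orb_of_faces) (use assms eq in auto)
  have "v \<noteq> w" using F by auto
  show ?thesis
  proof (cases "j \<in> idx")
    case True
    have "idx - (ranks - {j}) = {j}" using True by auto
    then show ?thesis using v orb_single[OF True \<open>w \<in> \<Omega>\<close>, of v] True \<open>v \<noteq> w\<close> by auto
  next
    case False
    \<comment> \<open>Now \<open>j\<close> is \<open>-1\<close> or \<open>n\<close>, where all flags
      share their face; no index is left, so \<open>v = w\<close>, which contradicts the existence
      of \<open>F\<close>.\<close>
    then have *: "idx - (ranks - {j}) = {}" by auto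
    show ?thesis using v \<open>v \<noteq> w\<close> unfolding * orb_empty by simp
  qed
qed

lemma fl_Int: 
  assumes "v \<in> \<Omega>" "w \<in> \<Omega>"
  shows "fl v \<inter> fl w = (\<lambda>i. fc i w) ` {i \<in> ranks. fc i v = fc i w}"
proof -
  have "fl v \<inter> fl w = {x \<in> fl w. x \<in> fl v}" by blast
  also have "\<dots> = (\<lambda>i. fc i w) ` {i \<in> ranks. fc i w \<in> fl v}" unfolding fl_def[of w] by blast
  also have "{i \<in> ranks. fc i w \<in> fl v} = {i \<in> ranks. fc i v = fc i w}"
    using fc_mem_fl_iff[OF _ assms(2,1)] by metis
  finally show ?thesis .
qed

text \<open>The path uses as indices only the ranks in which the two flags differ, so each flag on
  it keeps the common faces.\<close>

lemma strongly_connected: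
  assumes fl: "\<Phi> \<in> flags le" "\<Psi> \<in> flags le"
  shows "(\<Phi>, \<Psi>) \<in> {(\<Phi>', \<Psi>'). \<Phi>' \<in> flags le \<and> \<Psi>' \<in> flags le \<and> adjacent rk \<Phi>' \<Psi>' \<and>
                       \<Phi> \<inter> \<Psi> \<subseteq> \<Phi>' \<and> \<Phi> \<inter> \<Psi> \<subseteq> \<Psi>'}\<^sup>*" (is "_ \<in> ?R\<^sup>*")
proof -
  obtain v w where vw: "v \<in> \<Omega>" "w \<in> \<Omega>" "\<Phi> = fl w" "\<Psi> = fl v" using fl by (auto simp: flags_le)
  let ?I = "{i \<in> ranks. fc i v = fc i w}"
  have sub: "fl w \<inter> fl v \<subseteq> fl u" if u: "u \<in> orb r (idx - ?I) w" for u
  proof -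
    have "u \<in> \<Omega>" using orb_in[OF u] vw by auto
    have "fc i w \<in> fl u" if "i \<in> ?I" for i
      using fc_orb[OF u] that vw \<open>u \<in> \<Omega>\<close> fc_mem_fl_iff[of i w u] by auto
    then show ?thesis unfolding Int_commute[of "fl w"] fl_Int[OF vw(1,2)] by blast
  qed
  have v: "v \<in> orb r (idx - ?I) w" by (rule orb_of_faces) (use vw in auto)
  have "(fl w, fl u) \<in> ?R\<^sup>*" if "u \<in> orb r (idx - ?I) w" for u
    using that
  proof (induction rule: orb.induct)
    case (orb_step u j)
    have u: "u \<in> \<Omega>" using orb_in[OF orb_step.hyps(1)] vw by auto
    have "r j u \<in> orb r (idx - ?I) w" using orb_step by (auto intro: orb.orb_step)
    then have "(fl u, fl (r j u)) \<in> ?R"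
      using sub orb_step u closed adjacent_r[of j u] vw unfolding adjacent_def
      by (auto simp: flags_le)
    with orb_step.IH show ?case by (rule rtrancl_into_rtrancl)
  qed simp
  then show ?thesis using v vw by auto
qed

lemma fc_between:
  assumes "(F, H) \<in> le" "(H, G) \<in> le"
  obtains u where "u \<in> \<Omega>" "F = fc (rk F) u" "H = fc (rk H) u" "G = fc (rk G) u"
proof -
  obtain v where v: "v \<in> \<Omega>" "F = fc (rk F) v" "H = fc (rk H) v" "rk F \<in> ranks" "rk F \<le> rk H"
    using assms(1) by (rule le_common)
  obtain w where w: "w \<in> \<Omega>" "H = fc (rk H) w" "G = fc (rk G) w" "rk H \<in> ranks" "rk G \<in> ranks" "rk H \<le> rk G"
    using assms(2) by (rule le_common)
  have "\<exists>u \<in> \<Omega>. (\<forall>k \<in> ranks. k \<le> rk H \<longrightarrow> fc k u = fc k v) \<and> (\<forall>k \<in> ranks. rk H \<le> k \<longrightarrow> fc k u = fc k w)"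
    by (rule fc_amalgamate) (use v w in simp_all)
  then obtain u where "u \<in> \<Omega>" "fc (rk F) u = fc (rk F) v" "fc (rk H) u = fc (rk H) v"
    "fc (rk G) u = fc (rk G) w"
    using v(4,5) w(4-6) by blast
  then show thesis using that v(2,3) w(3) by simp
qed

text \<open>Translates sections of the poset into orbits under the indices strictly between
  \<open>a\<close> and \<open>b\<close>. Both the diamond condition and the count of edges in a
  2-section are read off from such orbits.\<close>

lemma fc_between_orb:
  assumes w: "w \<in> \<Omega>" "a \<in> ranks" "b \<in> ranks"
    and H: "(fc a w, H) \<in> le" "(H, fc b w) \<in> le" "rk H = k"
  shows "\<exists>u \<in> orb r {a<..<b} w. H = fc k u"
proof (cases "a < k \<and> k < b")
  case True
  obtain v where "v \<in> \<Omega>" "fc a w = fc (rk (fc a w)) v" "H = fc (rk H) v"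
    "fc b w = fc (rk (fc b w)) v"
    using H(1,2) by (rule fc_between)
  then have v: "v \<in> \<Omega>" "fc a w = fc a v" "H = fc k v" "fc b w = fc b v"
    unfolding rk_fc[OF w(2,1)] rk_fc[OF w(3,1)] H(3) by blast+
  have "v \<in> orb r (idx - {a, b}) w" by (rule orb_of_faces) (use v w in auto)
  moreover let ?A = "{0..<a} \<union> {b<..<int n}" and ?B = "{a<..<b}"
  have "idx - {a, b} \<subseteq> ?A \<union> ?B" by auto
  ultimately obtain u where u: "u \<in> orb r ?B w" "v \<in> orb r ?A u" "u \<in> \<Omega>"
    by (rule orb_splitE[OF _ w(1)]) (use w in auto)
  have "fc k v = fc k u"
    by (rule fc_orb[OF u(2,3)]) (use True w in auto)
  then show ?thesis using u(1) v(3) by auto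
next
  case False
  have "fc a w = H \<or> a < k" "H = fc b w \<or> k < b"
    using rk_mono[OF H(1)] rk_mono[OF H(2)] w H(3) by auto
  then have "H = fc k w" using False w H(3) by auto
  then show ?thesis using orb.orb_base[of w r] by blast
qed

lemma diamond:
  assumes i: "0 \<le> i" "i \<le> int n - 1"
    and FG: "(F, G) \<in> le" "F \<noteq> G" "rk F = i - 1" "rk G = i + 1"
  shows "card {H. rk H = i \<and> (F, H) \<in> le \<and> F \<noteq> H \<and> (H, G) \<in> le \<and> H \<noteq> G} = 2"
proof -
  obtain w where w: "w \<in> \<Omega>" "F = fc (i - 1) w" "G = fc (i + 1) w"
    using le_common[OF FG(1), unfolded FG(3,4)] .
  have idx: "i \<in> idx" using i by auto
  have "{H. rk H = i \<and> (F, H) \<in> le \<and> F \<noteq> H \<and> (H, G) \<in> le \<and> H \<noteq> G} = {fc i w, fc i (r i w)}"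
  proof (intro equalityI subsetI)
    fix H assume "H \<in> {H. rk H = i \<and> (F, H) \<in> le \<and> F \<noteq> H \<and> (H, G) \<in> le \<and> H \<noteq> G}"
    then have H: "rk H = i" "(F, H) \<in> le" "(H, G) \<in> le" by auto
    have "\<exists>u \<in> orb r {i - 1<..<i + 1} w. H = fc i u"
      by (rule fc_between_orb) (use w(1) i H in \<open>simp_all flip: w(2,3)\<close>)
    then obtain u where "u \<in> orb r {i - 1<..<i + 1} w" "H = fc i u" by blast
    moreover have "{i - 1<..<i + 1} = {i}" by auto
    ultimately show "H \<in> {fc i w, fc i (r i w)}" using orb_single[OF idx w(1)] by auto
  next
    fix H assume "H \<in> {fc i w, fc i (r i w)}"
    then obtain u where u: "u = w \<or> u = r i w" "H = fc i u" by blast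
    have "u \<in> \<Omega>" "fc (i - 1) u = F" "fc (i + 1) u = G"
      using u(1) w closed[OF idx w(1)] fc_r_other[OF idx w(1)] i by auto
    then have u: "u \<in> \<Omega>" "H = fc i u" "F = fc (i - 1) u" "G = fc (i + 1) u"
      using u(2) by auto
    have "rk H = i" using u(1,2) i by simp
    moreover from this have "F \<noteq> H" "H \<noteq> G" using FG(3,4) by fastforce+
    moreover have "(F, H) \<in> le" "(H, G) \<in> le"
      unfolding u(2,3,4) by (rule le_I; use u(1) i in simp)+
    ultimately show "H \<in> {H. rk H = i \<and> (F, H) \<in> le \<and> F \<noteq> H \<and> (H, G) \<in> le \<and> H \<noteq> G}"
      by simp
  qed
  moreover have "fc i w \<noteq> fc i (r i w)" using fc_r_same[OF idx w(1)] by metis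
  ultimately show ?thesis by simp
qed

lemma polytope: "abstract_polytope n le rk"
proof (rule abstract_polytope.intro)
  show "partial_order_on (Field le) le" by (rule partial_order_le)
  show "rk F < rk G" if "(F, G) \<in> le" "F \<noteq> G" for F G using rk_mono that .
  show "rk ` Field le = {-1..int n}"
  proof
    show "rk ` Field le \<subseteq> {-1..int n}" by (auto elim!: FieldE)
    show "{-1..int n} \<subseteq> rk ` Field le"
    proof
      fix i assume i: "i \<in> ranks"
      obtain w where w: "w \<in> \<Omega>" using flags_nonempty by auto
      show "i \<in> rk ` Field le"
        by (rule image_eqI[of _ _ "fc i w"]) (use i w fc_Field in auto)
    qed
  qed
  obtain w0 where w0: "w0 \<in> \<Omega>" using flags_nonempty by auto
  have all_eq: "fc i w = fc i w0" if "w \<in> \<Omega>" "i = -1 \<or> i = int n" for i w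
    by (rule fc_orb[OF connected]) (use that w0 in auto)
  show "\<exists>F \<in> Field le. \<forall>G \<in> Field le. (F, G) \<in> le"
  proof (rule bexI[of _ "fc (-1) w0"])
    show "\<forall>G \<in> Field le. (fc (-1) w0, G) \<in> le"
    proof
      fix G assume "G \<in> Field le"
      then obtain i w where "i \<in> ranks" "w \<in> \<Omega>" "G = fc i w" by (rule FieldE)
      then show "(fc (-1) w0, G) \<in> le" using le_I[of "-1" i w] all_eq[of w "-1"] by auto
    qed
  qed (use w0 fc_Field in auto)
  show "\<exists>G \<in> Field le. \<forall>F \<in> Field le. (F, G) \<in> le"
  proof (rule bexI[of _ "fc (int n) w0"])
    show "\<forall>F \<in> Field le. (F, fc (int n) w0) \<in> le"
    proof
      fix F assume "F \<in> Field le"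
      then obtain i w where "i \<in> ranks" "w \<in> \<Omega>" "F = fc i w" by (rule FieldE)
      then show "(F, fc (int n) w0) \<in> le" using le_I[of i "int n" w] all_eq[of w "int n"] by auto
    qed
  qed (use w0 fc_Field in auto)
  show "card \<Phi> = n + 2" if "\<Phi> \<in> flags le" for \<Phi>
    using that card_fl by (auto simp: flags_le)
qed (rule strongly_connected diamond; assumption)+

end

text \<open>The choice depends on the orbit only as a set, so it names the face; recording the rank
  separates faces of different ranks that consist of the same flags. The coding by
  \<open>to_nat\<close> places the poset on \<open>nat\<close>.\<close>

definition orbit_label :: "nat \<Rightarrow> (int \<Rightarrow> 'f :: countable \<Rightarrow> 'f) \<Rightarrow> int \<Rightarrow> 'f \<Rightarrow> nat" where
  "orbit_label n r i w = to_nat (i, SOME v. v \<in> orb r ({0..<int n} - {i}) w)"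

lemma face_labelling_orbit_label:
  fixes r :: "int \<Rightarrow> 'f :: countable \<Rightarrow> 'f"
  assumes "flag_system n \<Omega> r" and "\<And>j w. j \<in> {0..<int n} \<Longrightarrow> w \<in> \<Omega> \<Longrightarrow> r j w \<noteq> w"
  shows "face_labelling n \<Omega> r (orbit_label n r)"
proof (rule face_labelling.intro[OF assms(1) face_labelling_axioms.intro])
  interpret flag_system n \<Omega> r by (rule assms(1))
  fix i j v w assume vw: "v \<in> \<Omega>" "w \<in> \<Omega>"
  let ?o = "\<lambda>w. orb r (idx - {i}) w"
  have eq: "?o v = ?o w" if "v \<in> ?o w"
  proof -
    have "w \<in> ?o v" by (rule orb_sym[OF that vw(2)]) blast
    then show ?thesis using orb_trans[of _ r _ v w] orb_trans[of _ r _ w v] that by blast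
  qed
  have some: "(SOME u. u \<in> ?o x) \<in> ?o x" for x
    by (rule someI[of _ x]) (rule orb.orb_base)
  show "orbit_label n r i v = orbit_label n r j w \<longleftrightarrow> i = j \<and> v \<in> ?o w"
  proof
    assume "orbit_label n r i v = orbit_label n r j w"
    then have ij: "i = j" and s: "(SOME u. u \<in> ?o v) = (SOME u. u \<in> ?o w)"
      unfolding orbit_label_def by auto
    have "(SOME u. u \<in> ?o v) \<in> ?o w" unfolding s by (rule some)
    moreover have "v \<in> ?o (SOME u. u \<in> ?o v)" by (rule orb_sym[OF some vw(1)]) blast
    ultimately show "i = j \<and> v \<in> ?o w" using ij orb_trans by metis
  next
    assume "i = j \<and> v \<in> ?o w"
    then show "orbit_label n r i v = orbit_label n r j w" using eq unfolding orbit_label_def by auto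
  qed
qed (use assms(2) in auto)


section \<open>Automorphisms\<close>

text \<open>If \<open>f\<close> does not notice the order in which two elements of \<open>H\<close>
  act, every commutator preserves \<open>f\<close>. The derived group then lies in the subgroup
  preserving \<open>f\<close>, and solvability passes from there to \<open>H\<close>. Iteration
  replaces a series with abelian quotients without forming any quotient group.\<close>

lemma derived_BijGroup_invariant:
  assumes H: "subgroup H (BijGroup S)"
    and comm: "\<And>\<gamma> \<delta> w. \<gamma> \<in> H \<Longrightarrow> \<delta> \<in> H \<Longrightarrow> w \<in> S \<Longrightarrow> f (\<gamma> (\<delta> w)) = f (\<delta> (\<gamma> w))"
    and solvable: "subgroup {\<gamma> \<in> H. \<forall>w \<in> S. f (\<gamma> w) = f w} (BijGroup S) \<Longrightarrow>
      solvable_seq (BijGroup S) {\<gamma> \<in> H. \<forall>w \<in> S. f (\<gamma> w) = f w}"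
  shows "solvable_seq (BijGroup S) H"
proof -
  let ?G = "BijGroup S" and ?K = "{\<gamma> \<in> H. \<forall>w \<in> S. f (\<gamma> w) = f w}"
  interpret group ?G by (rule group_BijGroup)
  interpret H: subgroup H ?G by (rule H)
  have bij: "\<gamma> \<in> Bij S" if "\<gamma> \<in> H" for \<gamma>
    using H.subset that by (auto simp: BijGroup_def)
  have mem: "\<gamma> w \<in> S" if "\<gamma> \<in> H" "w \<in> S" for \<gamma> w
    using bij[OF that(1)] that(2) by (auto simp: Bij_def bij_betw_def)
  have mult: "(\<gamma> \<otimes>\<^bsub>?G\<^esub> \<delta>) w = \<gamma> (\<delta> w)" if "\<gamma> \<in> H" "\<delta> \<in> H" "w \<in> S" for \<gamma> \<delta> w
    using bij that by (simp add: BijGroup_def compose_eq)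
  have one: "\<one>\<^bsub>?G\<^esub> w = w" if "w \<in> S" for w using that by (simp add: BijGroup_def)
  have inv: "\<gamma> ((inv\<^bsub>?G\<^esub> \<gamma>) w) = w" if "\<gamma> \<in> H" "w \<in> S" for \<gamma> w
    using mult[of \<gamma> "inv\<^bsub>?G\<^esub> \<gamma>" w] that one by (simp add: H.mem_carrier)
  have K: "subgroup ?K ?G"
  proof (rule subgroupI)
    show "?K \<subseteq> carrier ?G" using H.subset by blast
    have "\<one>\<^bsub>?G\<^esub> \<in> ?K" using H.one_closed one by simp
    then show "?K \<noteq> {}" by blast
  next
    fix \<gamma> assume \<gamma>: "\<gamma> \<in> ?K"
    then have "f ((inv\<^bsub>?G\<^esub> \<gamma>) w) = f w" if "w \<in> S" for w
      using inv[of \<gamma> w] mem[of "inv\<^bsub>?G\<^esub> \<gamma>" w] that by force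
    then show "inv\<^bsub>?G\<^esub> \<gamma> \<in> ?K" using \<gamma> by simp
  next
    fix \<gamma> \<delta> assume "\<gamma> \<in> ?K" "\<delta> \<in> ?K"
    then show "\<gamma> \<otimes>\<^bsub>?G\<^esub> \<delta> \<in> ?K" using mult mem by simp
  qed
  have "derived_set ?G H \<subseteq> ?K"
  proof
    fix x assume "x \<in> derived_set ?G H"
    then obtain \<gamma> \<delta> where x: "\<gamma> \<in> H" "\<delta> \<in> H"
      "x = \<gamma> \<otimes>\<^bsub>?G\<^esub> \<delta> \<otimes>\<^bsub>?G\<^esub> inv\<^bsub>?G\<^esub> \<gamma> \<otimes>\<^bsub>?G\<^esub> inv\<^bsub>?G\<^esub> \<delta>" by blast
    have "f (x w) = f w" if w: "w \<in> S" for w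
    proof -
      let ?u = "(inv\<^bsub>?G\<^esub> \<gamma>) ((inv\<^bsub>?G\<^esub> \<delta>) w)"
      have "?u \<in> S" using mem x w by simp
      have "x w = \<gamma> (\<delta> ?u)" using x w mult mem by simp
      also have "f \<dots> = f (\<delta> (\<gamma> ?u))" using comm x \<open>?u \<in> S\<close> by blast
      also have "\<delta> (\<gamma> ?u) = w"
        using inv[OF x(1), of "(inv\<^bsub>?G\<^esub> \<delta>) w"] inv[OF x(2) w] mem x(2) w by simp
      finally show ?thesis .
    qed
    then show "x \<in> ?K" using x by simp
  qed
  then have DK: "derived ?G H \<subseteq> ?K"
    unfolding derived_def by (rule generate_subgroup_incl[OF _ K])
  obtain n where n: "(derived ?G ^^ n) ?K = {\<one>\<^bsub>?G\<^esub>}"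
    using solvable_imp_trivial_derived_seq[OF solvable[OF K]] by blast
  have D: "subgroup (derived ?G H) ?G" by (rule derived_is_subgroup[OF H.subset])
  have "(derived ?G ^^ n) (derived ?G H) \<subseteq> {\<one>\<^bsub>?G\<^esub>}"
    using mono_exp_of_derived[OF DK, of n] unfolding n .
  moreover have "\<one>\<^bsub>?G\<^esub> \<in> (derived ?G ^^ n) (derived ?G H)"
    by (rule subgroup.one_closed[OF exp_of_derived_is_subgroup[OF D]])
  ultimately have "(derived ?G ^^ n) (derived ?G H) = {\<one>\<^bsub>?G\<^esub>}" by blast
  then show ?thesis
    by (intro augment_solvable_seq[OF H] trivial_derived_seq_imp_solvable[OF D])
qed

text \<open>Makes poset automorphisms preserve ranks: the ranks of the images of the faces of one
  flag form such a map \<open>f\<close>.\<close>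

lemma strict_mono_int_interval_id:
  fixes f :: "int \<Rightarrow> int"
  assumes mem: "\<And>i. i \<in> {a..b} \<Longrightarrow> f i \<in> {a..b}"
    and mono: "\<And>i. a \<le> i \<Longrightarrow> i < b \<Longrightarrow> f i < f (i + 1)"
    and i: "i \<in> {a..b}"
  shows "f i = i"
proof (rule antisym)
  have "j \<le> b \<longrightarrow> j \<le> f j" if "a \<le> j" for j
    using that
  proof (induction j rule: int_ge_induct)
    case base
    then show ?case using mem[of a] by auto
  next
    case (step j)
    then show ?case using mono[of j] by auto
  qed
  then show "i \<le> f i" using i by auto
  have "a \<le> j \<longrightarrow> f j \<le> j" if "j \<le> b" for j
    using that
  proof (induction j rule: int_le_induct)
    case base
    then show ?case using mem[of b] by auto
  next
    case (step j)
    then show ?case using mono[of "j - 1"] by auto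
  qed
  then show "f i \<le> i" using i by auto
qed

context face_labelling
begin

definition centralizer :: "('f \<Rightarrow> 'f) set" where
  "centralizer = {\<gamma> \<in> Bij \<Omega>. \<forall>j \<in> idx. \<forall>w \<in> \<Omega>. \<gamma> (r j w) = r j (\<gamma> w)}"

lemma centralizer_mem: "\<gamma> \<in> centralizer \<Longrightarrow> w \<in> \<Omega> \<Longrightarrow> \<gamma> w \<in> \<Omega>"
  unfolding centralizer_def Bij_def bij_betw_def by auto

lemma centralizer_r: "\<gamma> \<in> centralizer \<Longrightarrow> j \<in> idx \<Longrightarrow> w \<in> \<Omega> \<Longrightarrow> \<gamma> (r j w) = r j (\<gamma> w)"
  unfolding centralizer_def by auto

lemma centralizer_orb:
  assumes "v \<in> orb r J w" "\<gamma> \<in> centralizer" "J \<subseteq> idx" "w \<in> \<Omega>"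
  shows "\<gamma> v \<in> orb r J (\<gamma> w)"
  using assms(1)
proof (induction rule: orb.induct)
  case orb_base
  show ?case by (rule orb.orb_base)
next
  case (orb_step v j)
  have "v \<in> \<Omega>" by (rule orb_in[OF orb_step.hyps(1) assms(4,3)])
  then have "\<gamma> (r j v) = r j (\<gamma> v)"
    using centralizer_r[OF assms(2)] orb_step.hyps(2) assms(3) by blast
  then show ?case using orb.orb_step[OF orb_step.IH orb_step.hyps(2)] by simp
qed

text \<open>Connectedness spreads agreement from one flag to all, so the action on flags is
  free.\<close>

lemma centralizer_eqI:
  assumes "\<gamma> \<in> centralizer" "\<delta> \<in> centralizer" "w \<in> \<Omega>" "\<gamma> w = \<delta> w"
  shows "\<gamma> = \<delta>"
proof (rule extensionalityI)
  show "\<gamma> \<in> extensional \<Omega>" "\<delta> \<in> extensional \<Omega>"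
    using assms(1,2) by (auto simp: centralizer_def Bij_def)
  fix v assume "v \<in> \<Omega>"
  then have "v \<in> orb r idx w" using connected assms by blast
  then have "v \<in> \<Omega> \<and> \<gamma> v = \<delta> v"
  proof (rule orb_invariant)
    fix u j assume "u \<in> \<Omega> \<and> \<gamma> u = \<delta> u" "j \<in> idx"
    then show "r j u \<in> \<Omega> \<and> \<gamma> (r j u) = \<delta> (r j u)"
      using closed[of j u] centralizer_r[OF assms(1), of j u] centralizer_r[OF assms(2), of j u] by simp
  qed (use assms in simp)
  then show "\<gamma> v = \<delta> v" by blast
qed

lemma subgroup_centralizer: "subgroup centralizer (BijGroup \<Omega>)"
proof (rule group.subgroupI[OF group_BijGroup])
  show "centralizer \<subseteq> carrier (BijGroup \<Omega>)" by (auto simp: centralizer_def BijGroup_def)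
  have "(\<lambda>w\<in>\<Omega>. w) \<in> centralizer" using closed by (simp add: centralizer_def id_Bij)
  then show "centralizer \<noteq> {}" by blast
next
  fix \<gamma> assume \<gamma>: "\<gamma> \<in> centralizer"
  then have B: "\<gamma> \<in> Bij \<Omega>" by (simp add: centralizer_def)
  let ?g = "inv_into \<Omega> \<gamma>"
  have "?g (r j w) = r j (?g w)" if j: "j \<in> idx" and w: "w \<in> \<Omega>" for j w
  proof -
    have g: "?g w \<in> \<Omega>" using Bij_inv_into_mem[OF B w] .
    have "\<gamma> (?g w) = w" using B w by (simp add: Bij_def bij_betw_def f_inv_into_f)
    then have "r j w = \<gamma> (r j (?g w))" using centralizer_r[OF \<gamma> j g] by simp
    then show ?thesis
      using B closed[OF j g] by (simp add: Bij_def bij_betw_def)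
  qed
  then show "inv\<^bsub>BijGroup \<Omega>\<^esub> \<gamma> \<in> centralizer"
    using closed by (simp add: centralizer_def inv_BijGroup[OF B] restrict_inv_into_Bij[OF B])
next
  fix \<gamma> \<delta> assume \<gamma>: "\<gamma> \<in> centralizer" and \<delta>: "\<delta> \<in> centralizer"
  then have B: "\<gamma> \<in> Bij \<Omega>" "\<delta> \<in> Bij \<Omega>" by (auto simp: centralizer_def)
  have "compose \<Omega> \<gamma> \<delta> \<in> centralizer"
    using compose_Bij[OF B] centralizer_r[OF \<gamma>] centralizer_r[OF \<delta>] centralizer_mem[OF \<delta>] closed
    by (simp add: centralizer_def compose_eq)
  then show "\<gamma> \<otimes>\<^bsub>BijGroup \<Omega>\<^esub> \<delta> \<in> centralizer" using B by (simp add: BijGroup_def)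
qed

lemma centralizerI:
  assumes ext: "\<gamma> \<in> extensional \<Omega>" and mem: "\<And>w. w \<in> \<Omega> \<Longrightarrow> \<gamma> w \<in> \<Omega>"
    and comm: "\<And>j w. j \<in> {0..<int n} \<Longrightarrow> w \<in> \<Omega> \<Longrightarrow> \<gamma> (r j w) = r j (\<gamma> w)"
  shows "\<gamma> \<in> centralizer"
proof -
  obtain w where w: "w \<in> \<Omega>" using flags_nonempty by auto
  \<comment> \<open>The image is closed under all \<open>r j\<close>, so connectedness makes it everything.\<close>
  have "\<gamma> ` \<Omega> = \<Omega>"
  proof (intro equalityI subsetI)
    fix v assume "v \<in> \<Omega>"
    then have "v \<in> orb r idx (\<gamma> w)" using connected mem[OF w] by blast
    then show "v \<in> \<gamma> ` \<Omega>"
    proof (rule orb_invariant)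
      fix u j assume "u \<in> \<gamma> ` \<Omega>" "j \<in> idx"
      then obtain x where "x \<in> \<Omega>" "u = \<gamma> x" by blast
      then have "r j u = \<gamma> (r j x)" "r j x \<in> \<Omega>" using comm closed \<open>j \<in> idx\<close> by auto
      then show "r j u \<in> \<gamma> ` \<Omega>" by blast
    qed (use w in blast)
  qed (use mem in blast)
  then have "bij_betw \<gamma> \<Omega> \<Omega>"
    using finite_flags by (simp add: bij_betw_def eq_card_imp_inj_on)
  then show ?thesis using ext comm by (simp add: centralizer_def Bij_def)
qed

text \<open>All pairs \<open>(w, \<gamma> w)\<close> arise from one of them by applying the same
  \<open>r j\<close> to both entries. This is what later shows that an automorphism changes a
  coordinate of the flags everywhere by the same amount.\<close>

lemma centralizer_invariant:
  assumes "\<gamma> \<in> centralizer" "v \<in> \<Omega>" "w \<in> \<Omega>" "P v (\<gamma> v)"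
    and "\<And>j x y. j \<in> {0..<int n} \<Longrightarrow> x \<in> \<Omega> \<Longrightarrow> y \<in> \<Omega> \<Longrightarrow> P x y \<Longrightarrow> P (r j x) (r j y)"
  shows "P w (\<gamma> w)"
proof -
  have "w \<in> orb r idx v" using connected assms by blast
  then have "w \<in> \<Omega> \<and> P w (\<gamma> w)"
  proof (rule orb_invariant)
    fix x j assume x: "x \<in> \<Omega> \<and> P x (\<gamma> x)" and j: "j \<in> idx"
    then have "P (r j x) (r j (\<gamma> x))" using assms(5)[OF j, of x "\<gamma> x"] centralizer_mem[OF assms(1)] by blast
    then show "r j x \<in> \<Omega> \<and> P (r j x) (\<gamma> (r j x))"
      using closed[OF j] centralizer_r[OF assms(1) j] x by simp
  qed (use assms in blast)
  then show ?thesis by blast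
qed

definition centralizer_group :: "('f \<Rightarrow> 'f) monoid" where
  "centralizer_group = BijGroup \<Omega> \<lparr>carrier := centralizer\<rparr>"

lemma group_centralizer_group: "group centralizer_group"
  unfolding centralizer_group_def
  by (rule subgroup.subgroup_is_group[OF subgroup_centralizer group_BijGroup])

lemma auts_lift_ex:
  assumes \<phi>: "\<phi> \<in> poset_auts le" and w: "w \<in> \<Omega>"
  shows "\<exists>v \<in> \<Omega>. \<forall>i \<in> ranks. \<phi> (fc i w) = fc i v"
proof -
  have bij: "bij_betw \<phi> (Field le) (Field le)"
    and iso: "\<And>x y. x \<in> Field le \<Longrightarrow> y \<in> Field le \<Longrightarrow> (x, y) \<in> le \<longleftrightarrow> (\<phi> x, \<phi> y) \<in> le"
    using \<phi> by (auto simp: poset_auts_def Bij_def)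
  have F: "fc i w \<in> Field le" if "i \<in> ranks" for i using fc_Field w that by blast
  have F': "\<phi> (fc i w) \<in> Field le" if "i \<in> ranks" for i
    using bij F[OF that] by (rule bij_betw_apply)
  have mono: "(\<phi> (fc i w), \<phi> (fc j w)) \<in> le" if "i \<in> ranks" "j \<in> ranks" "i \<le> j" for i j
    using iso[OF F F] le_I[OF that w] that by blast
  have inj: "\<phi> (fc i w) \<noteq> \<phi> (fc j w)" if "i \<in> ranks" "j \<in> ranks" "i \<noteq> j" for i j
    using bij F[OF that(1)] F[OF that(2)] rk_fc[OF that(1) w] rk_fc[OF that(2) w] that(3)
    by (metis bij_betw_def inj_onD)
  have rank: "rk (\<phi> (fc i w)) = i" if "i \<in> ranks" for i
  proof (rule strict_mono_int_interval_id[of "-1" "int n" "\<lambda>i. rk (\<phi> (fc i w))"])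
    show "rk (\<phi> (fc i w)) \<in> ranks" if "i \<in> ranks" for i
      using F'[OF that] by (auto elim!: FieldE)
    show "rk (\<phi> (fc i w)) < rk (\<phi> (fc (i + 1) w))" if "-1 \<le> i" "i < int n" for i
      by (rule rk_mono[OF mono inj]) (use that in auto)
  qed (use that in auto)
  have "\<exists>v \<in> \<Omega>. \<forall>i \<in> ranks. \<phi> (fc i w) = fc i v"
  proof (rule common_flag)
    show "\<exists>v \<in> \<Omega>. \<phi> (fc i w) = fc i v" if "i \<in> ranks" for i
      using F'[OF that] rank[OF that] by (metis FieldE)
  qed (use mono in auto)
  then show ?thesis .
qed

lemma flag_eqI:
  assumes "v \<in> \<Omega>" "w \<in> \<Omega>" "\<And>i. i \<in> ranks \<Longrightarrow> fc i v = fc i w"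
  shows "v = w"
  using inj_onD[OF inj_on_fl _ assms(1,2)] assms(3) by (simp add: fl_def)

definition lift :: "('a \<Rightarrow> 'a) \<Rightarrow> 'f \<Rightarrow> 'f" where
  "lift \<phi> = (\<lambda>w \<in> \<Omega>. THE v. v \<in> \<Omega> \<and> (\<forall>i \<in> ranks. \<phi> (fc i w) = fc i v))"

lemma lift_eqI:
  assumes "w \<in> \<Omega>" "v \<in> \<Omega>" "\<And>i. i \<in> ranks \<Longrightarrow> \<phi> (fc i w) = fc i v"
  shows "lift \<phi> w = v"
  unfolding lift_def restrict_apply'[OF assms(1)]
proof (rule the_equality)
  show "v \<in> \<Omega> \<and> (\<forall>i \<in> ranks. \<phi> (fc i w) = fc i v)" using assms by blast
  show "u = v" if "u \<in> \<Omega> \<and> (\<forall>i \<in> ranks. \<phi> (fc i w) = fc i u)" for u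
    by (rule flag_eqI) (use that assms in auto)
qed

lemma lift_props:
  assumes "\<phi> \<in> poset_auts le" "w \<in> \<Omega>"
  shows "lift \<phi> w \<in> \<Omega>" "i \<in> ranks \<Longrightarrow> \<phi> (fc i w) = fc i (lift \<phi> w)"
proof -
  obtain v where v: "v \<in> \<Omega>" "\<And>i. i \<in> ranks \<Longrightarrow> \<phi> (fc i w) = fc i v"
    using auts_lift_ex[OF assms] by blast
  have "lift \<phi> w = v" by (rule lift_eqI) (use assms v in auto)
  then show "lift \<phi> w \<in> \<Omega>" "i \<in> ranks \<Longrightarrow> \<phi> (fc i w) = fc i (lift \<phi> w)"
    using v by auto
qed

lemma auts_inj:
  assumes "\<phi> \<in> poset_auts le" "i \<in> ranks" "v \<in> \<Omega>" "w \<in> \<Omega>" "\<phi> (fc i v) = \<phi> (fc i w)"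
  shows "fc i v = fc i w"
proof -
  have "inj_on \<phi> (Field le)" using assms(1) by (simp add: poset_auts_def Bij_def bij_betw_def)
  then show ?thesis using assms(2-5) fc_Field by (meson inj_onD)
qed

text \<open>The images of two \<open>j\<close>-adjacent flags share all faces of rank other than
  \<open>j\<close>, so they are equal or \<open>j\<close>-adjacent; injectivity on faces excludes
  equality.\<close>

lemma lift_centralizer:
  assumes \<phi>: "\<phi> \<in> poset_auts le"
  shows "lift \<phi> \<in> centralizer"
  unfolding centralizer_def
proof (intro CollectI conjI ballI)
  have "inj_on (lift \<phi>) \<Omega>"
  proof (rule inj_onI)
    fix v w assume *: "v \<in> \<Omega>" "w \<in> \<Omega>" "lift \<phi> v = lift \<phi> w"
    show "v = w"
    proof (rule flag_eqI[OF *(1,2)])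
      fix i assume "i \<in> ranks"
      then show "fc i v = fc i w"
        using auts_inj[OF \<phi> _ *(1,2)] lift_props(2)[OF \<phi>] * by metis
    qed
  qed
  moreover have "lift \<phi> ` \<Omega> \<subseteq> \<Omega>" using lift_props(1)[OF \<phi>] by blast
  ultimately have "bij_betw (lift \<phi>) \<Omega> \<Omega>"
    using endo_inj_surj[OF finite_flags] by (simp add: bij_betw_def)
  moreover have "lift \<phi> \<in> extensional \<Omega>" by (simp add: lift_def)
  ultimately show "lift \<phi> \<in> Bij \<Omega>" by (simp add: Bij_def)
next
  fix j w assume j: "j \<in> idx" and w: "w \<in> \<Omega>"
  let ?u = "lift \<phi> (r j w)" and ?v = "lift \<phi> w"
  have rw: "r j w \<in> \<Omega>" by (rule closed[OF j w])
  have \<Omega>: "?u \<in> \<Omega>" "?v \<in> \<Omega>" using lift_props(1)[OF \<phi>] rw w by auto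
  have "fc i ?u = fc i ?v" if "i \<in> ranks - {j}" for i
    using lift_props(2)[OF \<phi> rw, of i] lift_props(2)[OF \<phi> w, of i] fc_r_other[OF j w, of i] that
    by auto
  then have "?u \<in> orb r (idx - (ranks - {j})) ?v"
    by (intro orb_of_faces \<Omega>) auto
  moreover have "idx - (ranks - {j}) = {j}" using j by auto
  ultimately have "?u = ?v \<or> ?u = r j ?v" using orb_single[OF j \<Omega>(2)] by metis
  moreover have "?u \<noteq> ?v"
  proof
    assume eq: "?u = ?v"
    have jr: "j \<in> ranks" using j by auto
    have "\<phi> (fc j (r j w)) = \<phi> (fc j w)"
      using lift_props(2)[OF \<phi> rw jr] lift_props(2)[OF \<phi> w jr] eq by simp
    then show False using auts_inj[OF \<phi> jr rw w] fc_r_same[OF j w] by blast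
  qed
  ultimately show "?u = r j ?v" by blast
qed

lemma centralizer_inv:
  assumes "\<gamma> \<in> centralizer"
  obtains \<delta> where "\<delta> \<in> centralizer" "\<And>w. w \<in> \<Omega> \<Longrightarrow> \<delta> (\<gamma> w) = w" "\<And>w. w \<in> \<Omega> \<Longrightarrow> \<gamma> (\<delta> w) = w"
proof -
  have B: "\<gamma> \<in> Bij \<Omega>" using assms by (simp add: centralizer_def)
  have "inv\<^bsub>BijGroup \<Omega>\<^esub> \<gamma> \<in> centralizer"
    by (rule subgroup.m_inv_closed[OF subgroup_centralizer assms])
  then show thesis
    using that[of "inv\<^bsub>BijGroup \<Omega>\<^esub> \<gamma>"] B centralizer_mem[OF assms]
    by (simp add: inv_BijGroup[OF B] Bij_def bij_betw_def f_inv_into_f)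
qed

lemma centralizer_fc:
  assumes "\<gamma> \<in> centralizer" "i \<in> ranks" "v \<in> \<Omega>" "w \<in> \<Omega>"
  shows "fc i (\<gamma> v) = fc i (\<gamma> w) \<longleftrightarrow> fc i v = fc i w"
proof -
  have *: "fc i (\<delta> x) = fc i (\<delta> y)"
    if "\<delta> \<in> centralizer" "x \<in> \<Omega>" "y \<in> \<Omega>" "fc i x = fc i y" for \<delta> x y
  proof -
    have "x \<in> orb r (idx - {i}) y" using fc_eq_iff assms(2) that by blast
    then have "\<delta> x \<in> orb r (idx - {i}) (\<delta> y)"
      using centralizer_orb that by blast
    then show ?thesis using fc_eq_iff assms(2) centralizer_mem that by blast
  qed
  obtain \<delta> where "\<delta> \<in> centralizer" "\<And>w. w \<in> \<Omega> \<Longrightarrow> \<delta> (\<gamma> w) = w"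
    using centralizer_inv assms(1) by metis
  then show ?thesis
    using *[OF assms(1,3,4)] *[of \<delta> "\<gamma> v" "\<gamma> w"] centralizer_mem[OF assms(1)] assms(3,4) by metis
qed

lemma lift_surj:
  assumes \<gamma>: "\<gamma> \<in> centralizer"
  shows "\<exists>\<phi> \<in> poset_auts le. lift \<phi> = \<gamma>"
proof -
  \<comment> \<open>A face is moved along with some flag through it; by
    \<open>centralizer_fc\<close> the choice of that flag does not matter.\<close>
  define \<phi> where "\<phi> = (\<lambda>x \<in> Field le. fc (rk x) (\<gamma> (SOME w. w \<in> \<Omega> \<and> x = fc (rk x) w)))"
  have \<phi>: "\<phi> (fc i w) = fc i (\<gamma> w)" if iw: "i \<in> ranks" "w \<in> \<Omega>" for i w
  proof -
    let ?v = "SOME v. v \<in> \<Omega> \<and> fc i w = fc i v"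
    have "?v \<in> \<Omega> \<and> fc i w = fc i ?v" by (rule someI[of _ w]) (use iw in auto)
    then have "fc i (\<gamma> ?v) = fc i (\<gamma> w)"
      using centralizer_fc[OF \<gamma> iw(1), of ?v w] iw(2) by simp
    then show ?thesis using iw by (simp add: \<phi>_def fc_Field)
  qed
  obtain \<delta> where \<delta>: "\<delta> \<in> centralizer" "\<And>w. w \<in> \<Omega> \<Longrightarrow> \<gamma> (\<delta> w) = w"
    using centralizer_inv[OF \<gamma>] by metis
  have "Field le = (\<Union>i \<in> ranks. fc i ` \<Omega>)" unfolding Field_le by blast
  then have fin: "finite (Field le)" using finite_flags by simp
  have "\<phi> ` Field le = Field le"
  proof (intro equalityI subsetI)
    fix x assume "x \<in> \<phi> ` Field le"
    then obtain i w where "i \<in> ranks" "w \<in> \<Omega>" "x = \<phi> (fc i w)" by (auto simp: Field_le)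
    then show "x \<in> Field le" using \<phi> fc_Field centralizer_mem[OF \<gamma>] by simp
  next
    fix x assume "x \<in> Field le"
    then obtain i w where iw: "i \<in> ranks" "w \<in> \<Omega>" "x = fc i w" by (rule FieldE)
    then have "x = \<phi> (fc i (\<delta> w))" using \<phi> \<delta> centralizer_mem by simp
    then show "x \<in> \<phi> ` Field le" using iw \<delta> centralizer_mem fc_Field by blast
  qed
  then have "bij_betw \<phi> (Field le) (Field le)"
    using fin by (simp add: bij_betw_def eq_card_imp_inj_on)
  then have "\<phi> \<in> Bij (Field le)" by (simp add: Bij_def \<phi>_def)
  moreover have "(x, y) \<in> le \<longleftrightarrow> (\<phi> x, \<phi> y) \<in> le" if xy: "x \<in> Field le" "y \<in> Field le" for x y
  proof
    assume "(x, y) \<in> le"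
    then obtain i j w where "i \<in> ranks" "j \<in> ranks" "i \<le> j" "w \<in> \<Omega>" "x = fc i w" "y = fc j w"
      by (rule leE)
    then show "(\<phi> x, \<phi> y) \<in> le" using \<phi> le_I centralizer_mem[OF \<gamma>] by simp
  next
    assume le: "(\<phi> x, \<phi> y) \<in> le"
    obtain i v where v: "i \<in> ranks" "v \<in> \<Omega>" "x = fc i v" using xy(1) by (rule FieldE)
    obtain j w where w: "j \<in> ranks" "w \<in> \<Omega>" "y = fc j w" using xy(2) by (rule FieldE)
    obtain i' j' u where u: "i' \<in> ranks" "j' \<in> ranks" "i' \<le> j'" "u \<in> \<Omega>" "\<phi> x = fc i' u" "\<phi> y = fc j' u"
      using le by (rule leE)
    have "rk (\<phi> x) = i" "rk (\<phi> y) = j" using \<phi> v w centralizer_mem[OF \<gamma>] by simp_all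
    then have ij: "i' = i" "j' = j" using u by simp_all
    have "fc i (\<gamma> v) = fc i (\<gamma> (\<delta> u))" "fc j (\<gamma> w) = fc j (\<gamma> (\<delta> u))"
      using \<phi> v w u \<delta>(2) ij by simp_all
    then have "x = fc i (\<delta> u)" "y = fc j (\<delta> u)"
      using centralizer_fc[OF \<gamma>] v w u centralizer_mem[OF \<delta>(1)] by simp_all
    then show "(x, y) \<in> le" using le_I u ij centralizer_mem[OF \<delta>(1)] by simp
  qed
  ultimately have "\<phi> \<in> poset_auts le" by (simp add: poset_auts_def)
  moreover have "lift \<phi> = \<gamma>"
  proof (rule extensionalityI)
    show "lift \<phi> \<in> extensional \<Omega>" by (simp add: lift_def)
    show "\<gamma> \<in> extensional \<Omega>" using \<gamma> by (simp add: centralizer_def Bij_def)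
    show "lift \<phi> w = \<gamma> w" if "w \<in> \<Omega>" for w
      by (rule lift_eqI) (use that \<phi> centralizer_mem[OF \<gamma>] in auto)
  qed
  ultimately show ?thesis by blast
qed

lemma inj_on_lift: "inj_on lift (poset_auts le)"
proof (rule inj_onI)
  fix \<phi> \<psi> assume *: "\<phi> \<in> poset_auts le" "\<psi> \<in> poset_auts le" "lift \<phi> = lift \<psi>"
  show "\<phi> = \<psi>"
  proof (rule extensionalityI)
    show "\<phi> \<in> extensional (Field le)" "\<psi> \<in> extensional (Field le)"
      using *(1,2) by (auto simp: poset_auts_def Bij_def)
    fix x assume "x \<in> Field le"
    then obtain i w where "i \<in> ranks" "w \<in> \<Omega>" "x = fc i w" by (rule FieldE)
    then show "\<phi> x = \<psi> x" using lift_props(2)[OF *(1)] lift_props(2)[OF *(2)] *(3) by simp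
  qed
qed

lemma lift_hom: "group_hom (aut_group le) centralizer_group lift"
proof (intro group_hom.intro group_hom_axioms.intro homI)
  show "group (aut_group le)" by (rule group_aut_group)
  show "group centralizer_group" by (rule group_centralizer_group)
  show "lift \<phi> \<in> carrier centralizer_group" if "\<phi> \<in> carrier (aut_group le)" for \<phi>
    using that lift_centralizer by (simp add: aut_group_def centralizer_group_def)
next
  fix \<phi> \<psi> assume "\<phi> \<in> carrier (aut_group le)" "\<psi> \<in> carrier (aut_group le)"
  then have \<phi>: "\<phi> \<in> poset_auts le" and \<psi>: "\<psi> \<in> poset_auts le" by (simp_all add: aut_group_def)
  have B: "\<phi> \<in> Bij (Field le)" "\<psi> \<in> Bij (Field le)" using \<phi> \<psi> by (simp_all add: poset_auts_def)
  have B': "lift \<phi> \<in> Bij \<Omega>" "lift \<psi> \<in> Bij \<Omega>"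
    using lift_centralizer[OF \<phi>] lift_centralizer[OF \<psi>] by (simp_all add: centralizer_def)
  have "lift (compose (Field le) \<phi> \<psi>) = compose \<Omega> (lift \<phi>) (lift \<psi>)"
  proof (rule extensionalityI)
    show "lift (compose (Field le) \<phi> \<psi>) w = compose \<Omega> (lift \<phi>) (lift \<psi>) w" if "w \<in> \<Omega>" for w
      by (rule lift_eqI) (use that lift_props[OF \<phi>] lift_props[OF \<psi>] fc_Field in \<open>auto simp: compose_eq\<close>)
  qed (auto simp: lift_def compose_def)
  then show "lift (\<phi> \<otimes>\<^bsub>aut_group le\<^esub> \<psi>) = lift \<phi> \<otimes>\<^bsub>centralizer_group\<^esub> lift \<psi>"
    using B B' by (simp add: aut_group_def centralizer_group_def BijGroup_def)
qed

lemma order_aut_group: "order (aut_group le) = card centralizer"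
proof -
  have "lift ` poset_auts le = centralizer" using lift_centralizer lift_surj by blast
  then have "card (poset_auts le) = card centralizer" using inj_on_lift card_image by metis
  then show ?thesis by (simp add: order_def aut_group_def)
qed

lemma solvable_aut_group:
  assumes "solvable_seq (BijGroup \<Omega>) centralizer"
  shows "solvable (aut_group le)"
proof -
  interpret B: group "BijGroup \<Omega>" by (rule group_BijGroup)
  interpret id: group_hom centralizer_group "BijGroup \<Omega>" id
    using subgroup_centralizer group_centralizer_group unfolding centralizer_group_def
    by (intro group_hom.intro group_hom_axioms.intro homI) (auto dest: subgroup.mem_carrier)
  interpret lift: group_hom "aut_group le" centralizer_group lift by (rule lift_hom)
  have "solvable_seq centralizer_group centralizer"
    by (rule id.solvable_img_imp_solvable)
      (use assms id.G.subgroup_self in \<open>auto simp: centralizer_group_def\<close>)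
  then have "solvable centralizer_group" by (simp add: solvable_def centralizer_group_def)
  then show ?thesis
    by (intro lift.inj_hom_imp_solvable) (use inj_on_lift in \<open>simp_all add: aut_group_def\<close>)
qed

lemma orbit_flag:
  assumes "w \<in> \<Omega>"
  shows "orbit (aut_group le) (`) (fl w) = (\<lambda>\<gamma>. fl (\<gamma> w)) ` centralizer"
proof -
  have "\<phi> ` fl w = fl (lift \<phi> w)" if "\<phi> \<in> poset_auts le" for \<phi>
    unfolding fl_def image_image using lift_props(2)[OF that assms] by simp
  then have "orbit (aut_group le) (`) (fl w) = (\<lambda>\<phi>. fl (lift \<phi> w)) ` poset_auts le"
    unfolding orbit_def aut_group_def by (auto simp: image_def)
  moreover have "lift ` poset_auts le = centralizer" using lift_centralizer lift_surj by blast
  ultimately show ?thesis by (metis (no_types, lifting) image_cong image_image)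
qed

end

section \<open>Two-coloured flags: chirality, group order and type\<close>

locale chiral_flag_system = face_labelling n \<Omega> r fc
  for n :: nat and \<Omega> :: "'f set" and r and fc :: "int \<Rightarrow> 'f \<Rightarrow> 'a" +
  fixes par :: "'f \<Rightarrow> bool"
  assumes rank_pos: "0 < n"
    and par_r: "\<And>j w. j \<in> {0..<int n} \<Longrightarrow> w \<in> \<Omega> \<Longrightarrow> par (r j w) \<longleftrightarrow> \<not> par w"
    and par_transitive: "\<And>v w. v \<in> \<Omega> \<Longrightarrow> w \<in> \<Omega> \<Longrightarrow> par v = par w \<Longrightarrow> \<exists>\<gamma> \<in> centralizer. \<gamma> v = w"
    and par_preserved: "\<And>\<gamma> w. \<gamma> \<in> centralizer \<Longrightarrow> w \<in> \<Omega> \<Longrightarrow> par (\<gamma> w) = par w"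
begin

lemma orbit_flag_par:
  assumes "w \<in> \<Omega>"
  shows "orbit (aut_group le) (`) (fl w) = fl ` {v \<in> \<Omega>. par v = par w}"
proof -
  have "(\<lambda>\<gamma>. \<gamma> w) ` centralizer = {v \<in> \<Omega>. par v = par w}"
  proof (intro equalityI subsetI)
    fix v assume "v \<in> {v \<in> \<Omega>. par v = par w}"
    then show "v \<in> (\<lambda>\<gamma>. \<gamma> w) ` centralizer" using par_transitive[OF assms, of v] by auto
  qed (use centralizer_mem par_preserved assms in auto)
  then show ?thesis unfolding orbit_flag[OF assms] by (metis image_image)
qed

lemma orbit_flag_eq_iff:
  assumes "v \<in> \<Omega>" "w \<in> \<Omega>"
  shows "orbit (aut_group le) (`) (fl v) = orbit (aut_group le) (`) (fl w) \<longleftrightarrow> par v = par w"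
proof
  assume "orbit (aut_group le) (`) (fl v) = orbit (aut_group le) (`) (fl w)"
  then have "fl v \<in> fl ` {u \<in> \<Omega>. par u = par w}" using orbit_flag_par assms by auto
  then show "par v = par w" using inj_onD[OF inj_on_fl] assms by auto
qed (use orbit_flag_par assms in simp)

lemma chiral_polytope: "chiral_polytope n le rk"
proof (rule chiral_polytope.intro[OF polytope chiral_polytope_axioms.intro])
  obtain w where w: "w \<in> \<Omega>" using flags_nonempty by auto
  have 0: "0 \<in> idx" using rank_pos by simp
  have rw: "r 0 w \<in> \<Omega>" "par (r 0 w) \<longleftrightarrow> \<not> par w" using closed[OF 0 w] par_r[OF 0 w] by auto
  define F where "F v = orbit (aut_group le) (`) (fl v)" for v
  have "orbits (aut_group le) (flags le) (`) = F ` \<Omega>"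
    unfolding orbits_def flags_le F_def by blast
  also have "\<dots> = {F w, F (r 0 w)}"
  proof (intro equalityI subsetI)
    fix B assume "B \<in> F ` \<Omega>"
    then obtain v where "v \<in> \<Omega>" "B = F v" by blast
    then show "B \<in> {F w, F (r 0 w)}"
      using orbit_flag_eq_iff[OF \<open>v \<in> \<Omega>\<close> w] orbit_flag_eq_iff[OF \<open>v \<in> \<Omega>\<close> rw(1)] rw(2)
      by (auto simp: F_def)
  qed (use w rw in auto)
  also have "card \<dots> = 2" using orbit_flag_eq_iff[OF w rw(1)] rw(2) by (simp add: F_def)
  finally show "card (orbits (aut_group le) (flags le) (`)) = 2" .
next
  fix \<Phi> \<Psi> assume "\<Phi> \<in> flags le" "\<Psi> \<in> flags le" and adj: "adjacent rk \<Phi> \<Psi>"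
  then obtain v w where vw: "v \<in> \<Omega>" "w \<in> \<Omega>" "\<Phi> = fl v" "\<Psi> = fl w" by (auto simp: flags_le)
  then obtain j where "j \<in> idx" "v = r j w" using adjacentD[of v w] adj by blast
  then show "orbit (aut_group le) (`) \<Phi> \<noteq> orbit (aut_group le) (`) \<Psi>"
    using orbit_flag_eq_iff[OF vw(1,2)] par_r vw by auto
qed

text \<open>An automorphism is determined by the image of one flag, which can be any flag of the
  same parity; \<open>r 0\<close> matches the flags of the two parities.\<close>

lemma double_order_aut_group: "2 * order (aut_group le) = card \<Omega>"
proof -
  obtain w where w: "w \<in> \<Omega>" using flags_nonempty by auto
  have 0: "0 \<in> idx" using rank_pos by simp
  let ?S = "\<lambda>b. {v \<in> \<Omega>. par v = b}"
  have "bij_betw (\<lambda>\<gamma>. \<gamma> w) centralizer (?S (par w))"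
    unfolding bij_betw_def
  proof
    show "inj_on (\<lambda>\<gamma>. \<gamma> w) centralizer" using centralizer_eqI[OF _ _ w] by (auto intro: inj_onI)
    show "(\<lambda>\<gamma>. \<gamma> w) ` centralizer = ?S (par w)"
      using par_transitive[OF w] centralizer_mem[OF _ w] par_preserved[OF _ w] by auto
  qed
  then have 1: "card centralizer = card (?S (par w))" by (rule bij_betw_same_card)
  have "bij_betw (r 0) (?S (par w)) (?S (\<not> par w))"
    by (rule bij_betw_byWitness[where f' = "r 0"])
      (use closed[OF 0] par_r[OF 0] invol[OF 0] in auto)
  then have 2: "card (?S (par w)) = card (?S (\<not> par w))" by (rule bij_betw_same_card)
  have "\<Omega> = ?S (par w) \<union> ?S (\<not> par w)" by auto
  then have "card \<Omega> = card (?S (par w)) + card (?S (\<not> par w))"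
    using card_Un_disjoint[of "?S (par w)" "?S (\<not> par w)"] finite_flags by auto
  then show ?thesis using 1 2 order_aut_group by simp
qed

text \<open>Parity halves the bookkeeping. Of the flags around the 2-section only the four with the
  parity of \<open>w\<close> are followed, namely the images of \<open>w\<close> under powers of
  \<open>s\<close>, and each \<open>i\<close>-face of the section belongs to exactly one of
  them.\<close>

lemma schlafli_type_4:
  assumes quad: "\<And>i w. i \<in> {1..<int n} \<Longrightarrow> w \<in> \<Omega> \<Longrightarrow>
      ((\<lambda>v. r i (r (i - 1) v)) ^^ 4) w = w \<and> ((\<lambda>v. r i (r (i - 1) v)) ^^ 2) w \<noteq> w"
  shows "has_schlafli_type n le rk (replicate (n - 1) 4)"
  unfolding has_schlafli_type_def
proof (intro conjI ballI allI impI)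
  fix i' F G assume i': "i' \<in> {1..n - 1}" 
    and FG: "(F, G) \<in> le \<and> rk F = int i' - 2 \<and> rk G = int i' + 1"
  define i where "i = int i'"
  have i: "1 \<le> i" "i < int n" using i' by (auto simp: i_def)
  obtain w where "w \<in> \<Omega>" "F = fc (rk F) w" "G = fc (rk G) w" using FG le_common[of F G] by metis
  then have w: "w \<in> \<Omega>" "F = fc (i - 2) w" "G = fc (i + 1) w" using FG by (metis i_def)+
  let ?a = "r (i - 1)" and ?b = "r i"
  have idx: "i - 1 \<in> idx" "i \<in> idx" using i by auto
  define s where "s = (\<lambda>v. ?b (?a v))"
  define w1 where "w1 = s w"
  define w2 where "w2 = s w1"
  define w3 where "w3 = s w2"
  have s: "s v \<in> \<Omega>" "par (s v) = par v" "?b (s v) = ?a v" "s (s (s (s v))) = v" "s (s v) \<noteq> v"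
    if "v \<in> \<Omega>" for v
    using that closed[OF idx(1)] closed[OF idx(2)] par_r[OF idx(1)] par_r[OF idx(2)] invol[OF idx(2)]
      quad[of i v] i by (auto simp: s_def numeral_eq_Suc)
  have \<Omega>: "w1 \<in> \<Omega>" "w2 \<in> \<Omega>" "w3 \<in> \<Omega>" using s(1) w(1) by (auto simp: w1_def w2_def w3_def)
  have s3: "s w3 = w" using s(4)[OF w(1)] by (simp add: w1_def w2_def w3_def)
  let ?W = "{w, w1, w2, w3}"
  have neq: "w \<noteq> w1" "w \<noteq> w2" "w \<noteq> w3" "w1 \<noteq> w2" "w1 \<noteq> w3" "w2 \<noteq> w3"
    using s(5)[OF w(1)] s(5)[OF \<Omega>(1)] s(5)[OF \<Omega>(2)] s(5)[OF \<Omega>(3)] s3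
    by (metis w1_def w2_def w3_def)+
  have W\<Omega>: "?W \<subseteq> \<Omega>" using w \<Omega> by auto
  have Wpar: "par v = par w" if "v \<in> ?W" for v
    using that s(2) w(1) \<Omega> by (auto simp: w1_def w2_def w3_def)
  have inj: "inj_on (fc i) ?W"
  proof (rule inj_onI)
    fix u v assume uv: "u \<in> ?W" "v \<in> ?W" "fc i u = fc i v"
    have \<Omega>': "u \<in> \<Omega>" "v \<in> \<Omega>" using uv W\<Omega> by auto
    have W1: "x \<in> orb r {i - 1, i} w" if "x \<in> ?W" for x
      using that by (auto simp: w1_def w2_def w3_def s_def intro!: orb.intros)
    \<comment> \<open>Two flags of the list with the same \<open>i\<close>-face can differ in rank
      \<open>i - 1\<close> only, but \<open>r (i - 1)\<close> would change the parity.\<close>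
    have "u \<in> orb r (idx - ((ranks - {i - 1, i}) \<union> {i})) v"
    proof (rule orb_of_faces[OF \<Omega>'])
      fix k assume "k \<in> (ranks - {i - 1, i}) \<union> {i}"
      then show "fc k u = fc k v"
        using uv(3) fc_orb[OF W1[OF uv(1)] w(1), of k] fc_orb[OF W1[OF uv(2)] w(1), of k] idx by auto
    qed (use i in auto)
    moreover have "idx - ((ranks - {i - 1, i}) \<union> {i}) = {i - 1}" using i by auto
    ultimately have "u = v \<or> u = ?a v" using orb_single[OF idx(1) \<Omega>'(2)] by metis
    moreover have "u \<noteq> ?a v" using par_r[OF idx(1) \<Omega>'(2)] Wpar uv by metis
    ultimately show "u = v" by blast
  qed
  have orbW: "v \<in> ?W \<or> (\<exists>u \<in> ?W. v = ?a u)" if "v \<in> orb r {i - 1, i} w" for v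
    using that
  proof (rule orb_invariant)
    fix v j assume v: "v \<in> ?W \<or> (\<exists>u \<in> ?W. v = ?a u)" and j: "j \<in> {i - 1, i}"
    have b1: "?b w1 = ?a w" "?b w2 = ?a w1" "?b w3 = ?a w2" "?b w = ?a w3"
      using s(3) w(1) \<Omega> s3 by (auto simp: w1_def w2_def w3_def) (metis s(3) \<Omega>(3) w3_def w2_def w1_def)
    have b2: "?b (?a w) = w1" "?b (?a w1) = w2" "?b (?a w2) = w3" "?b (?a w3) = w"
      using s3 by (simp_all add: w1_def w2_def w3_def s_def)
    have a2: "?a (?a u) = u" if "u \<in> ?W" for u using invol[OF idx(1)] W\<Omega> that by blast
    show "r j v \<in> ?W \<or> (\<exists>u \<in> ?W. r j v = ?a u)"
    proof (cases "j = i")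
      case True
      then show ?thesis using v b1 b2 by auto
    next
      case False
      then have "j = i - 1" using j by auto
      then show ?thesis using v a2 by auto
    qed
  qed simp
  have "{H \<in> poset_section le G F. rk H = i} = fc i ` ?W"
  proof (intro equalityI subsetI)
    fix H assume "H \<in> {H \<in> poset_section le G F. rk H = i}"
    then have H: "(fc (i - 2) w, H) \<in> le" "(H, fc (i + 1) w) \<in> le" "rk H = i"
      using w by (auto simp: poset_section_def)
    have "\<exists>u \<in> orb r {i - 2<..<i + 1} w. H = fc i u"
      by (rule fc_between_orb[OF w(1) _ _ H]) (use i in auto)
    moreover have "{i - 2<..<i + 1} = {i - 1, i}" by auto
    ultimately obtain u where u: "u \<in> orb r {i - 1, i} w" "H = fc i u" by auto
    moreover have "fc i (?a v) = fc i v" if "v \<in> ?W" for v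
      using fc_r_other[OF idx(1), of v i] that W\<Omega> i by auto
    ultimately show "H \<in> fc i ` ?W" using orbW by fastforce
  next
    fix H assume "H \<in> fc i ` ?W"
    then obtain u where u: "u \<in> ?W" "H = fc i u" by blast
    have uo: "u \<in> orb r {i - 1, i} w"
      using u(1) by (auto simp: w1_def w2_def w3_def s_def intro!: orb.intros)
    have "u \<in> \<Omega>" using u(1) W\<Omega> by blast
    have "fc (i - 2) u = F" "fc (i + 1) u = G"
      using fc_orb[OF uo w(1), of "i - 2"] fc_orb[OF uo w(1), of "i + 1"] idx i w(2,3) by auto
    then show "H \<in> {H \<in> poset_section le G F. rk H = i}"
      using le_I[of "i - 2" i u] le_I[of i "i + 1" u] u(2) \<open>u \<in> \<Omega>\<close> i by (auto simp: poset_section_def)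
  qed
  moreover have "card (fc i ` ?W) = 4" using card_image[OF inj] neq by simp
  moreover have "replicate (n - 1) 4 ! (i' - 1) = (4 :: nat)"
    using i' by (cases i') auto
  ultimately show "finite {H \<in> poset_section le G F. rk H = int i'}"
    "card {H \<in> poset_section le G F. rk H = int i'} = replicate (n - 1) 4 ! (i' - 1)"
    by (simp_all flip: i_def)
qed simp

end

section \<open>The gluing of 32 facets\<close>

type_synonym cell = "bool \<times> bool \<times> bool \<times> bool \<times> bool"
type_synonym flag = "cell \<times> (int \<times> int) \<times> (int \<times> int) \<times> (int \<times> int)"

text \<open>A complete invariant of squares modulo the lattice spanned by \<open>(2, 2)\<close> and
  \<open>(2, -2)\<close>: that lattice has index 8, and all eight triples occur.\<close>

definition colour :: "int \<times> int \<Rightarrow> bool \<times> bool \<times> bool" where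
  "colour t = (odd (fst t), odd (snd t), odd ((fst t + snd t) div 2))"

text \<open>
  In a facet \<open>(p, i, j, q, c)\<close> the entries \<open>p, i, j, q\<close> are coordinates of the abelianised action,
  and \<open>c\<close> is shifted by its centre. The term \<open>(i + p a) b\<close> of the cocycle makes two squares commute
  unless their colours differ in both \<open>a\<close> and \<open>b\<close>. By itself it is not compatible with quarter
  turns; the term \<open>(a + b) d\<close> repairs this for rotations but not for reflections.
\<close>

fun flip :: "bool \<times> bool \<times> bool \<Rightarrow> cell \<Rightarrow> cell" where
  "flip (a, b, d) (p, i, j, q, c) =
     (\<not> p, i \<noteq> a, j \<noteq> b, q \<noteq> d, c \<noteq> (((i \<noteq> (p \<and> a)) \<and> b) \<noteq> ((a \<noteq> b) \<and> d)))"

abbreviation glue :: "int \<times> int \<Rightarrow> cell \<Rightarrow> cell" where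
  "glue t \<equiv> flip (colour t)"

lemma flip_flip [simp]: "flip k (flip k x) = x"
  by (cases k; cases x) auto

lemma flip_commute:
  assumes "a = a' \<or> b = b'"
  shows "flip (a, b, d) (flip (a', b', d') x) = flip (a', b', d') (flip (a, b, d) x)"
  using assms by (cases x) (simp only: flip.simps prod.inject, argo)

lemma fst_flip [simp]: "fst (flip k x) \<longleftrightarrow> \<not> fst x"
  by (cases k; cases x) auto

lemma flip_neq [simp]: "flip k x \<noteq> x"
  by (cases k; cases x) auto

text \<open>Squares of different colours thus lead from a facet to different neighbours. This keeps
  the rotation about an edge, \<open>r 3\<close> after \<open>r 2\<close>, from having period
  2.\<close>

lemma flip_flip_eq_iff: "flip k (flip l x) = x \<longleftrightarrow> k = l"
proof
  assume "flip k (flip l x) = x"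
  then show "k = l" by (cases k; cases l; cases x) (simp only: flip.simps prod.inject, argo)
qed simp

text \<open>Transitivity of the gluings on the 32 facets. The coordinates are corrected one at a
  time with \<open>c\<close> last, because the switch of \<open>j\<close> disturbs \<open>c\<close>;
  the switch of \<open>c\<close> alone is the commutator of those of \<open>i\<close> and
  \<open>j\<close>.\<close>

lemma flip_closed_UNIV:
  assumes closed: "\<And>k x. x \<in> S \<Longrightarrow> flip k x \<in> S" and "x \<in> S"
  shows "y \<in> S"
proof -
  have P: "(\<not> p, i, j, q, c) \<in> S" if "(p, i, j, q, c) \<in> S" for p i j q c
    using closed[OF that, of "(False, False, False)"] by simp
  have two: "flip k (flip l x) \<in> S" if "x \<in> S" for k l x using closed that by blast
  have I: "(p, \<not> i, j, q, c) \<in> S" if "(p, i, j, q, c) \<in> S" for p i j q c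
    using two[OF that, of "(True, False, False)" "(False, False, False)"] by simp
  have J: "(p, i, \<not> j, q, c \<noteq> i) \<in> S" if "(p, i, j, q, c) \<in> S" for p i j q c
    using two[OF that, of "(False, True, False)" "(False, False, False)"] by simp
  have Q: "(p, i, j, \<not> q, c) \<in> S" if "(p, i, j, q, c) \<in> S" for p i j q c
    using two[OF that, of "(False, False, True)" "(False, False, False)"] by simp
  have C: "(p, i, j, q, \<not> c) \<in> S" if "(p, i, j, q, c) \<in> S" for p i j q c
  proof -
    have "(p, i, j, q, (c \<noteq> i) \<noteq> (\<not> i)) \<in> S"
      using I[OF J[OF I[OF J[OF that]]]] by simp
    moreover have "((c \<noteq> i) \<noteq> (\<not> i)) = (\<not> c)" by blast
    ultimately show ?thesis by simp
  qed
  obtain p i j q c where x: "x = (p, i, j, q, c)" by (cases x)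
  obtain p' i' j' q' c' where y: "y = (p', i', j', q', c')" by (cases y)
  have "(p', i, j, q, c) \<in> S" using P[of p i j q c] assms(2) unfolding x by (cases p; cases p') auto
  then have "(p', i', j, q, c) \<in> S" using I[of p' i j q c] by (cases i; cases i') auto
  then have "\<exists>e. (p', i', j', q, e) \<in> S" using J[of p' i' j q c] by (cases j; cases j') auto
  then obtain e where "(p', i', j', q, e) \<in> S" by blast
  then have "(p', i', j', q', e) \<in> S" using Q[of p' i' j' q e] by (cases q; cases q') auto
  then show ?thesis unfolding y using C[of p' i' j' q' e] by (cases e; cases c') auto
qed

lemma odd_half_add_1: "odd ((k + 1) div 2) \<longleftrightarrow> odd (k div 2) \<noteq> odd k" for k :: int
  by presburger

lemma odd_half_diff_double: "odd ((k - 2 * l) div 2) \<longleftrightarrow> odd (k div 2) \<noteq> odd l" for k l :: int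
  by presburger

lemma colour_add_10: "colour t = (a, b, d) \<Longrightarrow> colour (t + (1, 0)) = (\<not> a, b, d \<noteq> (a \<noteq> b))"
  using odd_half_add_1[of "fst t + snd t"] unfolding colour_def
  by (cases t) (auto simp: algebra_simps)

lemma colour_add_01: "colour t = (a, b, d) \<Longrightarrow> colour (t + (0, 1)) = (a, \<not> b, d \<noteq> (a \<noteq> b))"
  using odd_half_add_1[of "fst t + snd t"] unfolding colour_def
  by (cases t) (auto simp: algebra_simps)

definition rot :: "int \<times> int \<Rightarrow> int \<times> int" where "rot t = (- snd t, fst t)"
definition mirror :: "int \<times> int \<Rightarrow> int \<times> int" where "mirror t = (fst t, - snd t)"

lemma colour_rot: "colour t = (a, b, d) \<Longrightarrow> colour (rot t) = (b, a, d \<noteq> b)"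
  using odd_half_diff_double[of "fst t + snd t" "snd t"] unfolding colour_def rot_def
  by (cases t) (auto simp: algebra_simps)

lemma colour_mirror: "colour t = (a, b, d) \<Longrightarrow> colour (mirror t) = (a, b, d \<noteq> b)"
  using odd_half_diff_double[of "fst t + snd t" "snd t"] unfolding colour_def mirror_def
  by (cases t) (auto simp: algebra_simps)

definition units :: "(int \<times> int) set" where "units = {(1, 0), (-1, 0), (0, 1), (0, -1)}"

text \<open>The eight flags of a single square, grouped by orientation.\<close>

definition frames :: "((int \<times> int) \<times> (int \<times> int)) set" where
  "frames = (\<lambda>u. (u, rot u)) ` units \<union> (\<lambda>u. (u, - rot u)) ` units"

lemma frames_eq: "frames =
  {((1, 0), (0, -1)), ((-1, 0), (0, 1)), ((0, 1), (1, 0)), ((0, -1), (-1, 0)),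
   ((1, 0), (0, 1)), ((-1, 0), (0, -1)), ((0, 1), (-1, 0)), ((0, -1), (1, 0))}"
  unfolding frames_def units_def rot_def by simp

lemma card_frames: "card frames = 8"
  unfolding frames_eq by simp

lemma frames_cases:
  assumes "(u, v) \<in> frames" "(u', v') \<in> frames"
  shows "(u', v') \<in> {(u, v), (- u, v), (u, - v), (- u, - v), (v, u), (- v, u), (v, - u), (- v, - u)}"
proof -
  have rots: "rot (- t) = - rot t" "rot (rot t) = - t" for t by (simp_all add: rot_def prod_eq_iff)
  have "u \<in> units" "u' \<in> units" and v: "v = rot u \<or> v = - rot u" and v': "v' = rot u' \<or> v' = - rot u'"
    using assms unfolding frames_def by auto
  then have "u' = u \<or> u' = - u \<or> u' = rot u \<or> u' = - rot u"
    unfolding units_def by (elim insertE emptyE) (simp_all add: rot_def)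
  then show ?thesis using v v' by (elim disjE) (simp_all add: rots)
qed

lemma frames_sym:
  assumes "(u, v) \<in> frames"
  shows "(v, u) \<in> frames" "(- u, v) \<in> frames" "(u, - v) \<in> frames"
  using assms unfolding frames_eq by (elim insertE emptyE Pair_inject; simp)+

lemma framesD: "(u, v) \<in> frames \<Longrightarrow> u \<in> units \<and> v \<in> units \<and> u \<noteq> v \<and> u \<noteq> - v"
  unfolding frames_eq units_def by (elim insertE emptyE Pair_inject; simp)

lemma units_frame: "u \<in> units \<Longrightarrow> \<exists>v. (u, v) \<in> frames"
  unfolding frames_eq units_def by auto

lemma unit_neq_uminus: "u \<in> units \<Longrightarrow> u \<noteq> - u" "u \<in> units \<Longrightarrow> - u \<noteq> u"
  unfolding units_def by auto

lemma colour_add_unit: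
  assumes "u \<in> units"
  shows "(fst (colour (t + u)) = fst (colour t)) \<noteq> (fst (snd (colour (t + u))) = fst (snd (colour t)))"
  using assms unfolding units_def colour_def by (cases t) auto

text \<open>Squares that share an edge differ in exactly one of the parities \<open>a\<close> and
  \<open>b\<close>, so the facets around that edge close up after four crossings.\<close>

lemma glue_commute:
  assumes "u \<in> units"
  shows "glue (t + u) (glue t x) = glue t (glue (t + u) x)"
proof -
  obtain a b d where c: "colour t = (a, b, d)" by (cases "colour t")
  obtain a' b' d' where c': "colour (t + u) = (a', b', d')" by (cases "colour (t + u)")
  show ?thesis unfolding c c' by (rule flip_commute) (use colour_add_unit[OF assms, of t] c c' in auto)
qed

lemma glue_glue_neq: "u \<in> units \<Longrightarrow> glue t (glue (t + u) x) \<noteq> x"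
  unfolding flip_flip_eq_iff using colour_add_unit[of u t] by auto

section \<open>Identifying squares modulo a lattice\<close>

text \<open>
  The flag \<open>(x, t, u, v)\<close> lies in the facet \<open>x\<close>; within the square tessellation of that facet its
  square has centre \<open>t\<close>, its edge has midpoint \<open>t + u / 2\<close> and its vertex is \<open>t + (u + v) / 2\<close>.
  Squares are identified modulo the lattice \<open>\<Lambda>\<close>, with \<open>N t\<close> the representative of \<open>t + \<Lambda>\<close>.
\<close>

locale square_torus =
  fixes N :: "int \<times> int \<Rightarrow> int \<times> int" and \<Lambda> :: "(int \<times> int) set"
  assumes N_eq_iff: "\<And>s t. N s = N t \<longleftrightarrow> s - t \<in> \<Lambda>"
    and N_N [simp]: "\<And>t. N (N t) = N t"
    and lattice_zero: "0 \<in> \<Lambda>"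
    and lattice_diff: "\<And>s t. s \<in> \<Lambda> \<Longrightarrow> t \<in> \<Lambda> \<Longrightarrow> s - t \<in> \<Lambda>"
    and lattice_rot: "\<And>t. t \<in> \<Lambda> \<Longrightarrow> rot t \<in> \<Lambda>"
    and lattice_mirror: "\<And>t. t \<in> \<Lambda> \<Longrightarrow> mirror t \<in> \<Lambda>"
    and lattice_even: "\<And>t. t \<in> \<Lambda> \<Longrightarrow> even (fst t) \<and> 4 dvd fst t + snd t"
    and finite_torus: "finite (range N)"
begin

lemma lattice_uminus: "t \<in> \<Lambda> \<Longrightarrow> - t \<in> \<Lambda>"
  using lattice_diff[OF lattice_zero, of t] by simp

lemma lattice_add: "s \<in> \<Lambda> \<Longrightarrow> t \<in> \<Lambda> \<Longrightarrow> s + t \<in> \<Lambda>"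
  using lattice_diff[of s "- t"] lattice_uminus by simp

lemma N_add [simp]: "N (N s + t) = N (s + t)" "N (t + N s) = N (t + s)" "N (N s - t) = N (s - t)"
  "N (t - N s) = N (t - s)"
proof -
  have "N s - s \<in> \<Lambda>" using N_eq_iff[of "N s" s] by simp
  moreover from this have "s - N s \<in> \<Lambda>" using lattice_uminus by fastforce
  ultimately show "N (N s + t) = N (s + t)" "N (t + N s) = N (t + s)" "N (N s - t) = N (s - t)"
    "N (t - N s) = N (t - s)"
    unfolding N_eq_iff by (simp_all add: algebra_simps)
qed

lemma N_range: "t \<in> range N \<Longrightarrow> N t = t" by auto

lemma lattice_fst_snd_even: "t \<in> \<Lambda> \<Longrightarrow> even (fst t) \<and> even (snd t)"
  using lattice_even[of t] by presburger

lemma units_not_lattice: "u \<in> units \<Longrightarrow> u \<notin> \<Lambda>"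
  using lattice_fst_snd_even unfolding units_def by fastforce

text \<open>\<open>lattice_even\<close> places \<Lambda> inside the lattice of colour classes, which
  makes the gluing well defined on the torus.\<close>

lemma colour_lattice:
  assumes "s - t \<in> \<Lambda>"
  shows "colour s = colour t"
proof -
  have "2 dvd fst s - fst t" and "4 dvd fst s - fst t + (snd s - snd t)"
    using lattice_even[OF assms] by auto
  then obtain a k where a: "fst s - fst t = 2 * a" and k: "fst s - fst t + (snd s - snd t) = 4 * k"
    by (metis dvdE)
  have "odd (fst s) = odd (fst t)" using a by presburger
  moreover have "odd (snd s) = odd (snd t)" using a k by presburger
  moreover have "fst s + snd s = fst t + snd t + 2 * (2 * k)" using k by simp
  then have "(fst s + snd s) div 2 = (fst t + snd t) div 2 + 2 * k" by simp
  ultimately show ?thesis unfolding colour_def by simp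
qed

lemma colour_N [simp]: "colour (N t) = colour t"
  by (rule colour_lattice) (use N_eq_iff[of "N t" t] in simp)

definition \<Omega> :: "flag set" where
  "\<Omega> = UNIV \<times> range N \<times> frames"

text \<open>The moves change the vertex, the edge, the square and the facet. When an edge is
  crossed, \<open>u\<close> is reversed because from the new square it has to point back to the same
  edge.\<close>

fun r :: "int \<Rightarrow> flag \<Rightarrow> flag" where
  "r k (x, t, u, v) =
     (if k = 0 then (x, t, u, - v)
      else if k = 1 then (x, t, v, u)
      else if k = 2 then (x, N (t + u), - u, v)
      else (glue t x, t, u, v))"

lemma r_simps:
  "r 0 (x, t, u, v) = (x, t, u, - v)"
  "r 1 (x, t, u, v) = (x, t, v, u)"
  "r 2 (x, t, u, v) = (x, N (t + u), - u, v)"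
  "r 3 (x, t, u, v) = (glue t x, t, u, v)"
  by simp_all

declare r.simps [simp del]
declare r_simps [simp]

lemma mem_\<Omega>: "(x, t, u, v) \<in> \<Omega> \<longleftrightarrow> t \<in> range N \<and> (u, v) \<in> frames"
  unfolding \<Omega>_def by simp

lemma \<Omega>E:
  assumes "w \<in> \<Omega>"
  obtains x t u v where "w = (x, t, u, v)" "t \<in> range N" "(u, v) \<in> frames"
  using assms by (cases w) (auto simp: mem_\<Omega>)

section \<open>The axioms of a flag system for the glued tori\<close>

lemma idx4: "j \<in> {0..<int 4} \<longleftrightarrow> j = 0 \<or> j = 1 \<or> j = 2 \<or> j = 3"
  by auto

lemma r_closed:
  assumes "j \<in> {0..<int 4}" "w \<in> \<Omega>"
  shows "r j w \<in> \<Omega>"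
proof -
  obtain x t u v where "w = (x, t, u, v)" "t \<in> range N" "(u, v) \<in> frames" using assms(2) by (rule \<Omega>E)
  then show ?thesis using assms(1) unfolding idx4 by (auto simp: mem_\<Omega> frames_sym)
qed

lemma r_invol:
  assumes "j \<in> {0..<int 4}" "w \<in> \<Omega>"
  shows "r j (r j w) = w"
proof -
  obtain x t u v where "w = (x, t, u, v)" "t \<in> range N" "(u, v) \<in> frames" using assms(2) by (rule \<Omega>E)
  then show ?thesis using assms(1) unfolding idx4 by auto
qed

lemma r_far_commute:
  assumes "i \<in> {0..<int 4}" "j \<in> {0..<int 4}" "i + 2 \<le> j"
  shows "r i (r j w) = r j (r i w)"
proof -
  obtain x t u v where "w = (x, t, u, v)" by (cases w)
  then show ?thesis using assms unfolding idx4 by auto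
qed

lemma r_neq:
  assumes "j \<in> {0..<int 4}" "w \<in> \<Omega>"
  shows "r j w \<noteq> w"
proof -
  obtain x t u v where "w = (x, t, u, v)" "t \<in> range N" "(u, v) \<in> frames" using assms(2) by (rule \<Omega>E)
  moreover from this have "v \<noteq> u" "- v \<noteq> v" "- u \<noteq> u"
    using framesD unit_neq_uminus by metis+
  ultimately show ?thesis using assms(1) unfolding idx4 by auto
qed

text \<open>The alternating words in \<open>r 1\<close> and \<open>r 2\<close> run around a vertex
  and meet every frame; which square carries the frame is left open.\<close>

lemma orb_vertex_frames:
  assumes "{1, 2} \<subseteq> J" "(u, v) \<in> frames" "(u', v') \<in> frames"
  shows "\<exists>s. (x, s, u', v') \<in> orb r J (x, t, u, v)"
proof -
  let ?w = "(x, t, u, v)"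
  have st: "r 1 w \<in> orb r J ?w" "r 2 w \<in> orb r J ?w" if "w \<in> orb r J ?w" for w
    using that assms(1) by (auto intro: orb.orb_step)
  have 0: "?w \<in> orb r J ?w" by (rule orb.orb_base)
  note a = st(1)[OF 0] and b = st(2)[OF 0]
  note ab = st(2)[OF a] and ba = st(1)[OF b]
  note aba = st(1)[OF ab] and bab = st(2)[OF ba]
  note abab = st(2)[OF aba]
  note all = 0 a[unfolded r_simps] b[unfolded r_simps] ab[unfolded r_simps] ba[unfolded r_simps]
    aba[unfolded r_simps] bab[unfolded r_simps] abab[unfolded r_simps]
  from frames_cases[OF assms(2,3)] show ?thesis
    by (elim insertE emptyE Pair_inject; simp only:) (use all in blast)+
qed

lemma orb_square_frames:
  assumes "{0, 1} \<subseteq> J" "(u, v) \<in> frames" "(u', v') \<in> frames"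
  shows "(x, t, u', v') \<in> orb r J (x, t, u, v)"
proof -
  let ?w = "(x, t, u, v)"
  have st: "r 1 w \<in> orb r J ?w" "r 0 w \<in> orb r J ?w" if "w \<in> orb r J ?w" for w
    using that assms(1) by (auto intro: orb.orb_step)
  have 0: "?w \<in> orb r J ?w" by (rule orb.orb_base)
  note a = st(1)[OF 0] and b = st(2)[OF 0]
  note ab = st(2)[OF a] and ba = st(1)[OF b]
  note aba = st(1)[OF ab] and bab = st(2)[OF ba]
  note abab = st(2)[OF aba]
  from frames_cases[OF assms(2,3)] show ?thesis
    using 0 a b ab ba aba bab abab by (elim insertE emptyE Pair_inject; simp)
qed

text \<open>Turn within the square until \<open>u\<close> is \<open>e\<close>, cross that edge, and
  turn again.\<close>

lemma orb_torus_step: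
  assumes J: "{0, 1, 2} \<subseteq> J" and e: "e \<in> units"
    and all: "\<And>u' v'. (u', v') \<in> frames \<Longrightarrow> (x, s, u', v') \<in> orb r J w"
    and uv: "(u, v) \<in> frames"
  shows "(x, N (s + e), u, v) \<in> orb r J w"
proof -
  obtain v' where v': "(e, v') \<in> frames" using units_frame[OF e] by blast
  have "r 2 (x, s, e, v') \<in> orb r J w"
    by (rule orb.orb_step[OF all[OF v']]) (use J in auto)
  then have "(x, N (s + e), - e, v') \<in> orb r J w" by simp
  moreover have "(x, N (s + e), u, v) \<in> orb r J (x, N (s + e), - e, v')"
    using J by (intro orb_square_frames[OF _ frames_sym(2)[OF v'] uv]) blast
  ultimately show ?thesis by (rule orb_trans[rotated])
qed

lemma orb_torus:
  assumes J: "{0, 1, 2} \<subseteq> J" and "(x, t, u, v) \<in> \<Omega>" "(x, t', u', v') \<in> \<Omega>"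
  shows "(x, t', u', v') \<in> orb r J (x, t, u, v)"
proof -
  let ?w = "(x, t, u, v)"
  have t: "N t = t" "N t' = t'" and uv: "(u, v) \<in> frames" "(u', v') \<in> frames"
    using assms(2,3) by (auto simp: mem_\<Omega>)
  define P where "P s \<longleftrightarrow> (\<forall>u' v'. (u', v') \<in> frames \<longrightarrow> (x, N s, u', v') \<in> orb r J ?w)" for s
  have P0: "P t" unfolding P_def t using orb_square_frames[OF _ uv(1), of J] J by blast
  have step: "P (s + e)" if "P s" "e \<in> units" for s e
    unfolding P_def
  proof (intro allI impI)
    fix u' v' assume f: "(u', v') \<in> frames"
    have "(x, N (N s + e), u', v') \<in> orb r J ?w"
      by (rule orb_torus_step[OF J that(2) _ f]) (use that(1) in \<open>auto simp: P_def\<close>)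
    then show "(x, N (s + e), u', v') \<in> orb r J ?w" by simp
  qed
  have 1: "P (t + (a, 0))" for a
  proof (induction a rule: int_induct[where k = 0])
    case base
    then show ?case using P0 by (simp flip: zero_prod_def)
  next
    case (step1 a)
    then show ?case using step[of "t + (a, 0)" "(1, 0)"] by (simp add: add.assoc units_def)
  next
    case (step2 a)
    then show ?case using step[of "t + (a, 0)" "(-1, 0)"] by (simp add: add.assoc units_def)
  qed
  have 2: "P (t + (a, b))" for a b
  proof (induction b rule: int_induct[where k = 0])
    case base
    then show ?case using 1 by simp
  next
    case (step1 b)
    then show ?case using step[of "t + (a, b)" "(0, 1)"] by (simp add: add.assoc units_def)
  next
    case (step2 b)
    then show ?case using step[of "t + (a, b)" "(0, -1)"] by (simp add: add.assoc units_def)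
  qed
  have "t + (fst (t' - t), snd (t' - t)) = t'" unfolding prod.collapse by simp
  then have "P t'" using 2[of "fst (t' - t)" "snd (t' - t)"] by (simp only:)
  then show ?thesis using uv(2) unfolding P_def t(2) by blast
qed

text \<open>Walk within the facet to the square of \<open>s\<close>, cross it, and walk back along
  the torus of the neighbouring facet.\<close>

lemma orb_glue:
  assumes "(x, t, u, v) \<in> \<Omega>"
  shows "(glue s x, t, u, v) \<in> orb r {0..<int 4} (x, t, u, v)"
proof -
  let ?J = "{0..<int 4}"
  have J: "{0, 1, 2} \<subseteq> ?J" by auto
  have \<Omega>: "(y, t, u, v) \<in> \<Omega>" "(y, N s, u, v) \<in> \<Omega>" for y using assms by (auto simp: mem_\<Omega>)
  have "(x, N s, u, v) \<in> orb r ?J (x, t, u, v)"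
    by (rule orb_torus[OF J \<Omega>])
  then have "r 3 (x, N s, u, v) \<in> orb r ?J (x, t, u, v)"
    by (rule orb.orb_step) auto
  then have "(glue s x, N s, u, v) \<in> orb r ?J (x, t, u, v)" by simp
  then show ?thesis
    using orb_trans[OF orb_torus[OF J \<Omega>(2) \<Omega>(1), of "glue s x"]] by blast
qed

lemma colour_surj: "\<exists>t. colour t = k"
proof -
  have "k \<in> colour ` {(0, 0), (1, 0), (0, 1), (1, 1), (2, 0), (1, 2), (2, 1), (3, 1)}"
    by (cases k) (auto simp: colour_def image_iff)
  then show ?thesis by blast
qed

lemma r_connected:
  assumes "w' \<in> \<Omega>" "w \<in> \<Omega>"
  shows "w' \<in> orb r {0..<int 4} w"
proof -
  obtain x t u v where w: "w = (x, t, u, v)" "t \<in> range N" "(u, v) \<in> frames" using assms(2) by (rule \<Omega>E)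
  obtain x' t' u' v' where w': "w' = (x', t', u', v')" "t' \<in> range N" "(u', v') \<in> frames"
    using assms(1) by (rule \<Omega>E)
  let ?S = "{y. (y, t, u, v) \<in> orb r {0..<int 4} w}"
  have "x' \<in> ?S"
  proof (rule flip_closed_UNIV)
    fix k y assume "y \<in> ?S"
    then have y: "(y, t, u, v) \<in> orb r {0..<int 4} w" by simp
    obtain s where s: "colour s = k" using colour_surj by blast
    have "(glue s y, t, u, v) \<in> orb r {0..<int 4} (y, t, u, v)"
      by (rule orb_glue) (use w in \<open>simp add: mem_\<Omega>\<close>)
    then show "flip k y \<in> ?S" using orb_trans[OF _ y] unfolding s by blast
  next
    show "x \<in> ?S" using w by (simp add: orb.orb_base)
  qed
  then have "(x', t, u, v) \<in> orb r {0..<int 4} w" by simp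
  moreover have "w' \<in> orb r {0..<int 4} (x', t, u, v)"
    unfolding w' by (rule orb_torus) (use w w' in \<open>auto simp: mem_\<Omega>\<close>)
  ultimately show ?thesis by (rule orb_trans[rotated])
qed

lemma orb_facet:
  assumes "w' \<in> orb r {0..<3} (x, t, u, v)"
  shows "fst w' = x"
  using assms
proof (rule orb_invariant)
  fix w :: flag and j :: int assume "fst w = x" "j \<in> {0..<3 :: int}"
  moreover from this(2) have "j = 0 \<or> j = 1 \<or> j = 2" by auto
  ultimately show "fst (r j w) = x" by (cases w) auto
qed simp

lemma orb_square:
  assumes "w' \<in> orb r {0..<2} (x, t, u, v)"
  shows "fst w' = x \<and> fst (snd w') = t"
  using assms
proof (rule orb_invariant)
  fix w :: flag and j :: int assume "fst w = x \<and> fst (snd w) = t" "j \<in> {0..<2 :: int}"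
  moreover from this(2) have "j = 0 \<or> j = 1" by auto
  ultimately show "fst (r j w) = x \<and> fst (snd (r j w)) = t" by (cases w) auto
qed simp

lemma orb_edge:
  assumes "w' \<in> orb r {1<..<4} (x, t, u, v)" "t \<in> range N"
  shows "snd w' = (t, u, v) \<or> snd w' = (N (t + u), - u, v)"
  using assms(1)
proof (rule orb_invariant)
  fix w :: flag and j :: int
  assume w: "snd w = (t, u, v) \<or> snd w = (N (t + u), - u, v)" and "j \<in> {1<..<4}"
  then have "j = 2 \<or> j = 3" by auto
  moreover have "w = (fst w, t, u, v) \<or> w = (fst w, N (t + u), - u, v)"
    using w by (metis prod.collapse)
  then obtain x where "w = (x, t, u, v) \<or> w = (x, N (t + u), - u, v)" ..
  ultimately show "snd (r j w) = (t, u, v) \<or> snd (r j w) = (N (t + u), - u, v)"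
    using N_range[OF assms(2)] by auto
qed simp

text \<open>\<open>t + t + u + v\<close> is twice the position of the vertex. Doubling avoids
  half-integers, so congruence of vertices modulo \<Lambda> becomes equality up to
  \<open>l + l\<close>.\<close>

lemma orb_vertex:
  assumes "(y, t', u', v') \<in> orb r {0<..<4} (x, t, u, v)"
  shows "\<exists>l \<in> \<Lambda>. t' + t' + u' + v' = t + t + u + v + l + l"
proof -
  define P where "P w \<longleftrightarrow> (\<exists>l \<in> \<Lambda>. (case w of (y, t', u', v') \<Rightarrow> t' + t' + u' + v') = t + t + u + v + l + l)"
    for w :: flag
  have "P (y, t', u', v')"
    using assms
  proof (rule orb_invariant)
    show "P (x, t, u, v)" unfolding P_def using lattice_zero by (auto intro: bexI[of _ 0])
    fix w j assume w: "P w" and j: "j \<in> {0<..<4 :: int}"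
    obtain y s a b where w': "w = (y, s, a, b)" by (cases w)
    obtain l where l: "l \<in> \<Lambda>" "s + s + a + b = t + t + u + v + l + l" using w unfolding P_def w' by auto
    have "j = 1 \<or> j = 2 \<or> j = 3" using j by auto
    then show "P (r j w)"
    proof (elim disjE)
      assume j: "j = 2"
      let ?k = "N (s + a) - (s + a)"
      have k: "?k \<in> \<Lambda>" using N_eq_iff[of "N (s + a)" "s + a"] by simp
      have "N (s + a) + N (s + a) + - a + b = (s + s + a + b) + ?k + ?k" by (simp add: algebra_simps)
      also have "\<dots> = t + t + u + v + (l + ?k) + (l + ?k)" unfolding l by (simp add: algebra_simps)
      finally show ?thesis using lattice_add[OF l(1) k] unfolding P_def w' j r_simps prod.case by blast
    qed (use l in \<open>auto simp: P_def w' add.commute add.left_commute\<close>)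
  qed
  then show ?thesis unfolding P_def by simp
qed

text \<open>Two corners of one square differ in each coordinate by 0, 2 or -2, so the entries of
  \<open>l\<close> are 0, 1 or -1, and evenness of lattice vectors forces \<open>l = 0\<close>. The
  corners of a square therefore stay distinct on the torus, and a corner determines the frame up to
  a swap.\<close>

lemma frames_vertex_eq:
  assumes "(u, v) \<in> frames" "(u', v') \<in> frames" "u' + v' = u + v + l + l" "l \<in> \<Lambda>"
  shows "(u', v') = (u, v) \<or> (u', v') = (v, u)"
proof -
  obtain a b where l: "l = (a, b)" by (cases l)
  have "even a" "even b" using lattice_fst_snd_even[OF assms(4)] l by auto
  then have "a \<noteq> 1 \<and> a \<noteq> -1 \<and> b \<noteq> 1 \<and> b \<noteq> -1" by auto
  then show ?thesis using assms(1-3) unfolding l frames_eq by (elim insertE) auto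
qed

text \<open>A bound from above on the indices keeps the facet or even the square; a bound from below
  keeps the vertex or even the edge. Each range of \<open>i\<close> and \<open>k\<close> asks
  whether these data leave only the permitted moves.\<close>

lemma r_intersection:
  assumes "-1 \<le> i" "i < k" "k \<le> int 4" "w \<in> \<Omega>"
    and w': "w' \<in> orb r {i<..<int 4} w" "w' \<in> orb r {0..<k} w"
  shows "w' \<in> orb r {i<..<k} w"
proof -
  obtain x t u v where w: "w = (x, t, u, v)" "t \<in> range N" "(u, v) \<in> frames"
    using assms(4) by (rule \<Omega>E)
  have "w' \<in> \<Omega>"
    by (rule orb_invariant[OF w'(1)]) (use assms r_closed in auto)
  then obtain x' t' u' v' where w1: "w' = (x', t', u', v')" "t' \<in> range N" "(u', v') \<in> frames"
    by (rule \<Omega>E)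
  have base: "w \<in> orb r J w" for J by (rule orb.orb_base)
  have single: "r j w \<in> orb r {i<..<k} w" if "i < j" "j < k" for j
    by (rule orb.orb_step[OF base]) (use that in auto)
  have facet: "x' = x" if "k \<le> 3"
    using orb_facet[of w' x t u v] orb_mono[OF w'(2), of "{0..<3}"] that unfolding w w1 by auto
  have square: "t' = t" if "k \<le> 2"
    using orb_square[of w' x t u v] orb_mono[OF w'(2), of "{0..<2}"] that unfolding w w1 by auto
  have edge: "t' = t \<and> u' = u \<and> v' = v \<or> t' = N (t + u) \<and> u' = - u \<and> v' = v" if "1 \<le> i"
  proof -
    have "{i<..<int 4} \<subseteq> {1<..<4}" using that by auto
    then show ?thesis
      using orb_edge[of w' x t u v] orb_mono[OF w'(1), of "{1<..<4}"] w(2) unfolding w w1 by simp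
  qed
  have vertex: "\<exists>l \<in> \<Lambda>. t' + t' + u' + v' = t + t + u + v + l + l" if "0 \<le> i"
  proof -
    have "{i<..<int 4} \<subseteq> {0<..<4}" using that by auto
    then show ?thesis
      using orb_vertex[of x' t' u' v' x t u v] orb_mono[OF w'(1), of "{0<..<4}"] unfolding w w1 by simp
  qed
  have "i = -1 \<or> k = 4 \<or> i = 0 \<and> k = 1 \<or> i = 0 \<and> k = 2 \<or> i = 0 \<and> k = 3 \<or> i = 1 \<and> k = 2 \<or>
    i = 1 \<and> k = 3 \<or> i = 2 \<and> k = 3" using assms(1-3) by presburger
  then consider "i = -1" | "k = 4" | "i = 0" "k \<le> 2" "1 \<le> k" | "i = 0" "k = 3" | "i = 1" "k = 2" | "i = 1" "k = 3"
    | "i = 2" "k = 3" by fastforce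
  then show ?thesis
  proof cases
    case 1
    moreover have "{-1<..<k} = {0..<k}" by auto
    ultimately show ?thesis using w'(2) by simp
  next
    case 2
    then show ?thesis using w'(1) by simp
  next
    case 3
    obtain l where l: "l \<in> \<Lambda>" "u' + v' = u + v + l + l" using vertex square 3 by (auto simp: algebra_simps)
    have uv: "(u', v') = (u, v) \<or> (u', v') = (v, u)" by (rule frames_vertex_eq[OF w(3) w1(3) l(2,1)])
    show ?thesis
    proof (cases "k = 1")
      case True
      have "{0..<k} = {0}" using True by auto
      then have "w' = w \<or> w' = r 0 w"
        using w'(2) by (intro orb_singleton r_invol assms(4)) auto
      moreover have "w' \<noteq> r 0 w"
        using uv framesD[OF w(3)] unit_neq_uminus[of v] unfolding w w1 by auto
      ultimately show ?thesis using base by blast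
    next
      case False
      then show ?thesis using uv single[of 1] base facet square 3 unfolding w w1 by auto
    qed
  next
    case 4
    \<comment> \<open>Turning about the vertex yields the wanted frame in some square
      \<open>s\<close>. With equal frames, the doubled vertex positions of \<open>s\<close> and
      \<open>t'\<close> give \<open>s - t' \<in> \<Lambda>\<close>, so the two representatives
      coincide.\<close>
    obtain s where s: "(x, s, u', v') \<in> orb r {i<..<k} w"
      using orb_vertex_frames[of "{i<..<k}" u v u' v' x t] w w1 4 by auto
    have "{i<..<k} \<subseteq> {0<..<4}" using 4 by auto
    then have "(x, s, u', v') \<in> orb r {0<..<4} (x, t, u, v)"
      using orb_mono[OF s] w(1) by simp
    then obtain l where l: "l \<in> \<Lambda>" "s + s + u' + v' = t + t + u + v + l + l" using orb_vertex by blast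
    obtain l' where l': "l' \<in> \<Lambda>" "t' + t' + u' + v' = t + t + u + v + l' + l'" using vertex 4 by auto
    have "s - t' = l - l'"
    proof -
      have "(s + s + u' + v') - (t' + t' + u' + v') = (l + l) - (l' + l')" unfolding l l' by simp
      then have "(s - t') + (s - t') = (l - l') + (l - l')" by (simp add: algebra_simps)
      then show ?thesis by (cases s; cases t'; cases l; cases l') auto
    qed
    then have "N s = N t'" using lattice_diff[OF l(1) l'(1)] N_eq_iff by simp
    moreover have "s \<in> range N"
    proof -
      have "(x, s, u', v') \<in> \<Omega>"
      proof (rule orb_invariant[OF s])
        fix y j assume "y \<in> \<Omega>" "j \<in> {i<..<k}"
        then show "r j y \<in> \<Omega>" using r_closed[of j y] 4 by auto
      qed (rule assms(4))
      then show ?thesis by (simp add: mem_\<Omega>)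
    qed
    ultimately have "s = t'" using N_range w1(2) by metis
    then show ?thesis using s facet 4 w1 by simp
  next
    case 5
    \<comment> \<open>Lattice vectors have even coordinates, so a square is never its own
      neighbour.\<close>
    have "N (t + u) \<noteq> t"
    proof
      assume "N (t + u) = t"
      then have "N (t + u) = N t" using N_range w(2) by metis
      then show False using N_eq_iff units_not_lattice framesD[OF w(3)] by simp
    qed
    then have "w' = w" using edge facet square 5 unfolding w w1 by auto
    then show ?thesis using base by simp
  next
    case 6
    then have "w' = w \<or> w' = r 2 w" using edge facet unfolding w w1 by auto
    then show ?thesis using base single[of 2] 6 by auto
  next
    case 7
    then have "{i<..<int 4} = {3}" by auto
    then have "w' = w \<or> w' = r 3 w"
      using w'(1) by (intro orb_singleton r_invol assms(4)) auto
    moreover have "x \<noteq> glue t x" by (metis flip_neq)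
    then have "w' \<noteq> r 3 w" using facet 7 unfolding w w1 by auto
    ultimately show ?thesis using base by simp
  qed
qed


lemma N0_mem: "(x, N 0, (1, 0), (0, 1)) \<in> \<Omega>"
  unfolding mem_\<Omega> frames_eq by simp

lemma flag_system: "flag_system 4 \<Omega> r"
proof (rule flag_system.intro)
  show "finite \<Omega>" unfolding \<Omega>_def frames_eq by (intro finite_cartesian_product finite_torus) auto
  show "\<Omega> \<noteq> {}" using N0_mem by blast
  show "r j w \<in> \<Omega>" "r j (r j w) = w" if "j \<in> {0..<int 4}" "w \<in> \<Omega>" for j w
    using r_closed r_invol that by blast+
  show "r i (r j w) = r j (r i w)" if "i \<in> {0..<int 4}" "j \<in> {0..<int 4}" "i + 2 \<le> j" for i j w
    using r_far_commute that .
  show "v \<in> orb r {0..<int 4} w" if "v \<in> \<Omega>" "w \<in> \<Omega>" for v w using r_connected that .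
  show "v \<in> orb r {i<..<k} w" if "-1 \<le> i" "i < k" "k \<le> int 4" "w \<in> \<Omega>"
    "v \<in> orb r {i<..<int 4} w" "v \<in> orb r {0..<k} w" for i k v w
    using r_intersection that .
qed

sublocale P: face_labelling 4 \<Omega> r "orbit_label 4 r"
  by (rule face_labelling_orbit_label[OF flag_system r_neq])

section \<open>Parity and symmetries of the glued flags\<close>

lemma r_cases:
  assumes "j \<in> {0..<int 4}" "P 0" "P 1" "P 2" "P 3"
  shows "P j"
  using assms unfolding idx4 by auto

text \<open>Compares \<open>p\<close> with the orientation of the frame: \<open>r 0\<close>,
  \<open>r 1\<close> and \<open>r 2\<close> reverse the orientation and keep \<open>p\<close>, while
  \<open>r 3\<close> keeps the orientation and negates \<open>p\<close>.\<close>

definition par :: "flag \<Rightarrow> bool" where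
  "par w = (case w of (x, t, u, v) \<Rightarrow> fst x = (v = rot u))"

lemma frames_rot: "(u, v) \<in> frames \<Longrightarrow> (- v = rot u) = (v \<noteq> rot u)" "(u, v) \<in> frames \<Longrightarrow> (v = rot (- u)) = (v \<noteq> rot u)"
  "(u, v) \<in> frames \<Longrightarrow> (u = rot v) = (v \<noteq> rot u)"
  unfolding frames_eq by (elim insertE emptyE Pair_inject; simp add: rot_def)+

lemma par_r:
  assumes "j \<in> {0..<int 4}" "w \<in> \<Omega>"
  shows "par (r j w) = (\<not> par w)"
proof -
  obtain x t u v where w: "w = (x, t, u, v)" "(u, v) \<in> frames" using assms(2) by (rule \<Omega>E)
  show ?thesis
    using assms(1) unfolding w(1) by (rule r_cases) (use frames_rot[OF w(2)] in \<open>auto simp: par_def\<close>)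
qed

text \<open>Compatibility with \<open>r 0\<close>, \<open>r 1\<close> and \<open>r 2\<close> comes
  from the additivity of \<open>h\<close> and the invariance of \<Lambda>. The one genuine condition
  is that \<xi> turns the gluing across a square into the gluing across its image.\<close>

lemma affine_centralizer:
  assumes h: "\<And>s t. h (s + t) = h s + h t" and h\<Lambda>: "\<And>t. t \<in> \<Lambda> \<Longrightarrow> h t \<in> \<Lambda>"
    and hf: "\<And>u v. (u, v) \<in> frames \<Longrightarrow> (h u, h v) \<in> frames"
    and \<xi>: "\<And>t x. \<xi> (glue t x) = glue (h t + s) (\<xi> x)"
  shows "\<exists>\<gamma> \<in> P.centralizer. \<forall>x t u v. (x, t, u, v) \<in> \<Omega> \<longrightarrow> \<gamma> (x, t, u, v) = (\<xi> x, N (h t + s), h u, h v)"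
proof -
  define \<gamma> where "\<gamma> = (\<lambda>w \<in> \<Omega>. case w of (x, t, u, v) \<Rightarrow> (\<xi> x, N (h t + s), h u, h v))"
  have \<gamma>: "\<gamma> (x, t, u, v) = (\<xi> x, N (h t + s), h u, h v)" if "(x, t, u, v) \<in> \<Omega>" for x t u v
    using that by (simp add: \<gamma>_def)
  have h0: "h 0 = 0" using h[of 0 0] by simp
  have hm: "h (- t) = - h t" for t
  proof -
    have "h t + h (- t) = 0" using h[of t "- t"] h0 by simp
    then show ?thesis by (simp add: eq_neg_iff_add_eq_0 add.commute)
  qed
  have hN: "N (h (N t) + a) = N (h t + a)" for t a
  proof -
    have "N t - t \<in> \<Lambda>" using N_eq_iff[of "N t" t] by simp
    then have "h (N t - t) \<in> \<Lambda>" by (rule h\<Lambda>)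
    moreover have "h (N t - t) = h (N t) - h t" using h[of "N t" "- t"] hm by simp
    ultimately show ?thesis unfolding N_eq_iff by simp
  qed
  have hN': "N (a + h (N t)) = N (a + h t)" for t a using hN[of t a] by (simp add: add.commute)
  have "\<gamma> \<in> P.centralizer"
  proof (rule P.centralizerI)
    show "\<gamma> \<in> extensional \<Omega>" by (simp add: \<gamma>_def)
    fix w assume "w \<in> \<Omega>"
    then obtain x t u v where w: "w = (x, t, u, v)" "t \<in> range N" "(u, v) \<in> frames" by (rule \<Omega>E)
    show "\<gamma> w \<in> \<Omega>" using \<gamma>[of x t u v] \<open>w \<in> \<Omega>\<close> hf w by (simp add: mem_\<Omega>)
    fix j assume j: "j \<in> {0..<int 4}"
    have r: "r j (x, t, u, v) \<in> \<Omega>" using r_closed[OF j \<open>w \<in> \<Omega>\<close>] w by simp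
    have "r j (x, t, u, v) \<in> \<Omega> \<longrightarrow> \<gamma> (r j (x, t, u, v)) = r j (\<xi> x, N (h t + s), h u, h v)"
      using j by (rule r_cases) (auto simp: \<gamma> hm hN' \<xi> h algebra_simps)
    then show "\<gamma> (r j w) = r j (\<gamma> w)" using r \<gamma>[of x t u v] \<open>w \<in> \<Omega>\<close> unfolding w(1) by simp
  qed
  then show ?thesis using \<gamma> by blast
qed

definition equiv_flags :: "flag \<Rightarrow> flag \<Rightarrow> bool" where
  "equiv_flags v w \<longleftrightarrow> v \<in> \<Omega> \<and> w \<in> \<Omega> \<and> (\<exists>\<gamma> \<in> P.centralizer. \<gamma> v = w)"

lemma equiv_refl: "w \<in> \<Omega> \<Longrightarrow> equiv_flags w w"
proof -
  assume w: "w \<in> \<Omega>"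
  have "(\<lambda>w \<in> \<Omega>. w) \<in> P.centralizer" by (rule P.centralizerI) (use r_closed in auto)
  then show ?thesis unfolding equiv_flags_def using w by (metis restrict_apply')
qed

lemma equiv_sym: "equiv_flags v w \<Longrightarrow> equiv_flags w v"
  unfolding equiv_flags_def using P.centralizer_inv by metis

lemma equiv_trans:
  assumes "equiv_flags u v" "equiv_flags v w"
  shows "equiv_flags u w"
proof -
  obtain \<gamma> \<delta> where \<gamma>: "\<gamma> \<in> P.centralizer" "\<delta> \<in> P.centralizer" "\<gamma> u = v" "\<delta> v = w" "u \<in> \<Omega>" "w \<in> \<Omega>"
    using assms unfolding equiv_flags_def by blast
  have "\<delta> \<otimes>\<^bsub>BijGroup \<Omega>\<^esub> \<gamma> \<in> P.centralizer"
    by (rule subgroup.m_closed[OF P.subgroup_centralizer \<gamma>(2,1)])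
  moreover have "(\<delta> \<otimes>\<^bsub>BijGroup \<Omega>\<^esub> \<gamma>) u = w"
    using \<gamma> by (simp add: BijGroup_def P.centralizer_def compose_eq)
  ultimately show ?thesis unfolding equiv_flags_def using \<gamma> by blast
qed

lemma equiv_affine:
  assumes h: "\<And>s t. h (s + t) = h s + h t" and h\<Lambda>: "\<And>t. t \<in> \<Lambda> \<Longrightarrow> h t \<in> \<Lambda>"
    and hf: "\<And>u v. (u, v) \<in> frames \<Longrightarrow> (h u, h v) \<in> frames"
    and \<xi>: "\<And>t x. \<xi> (glue t x) = glue (h t + s) (\<xi> x)" and w: "(x, t, u, v) \<in> \<Omega>"
  shows "equiv_flags (x, t, u, v) (\<xi> x, N (h t + s), h u, h v)"
proof -
  obtain \<gamma> where "\<gamma> \<in> P.centralizer" "\<gamma> (x, t, u, v) = (\<xi> x, N (h t + s), h u, h v)"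
    using affine_centralizer[OF h h\<Lambda> hf \<xi>] w by blast
  then show ?thesis unfolding equiv_flags_def using w P.centralizer_mem by metis
qed

text \<open>On \<open>(p, i, j, q)\<close> the map is linear over the two-element field. It is the
  one that sends \<open>(1, a, b, d)\<close>, the shift made by a square of colour
  \<open>(a, b, d)\<close>, to the shift made by the translated square, as given by
  \<open>colour_add_10\<close>. The change of \<open>c\<close> absorbs the difference of the two
  cocycles. The maps for the other translation and for the quarter turn arise in the same
  way.\<close>

lemma equiv_translate_10:
  assumes "((p, i, j, q, c), t, u, v) \<in> \<Omega>"
  shows "equiv_flags ((p, i, j, q, c), t, u, v) ((p, i \<noteq> p, j, q \<noteq> (i \<noteq> j), c \<noteq> q), N (t + (1, 0)), u, v)"
proof -
  let ?\<xi> = "\<lambda>(p, i, j, q, c). (p, i \<noteq> p, j, q \<noteq> (i \<noteq> j), c \<noteq> q)"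
  have "?\<xi> (glue t x) = glue (t + (1, 0)) (?\<xi> x)" for t x
  proof -
    obtain a b d where k: "colour t = (a, b, d)" by (cases "colour t")
    show ?thesis unfolding k colour_add_10[OF k] by (cases x) (simp only: flip.simps prod.inject prod.case, argo)
  qed
  then show ?thesis using equiv_affine[of "\<lambda>t. t" ?\<xi> "(1, 0)", OF _ _ _ _ assms] by simp
qed

lemma equiv_translate_01:
  assumes "((p, i, j, q, c), t, u, v) \<in> \<Omega>"
  shows "equiv_flags ((p, i, j, q, c), t, u, v)
    ((p, i, j \<noteq> p, q \<noteq> (i \<noteq> j), c \<noteq> (q \<noteq> (i \<and> \<not> p))), N (t + (0, 1)), u, v)"
proof -
  let ?\<xi> = "\<lambda>(p, i, j, q, c). (p, i, j \<noteq> p, q \<noteq> (i \<noteq> j), c \<noteq> (q \<noteq> (i \<and> \<not> p)))"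
  have "?\<xi> (glue t x) = glue (t + (0, 1)) (?\<xi> x)" for t x
  proof -
    obtain a b d where k: "colour t = (a, b, d)" by (cases "colour t")
    show ?thesis unfolding k colour_add_01[OF k] by (cases x) (simp only: flip.simps prod.inject prod.case, argo)
  qed
  then show ?thesis using equiv_affine[of "\<lambda>t. t" ?\<xi> "(0, 1)", OF _ _ _ _ assms] by simp
qed

lemma equiv_rot:
  assumes "((p, i, j, q, c), t, u, v) \<in> \<Omega>"
  shows "equiv_flags ((p, i, j, q, c), t, u, v)
    ((p, j, i, q \<noteq> j, c \<noteq> (j \<and> \<not> i)), N (rot t), rot u, rot v)"
proof -
  let ?\<xi> = "\<lambda>(p, i, j, q, c). (p, j, i, q \<noteq> j, c \<noteq> (j \<and> \<not> i))"
  have 1: "?\<xi> (glue t x) = glue (rot t + 0) (?\<xi> x)" for t x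
  proof -
    obtain a b d where k: "colour t = (a, b, d)" by (cases "colour t")
    show ?thesis unfolding add_0_right k colour_rot[OF k] by (cases x) (simp only: flip.simps prod.inject prod.case, argo)
  qed
  have "(rot u, rot v) \<in> frames" if "(u, v) \<in> frames" for u v
    using that unfolding frames_eq by (elim insertE emptyE Pair_inject; simp add: rot_def)
  then show ?thesis
    using equiv_affine[OF _ lattice_rot _ 1 assms] by (simp add: rot_def)
qed

text \<open>The negation of \<open>p\<close> is forced: a mirror reverses the orientation of frames,
  so keeping \<open>p\<close> would change \<open>par\<close>, which no automorphism does.\<close>

lemma equiv_mirror:
  assumes "((p, i, j, q, c), t, u, v) \<in> \<Omega>"
  shows "equiv_flags ((p, i, j, q, c), t, u, v)
    ((\<not> p, i, j, q \<noteq> j, c \<noteq> j), N (mirror t), mirror u, mirror v)"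
proof -
  let ?\<xi> = "\<lambda>(p, i, j, q, c). (\<not> p, i, j, q \<noteq> j, c \<noteq> j)"
  have 1: "?\<xi> (glue t x) = glue (mirror t + 0) (?\<xi> x)" for t x
  proof -
    obtain a b d where k: "colour t = (a, b, d)" by (cases "colour t")
    show ?thesis unfolding add_0_right k colour_mirror[OF k]
      by (cases x) (simp only: flip.simps prod.inject prod.case, argo)
  qed
  have "(mirror u, mirror v) \<in> frames" if "(u, v) \<in> frames" for u v
    using that unfolding frames_eq by (elim insertE emptyE Pair_inject; simp add: mirror_def)
  then show ?thesis
    using equiv_affine[OF _ lattice_mirror _ 1 assms] by (simp add: mirror_def)
qed

text \<open>These automorphisms come from permutations of the facets that commute with every
  \<open>flip\<close>. Together they are transitive on the sixteen facets with a given
  \<open>p\<close>.\<close>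

lemma equiv_cell:
  assumes "((p, i, j, q, c), t, u, v) \<in> \<Omega>"
  shows "equiv_flags ((p, i, j, q, c), t, u, v) ((p, i, j, q, \<not> c), t, u, v)"
    "equiv_flags ((p, i, j, q, c), t, u, v) ((p, i, j, \<not> q, c), t, u, v)"
    "equiv_flags ((p, i, j, q, c), t, u, v) ((p, i, \<not> j, q, c), t, u, v)"
    "equiv_flags ((p, i, j, q, c), t, u, v) ((p, \<not> i, j, q, c \<noteq> j), t, u, v)"
proof -
  have t: "N t = t" using assms by (auto simp: mem_\<Omega>)
  have *: "equiv_flags ((p, i, j, q, c), t, u, v) (\<xi> (p, i, j, q, c), t, u, v)"
    if "\<And>k x. \<xi> (flip k x) = flip k (\<xi> x)" for \<xi>
    using equiv_affine[of "\<lambda>t. t" \<xi> 0, OF _ _ _ _ assms] that t by simp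
  have "(\<lambda>(p, i, j, q, c). (p, i, j, q, \<not> c)) (flip k x) = flip k ((\<lambda>(p, i, j, q, c). (p, i, j, q, \<not> c)) x)"
    "(\<lambda>(p, i, j, q, c). (p, i, j, \<not> q, c)) (flip k x) = flip k ((\<lambda>(p, i, j, q, c). (p, i, j, \<not> q, c)) x)"
    "(\<lambda>(p, i, j, q, c). (p, i, \<not> j, q, c)) (flip k x) = flip k ((\<lambda>(p, i, j, q, c). (p, i, \<not> j, q, c)) x)"
    "(\<lambda>(p, i, j, q, c). (p, \<not> i, j, q, c \<noteq> j)) (flip k x) = flip k ((\<lambda>(p, i, j, q, c). (p, \<not> i, j, q, c \<noteq> j)) x)"
    for k x
    by (cases k; cases x; simp only: flip.simps prod.inject prod.case; argo)+
  from *[OF this(1)] *[OF this(2)] *[OF this(3)] *[OF this(4)]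
  show "equiv_flags ((p, i, j, q, c), t, u, v) ((p, i, j, q, \<not> c), t, u, v)"
    "equiv_flags ((p, i, j, q, c), t, u, v) ((p, i, j, \<not> q, c), t, u, v)"
    "equiv_flags ((p, i, j, q, c), t, u, v) ((p, i, \<not> j, q, c), t, u, v)"
    "equiv_flags ((p, i, j, q, c), t, u, v) ((p, \<not> i, j, q, c \<noteq> j), t, u, v)"
    by simp_all
qed


definition base_flag :: "bool \<Rightarrow> flag" where
  "base_flag b = ((b, False, False, False, False), N 0, (1, 0), (0, 1))"

lemma base_flag_mem: "base_flag b \<in> \<Omega>"
  unfolding base_flag_def by (rule N0_mem)

text \<open>Only the bit \<open>p\<close> of the new facet is tracked, since
  \<open>equiv_cell\<close> can reset the other four.\<close>

lemma equiv_translate: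
  assumes "(x, t, u, v) \<in> \<Omega>"
  shows "\<exists>x'. fst x' = fst x \<and> equiv_flags (x, t, u, v) (x', N (t + s), u, v)"
proof -
  define R where "R s \<longleftrightarrow> (\<exists>x'. fst x' = fst x \<and> equiv_flags (x, t, u, v) (x', N (t + s), u, v))" for s
  have ext: "R s'" if Rs: "R s" and st: "\<And>x'. (x', N (t + s), u, v) \<in> \<Omega> \<Longrightarrow>
      \<exists>x''. fst x'' = fst x' \<and> equiv_flags (x', N (t + s), u, v) (x'', N (t + s'), u, v)" for s s'
  proof -
    obtain x' where x': "fst x' = fst x" "equiv_flags (x, t, u, v) (x', N (t + s), u, v)"
      using Rs unfolding R_def by blast
    then obtain x'' where x'': "fst x'' = fst x'" "equiv_flags (x', N (t + s), u, v) (x'', N (t + s'), u, v)"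
      using st[of x'] unfolding equiv_flags_def by blast
    show ?thesis unfolding R_def using x'(1) x''(1) equiv_trans[OF x'(2) x''(2)] by metis
  qed
  have mem: "(x, N s, u, v) \<in> \<Omega>" for x s using assms by (simp add: mem_\<Omega>)
  have up: "\<exists>x''. fst x'' = fst x' \<and> equiv_flags (x', N s, u, v) (x'', N (s + e), u, v)"
    if "e = (1, 0) \<or> e = (0, 1)" for x' s e
  proof -
    obtain p i j q c where x': "x' = (p, i, j, q, c)" by (cases x')
    show ?thesis
      using that equiv_translate_10[OF mem, of p i j q c s] equiv_translate_01[OF mem, of p i j q c s]
      unfolding x' N_add by (metis fst_conv)
  qed
  have down: "\<exists>x''. fst x'' = fst x' \<and> equiv_flags (x', N (s + e), u, v) (x'', N s, u, v)"
    if "e = (1, 0) \<or> e = (0, 1)" for x' s e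
  proof -
    obtain p i j q c where x': "x' = (p, i, j, q, c)" by (cases x')
    \<comment> \<open>The left-hand sides are the images under the translations of the cells that we take for \<open>x''\<close>.\<close>
    have 1: "(p, (i \<noteq> p) \<noteq> p, j, (q \<noteq> ((i \<noteq> p) \<noteq> j)) \<noteq> ((i \<noteq> p) \<noteq> j),
        (c \<noteq> (q \<noteq> ((i \<noteq> p) \<noteq> j))) \<noteq> (q \<noteq> ((i \<noteq> p) \<noteq> j))) = x'"
      unfolding x' prod.inject by argo
    have 2: "(p, i, (j \<noteq> p) \<noteq> p, (q \<noteq> (i \<noteq> (j \<noteq> p))) \<noteq> (i \<noteq> (j \<noteq> p)),
        (c \<noteq> ((q \<noteq> (i \<noteq> (j \<noteq> p))) \<noteq> (i \<and> \<not> p))) \<noteq> ((q \<noteq> (i \<noteq> (j \<noteq> p))) \<noteq> (i \<and> \<not> p))) = x'"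
      unfolding x' prod.inject by argo
    show ?thesis
      using that
    proof
      assume "e = (1, 0)"
      then show ?thesis
        using equiv_translate_10[OF mem, of p "i \<noteq> p" j "q \<noteq> ((i \<noteq> p) \<noteq> j)" "c \<noteq> (q \<noteq> ((i \<noteq> p) \<noteq> j))" s]
        unfolding 1 N_add using equiv_sym x' \<open>e = (1, 0)\<close> by (metis fst_conv)
    next
      assume "e = (0, 1)"
      then show ?thesis
        using equiv_translate_01[OF mem, of p i "j \<noteq> p" "q \<noteq> (i \<noteq> (j \<noteq> p))"
          "c \<noteq> ((q \<noteq> (i \<noteq> (j \<noteq> p))) \<noteq> (i \<and> \<not> p))" s]
        unfolding 2 N_add using equiv_sym x' \<open>e = (0, 1)\<close> by (metis fst_conv)
    qed
  qed
  have step: "R (s + e)" "R (s - e)" if "R s" "e = (1, 0) \<or> e = (0, 1)" for s e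
  proof -
    show "R (s + e)"
      by (rule ext[OF that(1)]) (use up[OF that(2), of _ "t + s"] in \<open>simp add: add.assoc\<close>)
    show "R (s - e)"
      by (rule ext[OF that(1)]) (use down[OF that(2), of _ "t + (s - e)"] in \<open>simp add: algebra_simps\<close>)
  qed
  have "N (t + 0) = t" using assms by (auto simp: mem_\<Omega>)
  then have R0: "R 0" unfolding R_def using equiv_refl[OF assms] by metis
  have 1: "R (a, 0)" for a
  proof (induction a rule: int_induct[where k = 0])
    case base
    show ?case using R0 by (simp add: zero_prod_def)
  next
    case (step1 a)
    then show ?case using step(1)[of "(a, 0)" "(1, 0)"] by simp
  next
    case (step2 a)
    then show ?case using step(2)[of "(a, 0)" "(1, 0)"] by simp
  qed
  have 2: "R (a, b)" for a b
  proof (induction b rule: int_induct[where k = 0])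
    case base
    show ?case by (rule 1)
  next
    case (step1 b)
    then show ?case using step(1)[of "(a, b)" "(0, 1)"] by simp
  next
    case (step2 b)
    then show ?case using step(2)[of "(a, b)" "(0, 1)"] by simp
  qed
  show ?thesis using 2[of "fst s" "snd s"] unfolding R_def prod.collapse .
qed

lemma N_linear_N0: "N (rot (N 0)) = N 0" "N (mirror (N 0)) = N 0"
proof -
  have "N 0 \<in> \<Lambda>" using N_eq_iff[of "N 0" 0] by simp
  then show "N (rot (N 0)) = N 0" "N (mirror (N 0)) = N 0"
    using lattice_rot lattice_mirror unfolding N_eq_iff by simp_all
qed

lemma equiv_rot_N0:
  assumes "(x, N 0, u, v) \<in> \<Omega>"
  shows "\<exists>x'. fst x' = fst x \<and> equiv_flags (x, N 0, u, v) (x', N 0, rot u, rot v)"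
proof -
  obtain p i j q c where x: "x = (p, i, j, q, c)" by (cases x)
  show ?thesis using equiv_rot[of p i j q c "N 0" u v] assms unfolding x N_linear_N0 by (metis fst_conv)
qed

text \<open>Quarter turns bring \<open>u\<close> to \<open>(1, 0)\<close> and keep both
  \<open>p\<close> and the orientation. If \<open>v\<close> then points down, one mirror corrects it
  at the price of negating \<open>p\<close>, so the two data survive only in their
  combination.\<close>

lemma equiv_standard_frame:
  assumes "(x, N 0, u, v) \<in> \<Omega>"
  shows "\<exists>x'. fst x' = (fst x = (v = rot u)) \<and> equiv_flags (x, N 0, u, v) (x', N 0, (1, 0), (0, 1))"
proof -
  have *: "\<exists>x'. fst x' = fst x \<and> equiv_flags (x, N 0, u, v) (x', N 0, rot (rot u), rot (rot v))"
    if xuv: "(x, N 0, u, v) \<in> \<Omega>" for x u v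
  proof -
    obtain x' where x': "fst x' = fst x" "equiv_flags (x, N 0, u, v) (x', N 0, rot u, rot v)"
      using equiv_rot_N0[OF xuv] by blast
    then obtain x'' where x'': "fst x'' = fst x'" "equiv_flags (x', N 0, rot u, rot v) (x'', N 0, rot (rot u), rot (rot v))"
      using equiv_rot_N0[of x' "rot u" "rot v"] unfolding equiv_flags_def by blast
    show ?thesis using x'(1) x''(1) equiv_trans[OF x'(2) x''(2)] by metis
  qed
  have **: "\<exists>x'. fst x' = fst x \<and> equiv_flags (x, N 0, u, v) (x', N 0, rot (rot (rot u)), rot (rot (rot v)))"
    if xuv: "(x, N 0, u, v) \<in> \<Omega>" for x u v
  proof -
    obtain x' where x': "fst x' = fst x" "equiv_flags (x, N 0, u, v) (x', N 0, rot (rot u), rot (rot v))"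
      using *[OF xuv] by blast
    then obtain x'' where x'': "fst x'' = fst x'"
      "equiv_flags (x', N 0, rot (rot u), rot (rot v)) (x'', N 0, rot (rot (rot u)), rot (rot (rot v)))"
      using equiv_rot_N0[of x' "rot (rot u)" "rot (rot v)"] unfolding equiv_flags_def by blast
    show ?thesis using x'(1) x''(1) equiv_trans[OF x'(2) x''(2)] by metis
  qed
  have uv: "(u, v) \<in> frames" using assms by (simp add: mem_\<Omega>)
  have rot10: "rot (1, 0) = (0, 1)" by (simp add: rot_def)
  have rot_inj: "rot a = rot b \<longleftrightarrow> a = b" for a b by (auto simp: rot_def prod_eq_iff)
  have "u = (1, 0) \<or> rot u = (1, 0) \<or> rot (rot u) = (1, 0) \<or> rot (rot (rot u)) = (1, 0)"
    using uv unfolding frames_eq by (auto simp: rot_def)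
  then have "\<exists>x' v'. fst x' = fst x \<and> (v' = rot (1, 0)) = (v = rot u) \<and>
      equiv_flags (x, N 0, u, v) (x', N 0, (1, 0), v')"
  proof (elim disjE)
    assume u: "u = (1, 0)"
    show ?thesis using equiv_refl[OF assms] unfolding u by blast
  next
    assume u: "rot u = (1, 0)"
    show ?thesis using equiv_rot_N0[OF assms] rot_inj[of v "rot u"] unfolding u by blast
  next
    assume u: "rot (rot u) = (1, 0)"
    show ?thesis
      using *[OF assms] rot_inj[of v "rot u"] rot_inj[of "rot v" "rot (rot u)"] unfolding u by blast
  next
    assume u: "rot (rot (rot u)) = (1, 0)"
    show ?thesis
      using **[OF assms] rot_inj[of v "rot u"] rot_inj[of "rot v" "rot (rot u)"]
        rot_inj[of "rot (rot v)" "rot (rot (rot u))"] unfolding u by blast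
  qed
  then obtain x' v' where x': "fst x' = fst x" "(v' = (0, 1)) = (v = rot u)"
    "equiv_flags (x, N 0, u, v) (x', N 0, (1, 0), v')" unfolding rot10 by blast
  have "((1, 0), v') \<in> frames" using x'(3) unfolding equiv_flags_def mem_\<Omega> by blast
  then have v'_cases: "v' = (0, 1) \<or> v' = (0, -1)" unfolding frames_eq by auto
  show ?thesis
  proof (cases "v' = (0, 1)")
    case True
    then show ?thesis using x' by metis
  next
    case False
    then have v': "v' = (0, -1)" using v'_cases by blast
    obtain p i j q c where xx: "x' = (p, i, j, q, c)" by (cases x')
    have "equiv_flags (x', N 0, (1, 0), v') ((\<not> p, i, j, q \<noteq> j, c \<noteq> j), N 0, (1, 0), (0, 1))"
      using equiv_mirror[of p i j q c "N 0" "(1, 0)" "(0, -1)"] x'(3)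
      unfolding xx v' N_linear_N0 equiv_flags_def by (simp add: mirror_def)
    then have "equiv_flags (x, N 0, u, v) ((\<not> p, i, j, q \<noteq> j, c \<noteq> j), N 0, (1, 0), (0, 1))"
      using equiv_trans[OF x'(3)] by blast
    then show ?thesis using x'(1,2) False unfolding xx by (metis fst_conv)
  qed
qed

lemma equiv_base_flag:
  assumes w: "w \<in> \<Omega>"
  shows "equiv_flags w (base_flag (par w))"
proof -
  obtain x t u v where w': "w = (x, t, u, v)" using w by (rule \<Omega>E)
  obtain x1 where x1: "fst x1 = fst x" "equiv_flags (x, t, u, v) (x1, N (t + - t), u, v)"
    using equiv_translate[of x t u v "- t"] w w' by blast
  then have x1: "fst x1 = fst x" "equiv_flags (x, t, u, v) (x1, N 0, u, v)" by simp_all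
  then obtain x2 where x2: "fst x2 = (fst x1 = (v = rot u))" "equiv_flags (x1, N 0, u, v) (x2, N 0, (1, 0), (0, 1))"
    using equiv_standard_frame[of x1 u v] unfolding equiv_flags_def by blast
  let ?f = "\<lambda>x. (x, N 0, (1, 0), (0, 1))"
  have f: "?f x \<in> \<Omega>" for x by (rule N0_mem)
  obtain p i j q c where x2': "x2 = (p, i, j, q, c)" by (cases x2)
  \<comment> \<open>The bits are cleared in the order \<open>c\<close>, \<open>q\<close>,
    \<open>j\<close>, \<open>i\<close>: switching \<open>i\<close> adds \<open>j\<close> to
    \<open>c\<close>, which is harmless once \<open>j\<close> is false.\<close>
  have "equiv_flags (?f (p, i, j, q, c)) (?f (p, i, j, q, False))"
    using equiv_cell(1)[OF f, of p i j q c] equiv_refl[OF f] by (cases c) auto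
  also have "equiv_flags \<dots> (?f (p, i, j, False, False))"
    using equiv_cell(2)[OF f, of p i j q False] equiv_refl[OF f] by (cases q) auto
  finally (equiv_trans) have "equiv_flags (?f x2) (?f (p, i, j, False, False))" unfolding x2' .
  also have "equiv_flags \<dots> (?f (p, i, False, False, False))"
    using equiv_cell(3)[OF f, of p i j False False] equiv_refl[OF f] by (cases j) auto
  finally (equiv_trans) have "equiv_flags (?f x2) (?f (p, i, False, False, False))" .
  also have "equiv_flags \<dots> (?f (p, False, False, False, False))"
    using equiv_cell(4)[OF f, of p i False False False] equiv_refl[OF f] by (cases i) auto
  finally (equiv_trans) have 3: "equiv_flags (?f x2) (?f (p, False, False, False, False))" .
  have "p = par w" using x1(1) x2(1) by (simp add: x2' w' par_def)
  then show ?thesis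
    using equiv_trans[OF equiv_trans[OF x1(2) x2(2)] 3] unfolding base_flag_def w' by simp
qed

text \<open>\<open>r 0\<close>, \<open>r 1\<close> and \<open>r 2\<close> treat the torus
  coordinates alike in all facets and connect the flags of one facet. An automorphism that matches
  two facets in this way therefore also matches the facets reached from them by crossing the same
  sequence of squares.\<close>

lemma centralizer_same_torus_flag:
  assumes \<gamma>: "\<gamma> \<in> P.centralizer" and w: "(x, t, u, v) \<in> \<Omega>" "\<gamma> (x, t, u, v) = (y, t, u, v)"
    and "(x, t', u', v') \<in> \<Omega>"
  shows "\<gamma> (x, t', u', v') = (y, t', u', v')"
proof -
  have "(x, t', u', v') \<in> orb r {0, 1, 2} (x, t, u, v)"
    by (rule orb_torus) (use assms in auto)
  then have "(x, t', u', v') \<in> \<Omega> \<and> \<gamma> (x, t', u', v') = (y, snd (x, t', u', v')) \<and> fst (x, t', u', v') = x"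
  proof (rule orb_invariant[where P = "\<lambda>w. w \<in> \<Omega> \<and> \<gamma> w = (y, snd w) \<and> fst w = x"])
    fix z :: flag and j :: int
    assume z: "z \<in> \<Omega> \<and> \<gamma> z = (y, snd z) \<and> fst z = x" and j: "j \<in> {0, 1, 2}"
    then have "j \<in> {0..<int 4}" by auto
    moreover obtain a b c where z': "z = (x, a, b, c)" using z by (cases z) auto
    ultimately show "r j z \<in> \<Omega> \<and> \<gamma> (r j z) = (y, snd (r j z)) \<and> fst (r j z) = x"
      using z j r_closed[of j z] P.centralizer_r[OF \<gamma>, of j z] by auto
  qed (use w in auto)
  then show ?thesis by simp
qed

lemma not_equiv_base_flags: "\<not> equiv_flags (base_flag False) (base_flag True)"
proof
  assume "equiv_flags (base_flag False) (base_flag True)"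
  then obtain \<gamma> where \<gamma>: "\<gamma> \<in> P.centralizer" "\<gamma> (base_flag False) = base_flag True"
    unfolding equiv_flags_def by blast
  let ?f = "\<lambda>x. (x, N 0, (1, 0), (0, 1))"
  have f: "(x, N s, (1, 0), (0, 1)) \<in> \<Omega>" for x s using N0_mem by (simp add: mem_\<Omega>)
  have step: "\<gamma> (?f (glue s x)) = ?f (glue s y)" if "\<gamma> (?f x) = ?f y" for s x y
  proof -
    have "\<gamma> (x, N s, (1, 0), (0, 1)) = (y, N s, (1, 0), (0, 1))"
      by (rule centralizer_same_torus_flag[OF \<gamma>(1) f that f])
    then have "\<gamma> (glue s x, N s, (1, 0), (0, 1)) = (glue s y, N s, (1, 0), (0, 1))"
      using P.centralizer_r[OF \<gamma>(1), of 3 "(x, N s, (1, 0), (0, 1))"] f by simp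
    then show ?thesis by (rule centralizer_same_torus_flag[OF \<gamma>(1) f _ f])
  qed
  have "\<gamma> (?f (False, False, False, False, False)) = ?f (True, False, False, False, False)"
    using \<gamma>(2) by (simp add: base_flag_def)
  \<comment> \<open>Crossing these four squares leads from the base facet back to itself, but not so from its
    neighbour across the square \<open>0\<close>.\<close>
  moreover from step[OF step[OF step[OF step[OF this, of "(0, 1)"], of "(2, 0)"], of "(1, 0)"], of "(1, 1)"]
  have "\<gamma> (?f (False, False, False, False, False)) = ?f (True, False, False, False, True)"
    by (simp add: colour_def)
  ultimately show False by simp
qed

lemma equiv_iff_par:
  assumes "v \<in> \<Omega>" "w \<in> \<Omega>"
  shows "equiv_flags v w \<longleftrightarrow> par v = par w"
proof
  assume "par v = par w"
  then have "equiv_flags v (base_flag (par w))" using equiv_base_flag[OF assms(1)] by simp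
  then show "equiv_flags v w" by (rule equiv_trans[OF _ equiv_sym[OF equiv_base_flag[OF assms(2)]]])
next
  assume vw: "equiv_flags v w"
  have "equiv_flags (base_flag (par v)) (base_flag (par w))"
    by (rule equiv_trans[OF equiv_sym[OF equiv_base_flag] equiv_trans[OF vw equiv_base_flag]]) (use assms in auto)
  then show "par v = par w"
    using not_equiv_base_flags equiv_sym[of "base_flag True" "base_flag False"]
    by (cases "par v"; cases "par w") auto
qed

sublocale P: chiral_flag_system 4 \<Omega> r "orbit_label 4 r" par
proof
  show "par (r j w) \<longleftrightarrow> \<not> par w" if "j \<in> {0..<int 4}" "w \<in> \<Omega>" for j w
    by (rule par_r[OF that])
  show "\<exists>\<gamma> \<in> P.centralizer. \<gamma> v = w" if "v \<in> \<Omega>" "w \<in> \<Omega>" "par v = par w" for v w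
    using equiv_iff_par that unfolding equiv_flags_def by blast
  show "par (\<gamma> w) = par w" if "\<gamma> \<in> P.centralizer" "w \<in> \<Omega>" for \<gamma> w
    using equiv_iff_par[of w "\<gamma> w"] P.centralizer_mem[OF that] that unfolding equiv_flags_def by blast
qed simp

lemma schlafli_type: "has_schlafli_type 4 P.le P.rk [4, 4, 4]"
proof -
  have "has_schlafli_type 4 P.le P.rk (replicate (4 - 1) 4)"
  proof (rule P.schlafli_type_4)
    fix i w assume i: "i \<in> {1..<int 4}" and w: "w \<in> \<Omega>"
    obtain x t u v where w': "w = (x, t, u, v)" "t \<in> range N" "(u, v) \<in> frames" using w by (rule \<Omega>E)
    note t = N_range[OF w'(2)]
    have uv: "u \<in> units" "u \<noteq> - u" "- u \<noteq> u" using framesD[OF w'(3)] unit_neq_uminus by blast+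
    have "i = 1 \<or> i = 2 \<or> i = 3" using i by auto
    then show "((\<lambda>v. r i (r (i - 1) v)) ^^ 4) w = w \<and> ((\<lambda>v. r i (r (i - 1) v)) ^^ 2) w \<noteq> w"
    proof (elim disjE)
      assume "i = 3"
      then show ?thesis
        using t uv glue_commute[OF uv(1), of t] glue_glue_neq[OF uv(1), of t x]
        unfolding w' by (simp add: numeral_eq_Suc)
    qed (use t uv in \<open>auto simp: w' numeral_eq_Suc algebra_simps\<close>)
  qed
  then show ?thesis by (simp add: numeral_eq_Suc)
qed

lemma card_\<Omega>: "card \<Omega> = 256 * card (range N)"
proof -
  have "card \<Omega> = card (UNIV :: cell set) * (card (range N) * card frames)"
    unfolding \<Omega>_def by (simp only: card_cartesian_product)
  also have "card (UNIV :: cell set) = 32"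
    by (simp add: card_cartesian_product flip: UNIV_Times_UNIV)
  finally show ?thesis using card_frames by simp
qed

lemma order_aut: "order (aut_group P.le) = 128 * card (range N)"
  using P.double_order_aut_group card_\<Omega> by simp

end

section \<open>Solvability\<close>

context square_torus
begin

text \<open>Used with \<open>a\<close> and \<open>b\<close> equal to 1 or -1, as the commuting
  reflections in the two coordinate axes.\<close>

definition scale :: "int \<Rightarrow> int \<Rightarrow> int \<times> int \<Rightarrow> int \<times> int" where
  "scale a b u = (a * fst u, b * snd u)"

definition tile_of :: "flag \<Rightarrow> int \<times> int" where "tile_of w = fst (snd w)"
definition frame_of :: "flag \<Rightarrow> (int \<times> int) \<times> (int \<times> int)" where "frame_of w = snd (snd w)"
definition axis_of :: "flag \<Rightarrow> bool" where "axis_of w \<longleftrightarrow> fst (fst (frame_of w)) = 0"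
definition sheet_of :: "flag \<Rightarrow> bool" where "sheet_of w = snd (snd (snd (snd (fst w))))"
definition coords :: "cell \<Rightarrow> bool \<times> bool \<times> bool \<times> bool" where
  "coords x = (case x of (p, i, j, q, c) \<Rightarrow> (p, i, j, q))"
definition coords_of :: "flag \<Rightarrow> bool \<times> bool \<times> bool \<times> bool" where "coords_of w = coords (fst w)"

definition xor4 :: "bool \<times> bool \<times> bool \<times> bool \<Rightarrow> bool \<times> bool \<times> bool \<times> bool \<Rightarrow> bool \<times> bool \<times> bool \<times> bool" where
  "xor4 k l = (case (k, l) of ((p, i, j, q), (p', i', j', q')) \<Rightarrow> (p \<noteq> p', i \<noteq> i', j \<noteq> j', q \<noteq> q'))"

lemma xor4_left_commute: "xor4 a (xor4 b k) = xor4 b (xor4 a k)"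
  by (cases a; cases b; cases k) (simp only: xor4_def prod.case prod.inject, argo)

lemma coords_flip: "coords (flip (a, b, d) x) = xor4 (True, a, b, d) (coords x)"
  by (cases x) (auto simp: coords_def xor4_def)

lemma flag_eqI:
  assumes "coords_of v = coords_of w" "sheet_of v = sheet_of w" "tile_of v = tile_of w" "frame_of v = frame_of w"
  shows "v = w"
  using assms by (cases v; cases w) (auto simp: coords_of_def coords_def sheet_of_def tile_of_def frame_of_def)

lemma axis_of_r:
  assumes "j \<in> {0..<int 4}" "w \<in> \<Omega>"
  shows "axis_of (r j w) = (axis_of w \<noteq> (j = 1))"
proof -
  obtain x t u v where w: "w = (x, t, u, v)" "(u, v) \<in> frames" using assms(2) by (rule \<Omega>E)
  have "(fst v = 0) = (fst u \<noteq> 0)"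
    using w(2) unfolding frames_eq by (elim insertE emptyE Pair_inject; simp)
  then show ?thesis
    using assms(1) unfolding w(1) idx4 by (auto simp: axis_of_def frame_of_def)
qed

lemma centralizer_axis:
  assumes "\<gamma> \<in> P.centralizer"
  shows "\<exists>k. \<forall>w \<in> \<Omega>. axis_of (\<gamma> w) = (axis_of w \<noteq> k)"
proof (intro exI ballI)
  let ?k = "axis_of (\<gamma> (base_flag True)) \<noteq> axis_of (base_flag True)"
  fix w assume "w \<in> \<Omega>"
  show "axis_of (\<gamma> w) = (axis_of w \<noteq> ?k)"
    by (rule P.centralizer_invariant[OF assms base_flag_mem[of True] \<open>w \<in> \<Omega>\<close>,
        where P = "\<lambda>x y. axis_of y = (axis_of x \<noteq> ?k)"]) (auto simp: axis_of_r)
qed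

text \<open>With the axes preserved, the standard frame goes to itself up to two signs, and these
  signs act on all frames alike. Such sign changes commute, unlike the full symmetry group of the
  square; this is why \<open>axis_of\<close> is split off first.\<close>

lemma centralizer_frame:
  assumes \<gamma>: "\<gamma> \<in> P.centralizer" and axis: "\<forall>w \<in> \<Omega>. axis_of (\<gamma> w) = axis_of w"
  shows "\<exists>a b. \<forall>w \<in> \<Omega>. frame_of (\<gamma> w) = map_prod (scale a b) (scale a b) (frame_of w)"
proof -
  obtain x t u v where b: "\<gamma> (base_flag True) = (x, t, u, v)" "(u, v) \<in> frames"
    using P.centralizer_mem[OF \<gamma> base_flag_mem[of True]] by (rule \<Omega>E)
  have "axis_of (\<gamma> (base_flag True)) = axis_of (base_flag True)" using axis base_flag_mem by blast
  then have "fst u \<noteq> 0" unfolding b by (simp add: axis_of_def frame_of_def base_flag_def)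
  then have uv: "u = (fst u, 0)" "v = (0, snd v)"
    using b(2) unfolding frames_eq by auto
  have scale_uminus: "scale a b (- z) = - scale a b z" for a b z by (simp add: scale_def prod_eq_iff)
  let ?P = "\<lambda>x y. frame_of y = map_prod (scale (fst u) (snd v)) (scale (fst u) (snd v)) (frame_of x)"
  have "?P w (\<gamma> w)" if "w \<in> \<Omega>" for w
  proof (rule P.centralizer_invariant[OF \<gamma> base_flag_mem[of True] that, where P = ?P])
    show "?P (base_flag True) (\<gamma> (base_flag True))"
      unfolding b using uv by (simp add: frame_of_def base_flag_def scale_def)
    fix j y z assume "j \<in> {0..<int 4}" and P: "?P y z"
    obtain xy ty uy vy where y: "y = (xy, ty, uy, vy)" by (cases y)
    obtain xz tz uz vz where z: "z = (xz, tz, uz, vz)" by (cases z)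
    show "?P (r j y) (r j z)"
      using \<open>j \<in> {0..<int 4}\<close> P unfolding y z idx4 by (auto simp: frame_of_def scale_uminus)
  qed
  then show ?thesis by blast
qed

lemma centralizer_tile:
  assumes \<gamma>: "\<gamma> \<in> P.centralizer" and frame: "\<forall>w \<in> \<Omega>. frame_of (\<gamma> w) = frame_of w"
  shows "\<exists>s. \<forall>w \<in> \<Omega>. tile_of (\<gamma> w) = N (tile_of w + s)"
proof -
  let ?b = "base_flag True"
  define s where "s = tile_of (\<gamma> ?b) - tile_of ?b"
  \<comment> \<open>The frames belong to the invariant because \<open>r 2\<close> moves the tile by
    \<open>u\<close>, so the shift stays constant only while the frames agree.\<close>
  let ?P = "\<lambda>x y. frame_of y = frame_of x \<and> tile_of y = N (tile_of x + s)"
  have "?P w (\<gamma> w)" if "w \<in> \<Omega>" for w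
  proof (rule P.centralizer_invariant[OF \<gamma> base_flag_mem[of True] that, where P = ?P])
    have "tile_of (\<gamma> ?b) \<in> range N"
      using P.centralizer_mem[OF \<gamma> base_flag_mem[of True]] unfolding \<Omega>_def tile_of_def by auto
    from N_range[OF this] have "tile_of (\<gamma> ?b) = N (tile_of ?b + s)" by (simp add: s_def)
    then show "?P ?b (\<gamma> ?b)" using frame base_flag_mem[of True] by blast
    fix j y z assume "j \<in> {0..<int 4}" and P: "?P y z"
    obtain xy t u v where y: "y = (xy, t, u, v)" by (cases y)
    obtain xz where z: "z = (xz, N (t + s), u, v)" using P y by (cases z) (auto simp: frame_of_def tile_of_def)
    have "N (t + s + u) = N (t + u + s)" by (simp add: ac_simps)
    then show "?P (r j y) (r j z)"
      using \<open>j \<in> {0..<int 4}\<close> unfolding y z idx4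
      by (elim disjE) (simp_all add: frame_of_def tile_of_def)
  qed
  then show ?thesis by blast
qed

text \<open>By \<open>coords_flip\<close> each gluing translates the coordinates by a vector that
  depends only on the colour of the square. Once the squares are fixed, a flag and its image are
  translated alike.\<close>

lemma centralizer_coords:
  assumes \<gamma>: "\<gamma> \<in> P.centralizer"
    and snd: "\<forall>w \<in> \<Omega>. frame_of (\<gamma> w) = frame_of w" "\<forall>w \<in> \<Omega>. tile_of (\<gamma> w) = tile_of w"
  shows "\<exists>k. \<forall>w \<in> \<Omega>. coords_of (\<gamma> w) = xor4 k (coords_of w)"
proof -
  let ?b = "base_flag True"
  let ?k = "xor4 (coords_of ?b) (coords_of (\<gamma> ?b))"
  let ?P = "\<lambda>x y. snd y = snd x \<and> coords_of y = xor4 ?k (coords_of x)"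
  have "?P w (\<gamma> w)" if "w \<in> \<Omega>" for w
  proof (rule P.centralizer_invariant[OF \<gamma> base_flag_mem[of True] that, where P = ?P])
    have "snd (\<gamma> ?b) = snd ?b"
      using snd base_flag_mem[of True] by (simp add: frame_of_def tile_of_def prod_eq_iff)
    moreover have "xor4 (xor4 k l) k = l" for k l
      by (cases k; cases l) (simp only: xor4_def prod.case prod.inject, argo)
    ultimately show "?P ?b (\<gamma> ?b)" by simp
    fix j y z assume j: "j \<in> {0..<int 4}" and P: "?P y z"
    obtain xy t u v where y: "y = (xy, t, u, v)" by (cases y)
    obtain xz where z: "z = (xz, t, u, v)" using P y by (cases z) auto
    obtain a b d where c: "colour t = (a, b, d)" by (cases "colour t")
    have "coords xz = xor4 ?k (coords xy)" using P unfolding y z by (simp add: coords_of_def)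
    then show "?P (r j y) (r j z)"
      using j unfolding y z idx4 by (auto simp: c coords_of_def coords_flip xor4_left_commute)
  qed
  then show ?thesis by blast
qed

text \<open>The amount that a gluing adds to \<open>c\<close> depends only on the colour and the
  other coordinates, which agree here for a flag and its image.\<close>

lemma centralizer_sheet:
  assumes \<gamma>: "\<gamma> \<in> P.centralizer"
    and fixed: "\<forall>w \<in> \<Omega>. frame_of (\<gamma> w) = frame_of w" "\<forall>w \<in> \<Omega>. tile_of (\<gamma> w) = tile_of w"
      "\<forall>w \<in> \<Omega>. coords_of (\<gamma> w) = coords_of w"
  shows "\<exists>k. \<forall>w \<in> \<Omega>. sheet_of (\<gamma> w) = (sheet_of w \<noteq> k)"
proof -
  let ?b = "base_flag True"
  let ?k = "sheet_of (\<gamma> ?b) \<noteq> sheet_of ?b"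
  let ?P = "\<lambda>x y. snd y = snd x \<and> coords_of y = coords_of x \<and> (sheet_of y \<noteq> sheet_of x) = ?k"
  have "?P w (\<gamma> w)" if "w \<in> \<Omega>" for w
  proof (rule P.centralizer_invariant[OF \<gamma> base_flag_mem[of True] that, where P = ?P])
    show "?P ?b (\<gamma> ?b)"
      using fixed base_flag_mem[of True] by (simp add: frame_of_def tile_of_def prod_eq_iff)
    fix j y z assume j: "j \<in> {0..<int 4}" and P: "?P y z"
    obtain p i jj q c t u v where y: "y = ((p, i, jj, q, c), t, u, v)" by (cases y) auto
    obtain c' where z: "z = ((p, i, jj, q, c'), t, u, v)" using P y by (cases z) (auto simp: coords_of_def coords_def)
    obtain a b d where col: "colour t = (a, b, d)" by (cases "colour t")
    have k: "(c' \<noteq> c) = ?k" using P unfolding y z by (simp add: sheet_of_def)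
    show "?P (r j y) (r j z)"
      unfolding k[symmetric] using j unfolding y z idx4 by (auto simp: col coords_of_def coords_def sheet_of_def)
  qed
  then have "\<forall>w \<in> \<Omega>. sheet_of (\<gamma> w) = (sheet_of w \<noteq> ?k)" by blast
  then show ?thesis by blast
qed

text \<open>
  On the subgroup that preserves the previous ones, each of the maps \<open>axis_of\<close>, \<open>frame_of\<close>,
  \<open>tile_of\<close>, \<open>coords_of\<close>, \<open>sheet_of\<close> is changed by an automorphism only through an element of an
  abelian group.
\<close>

lemma solvable_centralizer: "solvable_seq (BijGroup \<Omega>) P.centralizer"
proof (rule derived_BijGroup_invariant[where f = axis_of, OF P.subgroup_centralizer])
  show "axis_of (\<gamma> (\<delta> w)) = axis_of (\<delta> (\<gamma> w))"
    if "\<gamma> \<in> P.centralizer" "\<delta> \<in> P.centralizer" "w \<in> \<Omega>" for \<gamma> \<delta> w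
    using centralizer_axis[OF that(1)] centralizer_axis[OF that(2)] P.centralizer_mem that by metis
  let ?H1 = "{\<gamma> \<in> P.centralizer. \<forall>w \<in> \<Omega>. axis_of (\<gamma> w) = axis_of w}"
  let ?H2 = "{\<gamma> \<in> ?H1. \<forall>w \<in> \<Omega>. frame_of (\<gamma> w) = frame_of w}"
  let ?H3 = "{\<gamma> \<in> ?H2. \<forall>w \<in> \<Omega>. tile_of (\<gamma> w) = tile_of w}"
  let ?H4 = "{\<gamma> \<in> ?H3. \<forall>w \<in> \<Omega>. coords_of (\<gamma> w) = coords_of w}"
  let ?H5 = "{\<gamma> \<in> ?H4. \<forall>w \<in> \<Omega>. sheet_of (\<gamma> w) = sheet_of w}"
  assume H1: "subgroup ?H1 (BijGroup \<Omega>)"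
  show "solvable_seq (BijGroup \<Omega>) ?H1"
  proof (rule derived_BijGroup_invariant[where f = frame_of, OF H1])
    show "frame_of (\<gamma> (\<delta> w)) = frame_of (\<delta> (\<gamma> w))" if *: "\<gamma> \<in> ?H1" "\<delta> \<in> ?H1" "w \<in> \<Omega>" for \<gamma> \<delta> w
    proof -
      have \<gamma>: "\<gamma> \<in> P.centralizer" "\<forall>w \<in> \<Omega>. axis_of (\<gamma> w) = axis_of w"
        and \<delta>: "\<delta> \<in> P.centralizer" "\<forall>w \<in> \<Omega>. axis_of (\<delta> w) = axis_of w" using * by auto
      obtain a b where 1: "\<forall>w \<in> \<Omega>. frame_of (\<gamma> w) = map_prod (scale a b) (scale a b) (frame_of w)"
        using centralizer_frame[OF \<gamma>] by blast
      obtain a' b' where 2: "\<forall>w \<in> \<Omega>. frame_of (\<delta> w) = map_prod (scale a' b') (scale a' b') (frame_of w)"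
        using centralizer_frame[OF \<delta>] by blast
      show ?thesis
        using 1 2 P.centralizer_mem[OF \<gamma>(1) *(3)] P.centralizer_mem[OF \<delta>(1) *(3)] *(3)
        by (simp add: prod_eq_iff scale_def)
    qed
    assume H2: "subgroup ?H2 (BijGroup \<Omega>)"
    show "solvable_seq (BijGroup \<Omega>) ?H2"
    proof (rule derived_BijGroup_invariant[where f = tile_of, OF H2])
      show "tile_of (\<gamma> (\<delta> w)) = tile_of (\<delta> (\<gamma> w))" if *: "\<gamma> \<in> ?H2" "\<delta> \<in> ?H2" "w \<in> \<Omega>" for \<gamma> \<delta> w
      proof -
        have \<gamma>: "\<gamma> \<in> P.centralizer" "\<forall>w \<in> \<Omega>. frame_of (\<gamma> w) = frame_of w"
          and \<delta>: "\<delta> \<in> P.centralizer" "\<forall>w \<in> \<Omega>. frame_of (\<delta> w) = frame_of w" using * by auto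
        obtain s where 1: "\<forall>w \<in> \<Omega>. tile_of (\<gamma> w) = N (tile_of w + s)"
          using centralizer_tile[OF \<gamma>] by blast
        obtain s' where 2: "\<forall>w \<in> \<Omega>. tile_of (\<delta> w) = N (tile_of w + s')"
          using centralizer_tile[OF \<delta>] by blast
        show ?thesis
          using 1 2 P.centralizer_mem[OF \<gamma>(1) *(3)] P.centralizer_mem[OF \<delta>(1) *(3)] *(3)
          by (simp add: algebra_simps)
      qed
      assume H3: "subgroup ?H3 (BijGroup \<Omega>)"
      show "solvable_seq (BijGroup \<Omega>) ?H3"
      proof (rule derived_BijGroup_invariant[where f = coords_of, OF H3])
        show "coords_of (\<gamma> (\<delta> w)) = coords_of (\<delta> (\<gamma> w))" if *: "\<gamma> \<in> ?H3" "\<delta> \<in> ?H3" "w \<in> \<Omega>" for \<gamma> \<delta> w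
        proof -
          have \<gamma>: "\<gamma> \<in> P.centralizer" "\<forall>w \<in> \<Omega>. frame_of (\<gamma> w) = frame_of w" "\<forall>w \<in> \<Omega>. tile_of (\<gamma> w) = tile_of w"
            and \<delta>: "\<delta> \<in> P.centralizer" "\<forall>w \<in> \<Omega>. frame_of (\<delta> w) = frame_of w" "\<forall>w \<in> \<Omega>. tile_of (\<delta> w) = tile_of w"
            using * by auto
          obtain k where 1: "\<forall>w \<in> \<Omega>. coords_of (\<gamma> w) = xor4 k (coords_of w)"
            using centralizer_coords[OF \<gamma>] by blast
          obtain k' where 2: "\<forall>w \<in> \<Omega>. coords_of (\<delta> w) = xor4 k' (coords_of w)"
            using centralizer_coords[OF \<delta>] by blast
          show ?thesis
            using 1 2 P.centralizer_mem[OF \<gamma>(1) *(3)] P.centralizer_mem[OF \<delta>(1) *(3)] *(3)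
            by (simp add: xor4_left_commute)
        qed
        assume H4: "subgroup ?H4 (BijGroup \<Omega>)"
        show "solvable_seq (BijGroup \<Omega>) ?H4"
        proof (rule derived_BijGroup_invariant[where f = sheet_of, OF H4])
          show "sheet_of (\<gamma> (\<delta> w)) = sheet_of (\<delta> (\<gamma> w))" if *: "\<gamma> \<in> ?H4" "\<delta> \<in> ?H4" "w \<in> \<Omega>" for \<gamma> \<delta> w
          proof -
            have \<gamma>: "\<gamma> \<in> P.centralizer" "\<forall>w \<in> \<Omega>. frame_of (\<gamma> w) = frame_of w" "\<forall>w \<in> \<Omega>. tile_of (\<gamma> w) = tile_of w"
              "\<forall>w \<in> \<Omega>. coords_of (\<gamma> w) = coords_of w"
              and \<delta>: "\<delta> \<in> P.centralizer" "\<forall>w \<in> \<Omega>. frame_of (\<delta> w) = frame_of w" "\<forall>w \<in> \<Omega>. tile_of (\<delta> w) = tile_of w"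
              "\<forall>w \<in> \<Omega>. coords_of (\<delta> w) = coords_of w"
              using * by auto
            obtain k where 1: "\<forall>w \<in> \<Omega>. sheet_of (\<gamma> w) = (sheet_of w \<noteq> k)"
              using centralizer_sheet[OF \<gamma>] by blast
            obtain k' where 2: "\<forall>w \<in> \<Omega>. sheet_of (\<delta> w) = (sheet_of w \<noteq> k')"
              using centralizer_sheet[OF \<delta>] by blast
            have "sheet_of (\<gamma> (\<delta> w)) = ((sheet_of w \<noteq> k') \<noteq> k)" "sheet_of (\<delta> (\<gamma> w)) = ((sheet_of w \<noteq> k) \<noteq> k')"
              using 1 2 P.centralizer_mem[OF \<gamma>(1) *(3)] P.centralizer_mem[OF \<delta>(1) *(3)] *(3) by simp_all
            then show ?thesis by argo
          qed
          assume H5: "subgroup ?H5 (BijGroup \<Omega>)"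
          \<comment> \<open>The preserved data determine a flag, so these automorphisms fix the base
            flag, and the action is free.\<close>
          have "?H5 = {\<one>\<^bsub>BijGroup \<Omega>\<^esub>}"
          proof (intro equalityI subsetI)
            fix \<gamma> assume \<gamma>: "\<gamma> \<in> ?H5"
            then have C: "\<gamma> \<in> P.centralizer" by simp
            have "\<one>\<^bsub>BijGroup \<Omega>\<^esub> \<in> P.centralizer"
              by (rule subgroup.one_closed[OF P.subgroup_centralizer])
            moreover have "\<gamma> (base_flag True) = \<one>\<^bsub>BijGroup \<Omega>\<^esub> (base_flag True)"
            proof -
              have "\<gamma> (base_flag True) = base_flag True"
                by (rule flag_eqI) (use \<gamma> base_flag_mem[of True] in auto)
              then show ?thesis using base_flag_mem[of True] by (simp add: BijGroup_def)
            qed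
            ultimately show "\<gamma> \<in> {\<one>\<^bsub>BijGroup \<Omega>\<^esub>}"
              using P.centralizer_eqI[OF C _ base_flag_mem[of True]] by blast
          qed (use subgroup.one_closed[OF H5] in blast)
          then show "solvable_seq (BijGroup \<Omega>) ?H5" by (simp only: solvable_seq.unity)
        qed
      qed
    qed
  qed
qed

theorem chiral_444:
  "chiral_polytope 4 P.le P.rk" "has_schlafli_type 4 P.le P.rk [4, 4, 4]"
  "solvable (aut_group P.le)" "order (aut_group P.le) = 128 * card (range N)"
  using P.chiral_polytope schlafli_type P.solvable_aut_group[OF solvable_centralizer] order_aut by blast+

end

section \<open>The two families of lattices\<close>

lemma square_torus_axis:
  assumes "0 < k" and N: "\<And>a b. N (a, b) = (a mod (4 * k), b mod (4 * k))"
  shows "square_torus N {(a, b). 4 * k dvd a \<and> 4 * k dvd b}" and "card (range N) = (nat (4 * k))\<^sup>2"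
proof -
  have range: "range N = {0..<4 * k} \<times> {0..<4 * k}"
  proof (intro equalityI subsetI)
    fix t assume t: "t \<in> {0..<4 * k} \<times> {0..<4 * k}"
    then have "N t = t" by (cases t) (auto simp: N)
    then show "t \<in> range N" by (metis rangeI)
  qed (use assms(1) in \<open>auto simp: N\<close>)
  show "card (range N) = (nat (4 * k))\<^sup>2"
    unfolding range by (simp add: card_cartesian_product power2_eq_square)
  show "square_torus N {(a, b). 4 * k dvd a \<and> 4 * k dvd b}"
  proof
    show "finite (range N)" unfolding range by simp
    show "N s = N t \<longleftrightarrow> s - t \<in> {(a, b). 4 * k dvd a \<and> 4 * k dvd b}" for s t
      by (cases s; cases t) (simp add: N mod_eq_dvd_iff)
    show "even (fst t) \<and> 4 dvd fst t + snd t" if "t \<in> {(a, b). 4 * k dvd a \<and> 4 * k dvd b}" for t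
    proof -
      have "4 dvd fst t" "4 dvd snd t" using that by (auto intro: dvd_mult_left)
      then show ?thesis by (simp add: dvd_trans[of 2 4])
    qed
  qed (auto simp: N rot_def mirror_def zero_prod_def)
qed

text \<open>This is the lattice spanned by \<open>(2 * k, 2 * k)\<close> and
  \<open>(2 * k, - 2 * k)\<close>. A class is given by the first coordinate modulo
  \<open>2 * k\<close> and the coordinate sum modulo \<open>4 * k\<close>; \<open>N\<close> reduces
  these two and recovers the second coordinate by subtraction.\<close>

lemma square_torus_diagonal:
  assumes "0 < k"
    and N: "\<And>a b. N (a, b) = (a mod (2 * k), (a + b) mod (4 * k) - a mod (2 * k))"
  shows "square_torus N {(a, b). 2 * k dvd a \<and> 4 * k dvd a + b}" and "card (range N) = nat (8 * k\<^sup>2)"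
proof -
  \<comment> \<open>Both \<open>rot\<close> and \<open>mirror\<close> turn the coordinate sum
    \<open>a + b\<close> into \<open>a - b\<close>, and \<open>rot\<close> makes \<open>- b\<close>
    the first coordinate.\<close>
  have dvd: "2 * k dvd b" "4 * k dvd a - b" if "2 * k dvd a" "4 * k dvd a + b" for a b
  proof -
    have "2 * k dvd a + b" using that(2) by (rule dvd_trans[rotated]) simp
    then show b: "2 * k dvd b" using that(1) by (simp add: dvd_add_right_iff)
    then have "4 * k dvd 2 * b" by (auto elim!: dvdE)
    then have "4 * k dvd (a + b) - 2 * b" using that(2) by (rule dvd_diff[rotated])
    then show "4 * k dvd a - b" by simp
  qed
  let ?f = "\<lambda>(a, c). (a, c - a) :: int \<times> int"
  have range: "range N = ?f ` ({0..<2 * k} \<times> {0..<4 * k})"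
  proof (intro equalityI subsetI)
    fix t assume "t \<in> ?f ` ({0..<2 * k} \<times> {0..<4 * k})"
    then have "N t = t" by (cases t) (auto simp: N)
    then show "t \<in> range N" by (metis rangeI)
  next
    fix t assume "t \<in> range N"
    then obtain a b where "t = N (a, b)" by auto
    then show "t \<in> ?f ` ({0..<2 * k} \<times> {0..<4 * k})" 
      using assms(1) by (intro image_eqI[of _ _ "(a mod (2 * k), (a + b) mod (4 * k))"]) (simp_all add: N)
  qed
  have "inj_on ?f ({0..<2 * k} \<times> {0..<4 * k})" by (auto intro!: inj_onI)
  then have "card (range N) = nat (2 * k) * nat (4 * k)"
    unfolding range by (simp add: card_image card_cartesian_product)
  also have "\<dots> = nat (8 * k\<^sup>2)"
    using assms(1) by (simp add: power2_eq_square flip: nat_mult_distrib)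
  finally show "card (range N) = nat (8 * k\<^sup>2)" .
  show "square_torus N {(a, b). 2 * k dvd a \<and> 4 * k dvd a + b}"
  proof
    show "finite (range N)" unfolding range by simp
    show "N s = N t \<longleftrightarrow> s - t \<in> {(a, b). 2 * k dvd a \<and> 4 * k dvd a + b}" for s t
    proof -
      obtain a b c d where st: "s = (a, b)" "t = (c, d)" by (cases s; cases t)
      have "N s = N t \<longleftrightarrow> a mod (2 * k) = c mod (2 * k) \<and> (a + b) mod (4 * k) = (c + d) mod (4 * k)"
        unfolding st N by auto
      also have "\<dots> \<longleftrightarrow> 2 * k dvd a - c \<and> 4 * k dvd (a - c) + (b - d)"
        unfolding mod_eq_dvd_iff by (simp add: algebra_simps)
      finally show ?thesis by (simp add: st)
    qed
    show "N (N t) = N t" for t by (cases t) (simp add: N)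
    show "s - t \<in> {(a, b). 2 * k dvd a \<and> 4 * k dvd a + b}"
      if "s \<in> {(a, b). 2 * k dvd a \<and> 4 * k dvd a + b}" "t \<in> {(a, b). 2 * k dvd a \<and> 4 * k dvd a + b}" for s t
    proof -
      have "4 * k dvd (fst s + snd s) - (fst t + snd t)" using that by (intro dvd_diff) auto
      then show ?thesis using that by (auto simp: algebra_simps)
    qed
    show "rot t \<in> {(a, b). 2 * k dvd a \<and> 4 * k dvd a + b}" if "t \<in> {(a, b). 2 * k dvd a \<and> 4 * k dvd a + b}" for t
      using that dvd[of "fst t" "snd t"] by (auto simp: rot_def)
    show "mirror t \<in> {(a, b). 2 * k dvd a \<and> 4 * k dvd a + b}" if "t \<in> {(a, b). 2 * k dvd a \<and> 4 * k dvd a + b}" for t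
      using that dvd[of "fst t" "snd t"] by (auto simp: mirror_def)
    show "even (fst t) \<and> 4 dvd fst t + snd t" if "t \<in> {(a, b). 2 * k dvd a \<and> 4 * k dvd a + b}" for t
      using that by (auto intro: dvd_mult_left)
  qed (simp add: zero_prod_def)
qed

lemma exists_chiral_444:
  assumes "square_torus N \<Lambda>" "128 * card (range N) = k"
  shows "\<exists>(P :: nat rel) rkP. chiral_polytope 4 P rkP \<and> has_schlafli_type 4 P rkP [4, 4, 4] \<and>
    solvable (aut_group P) \<and> order (aut_group P) = k"
proof -
  interpret square_torus N \<Lambda> by (rule assms(1))
  show ?thesis using chiral_444 assms(2) by metis
qed

theorem theorem3p1:
  fixes m :: nat
  assumes "m \<ge> 1"
  shows "\<exists>(P :: nat rel) rkP (Q :: nat rel) rkQ.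
    chiral_polytope 4 P rkP \<and> has_schlafli_type 4 P rkP [4, 4, 4] \<and>
    solvable (aut_group P) \<and> order (aut_group P) = 1024 * m\<^sup>2 \<and>
    chiral_polytope 4 Q rkQ \<and> has_schlafli_type 4 Q rkQ [4, 4, 4] \<and>
    solvable (aut_group Q) \<and> order (aut_group Q) = 2048 * m\<^sup>2"
proof -
  have m: "0 < int m" using assms by simp
  define N where "N = (\<lambda>(a, b). (a mod (2 * int m), (a + b) mod (4 * int m) - a mod (2 * int m)))"
  define N' where "N' = (\<lambda>(a, b). (a mod (4 * int m), b mod (4 * int m)))"
  have N: "N (a, b) = (a mod (2 * int m), (a + b) mod (4 * int m) - a mod (2 * int m))"
    and N': "N' (a, b) = (a mod (4 * int m), b mod (4 * int m))" for a b
    by (simp_all add: N_def N'_def)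
  have "128 * card (range N) = 1024 * m\<^sup>2"
    unfolding square_torus_diagonal(2)[OF m N] by (simp add: nat_mult_distrib nat_power_eq)
  note P = exists_chiral_444[OF square_torus_diagonal(1)[OF m N] this]
  have "128 * card (range N') = 2048 * m\<^sup>2"
    unfolding square_torus_axis(2)[OF m N'] by (simp add: nat_mult_distrib power_mult_distrib)
  note Q = exists_chiral_444[OF square_torus_axis(1)[OF m N'] this]
  show ?thesis using P Q by blast
qed

end
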